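(* Let $U=\{\alpha_1,\ldots,\alpha_K\}\subset\mathbb{R}^m$ be a finite input set. Every ODE-RNN (every element of $\mathcal{F}_1$) and every ODE-LSTM (every element of $\mathcal{F}_2$) has a polynomial embedding. Moreover, if an input-output map $p:\mathcal{U}_{pco}\to\mathcal{S}_{pc}$ has a realization by an ODE-LSTM or by an ODE-RNN, then $p$ is causal, analytic, and $\mathrm{trdeg}\,\mathcal{A}_{obs}(p)<+\infty$.
   Context: **Function spaces.** For $Z\subset\mathbb{R}^k$: $\mathcal{Z}_{pc}$ and $\mathcal{Z}_{ac}$ are the sets of piecewise-continuous, resp. absolutely continuous, functions $[0,+\infty[\to Z$; $\mathcal{Z}_{pco}$ is the set of piecewise-constant functions $[0,+\infty[\to Z$ that are constant from some time on. The notation is used with $Z=X$ (state space), $Z=U$ (finite input set $U=\{\alpha_1,\dots,\alpha_K\}\subset\mathbb{R}^m$), $Z=S=\mathbb{R}^{\mathrm{p}}$ (output space), giving $\mathcal{X}_{ac},\mathcal{U}_{pco},\mathcal{S}_{pc}$. Each element of $\mathcal{U}_{pco}$ is of the form $u_{t_1,\ldots,t_l}^{\beta_1,\ldots,\beta_l}$ with $l\ge 1$, $\beta_i\in U$, $t_i\ge 0$, where, with $T_0=0$, $T_i=\sum_{j=1}^i t_j$, this function equals $\beta_i$ on $[T_{i-1},T_i[$ for $i=1,\dots,l$ and equals $\beta_l$ for $t\ge T_l$. **Class $\mathcal{F}$.** Systems $\Sigma=(f,g,x_0)$: $\dot x(t)=f(x(t),u(t))$, $y(t)=g(x(t))$,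 $t\ge 0$, $x(0)=x_0\in X=\mathbb{R}^n$, with $f:X\times U\to X$ analytic in its first argument and $g:X\to S$ analytic. Solutions are triples $(x,u,y)\in\mathcal{X}_{ac}\times\mathcal{U}_{pco}\times\mathcal{S}_{pc}$ satisfying these equations, including the initial condition. **Activation functions.** $\mathcal{C}_1^\omega(\mathbb{R})$ is the set of real analytic $\sigma:\mathbb{R}\to\mathbb{R}$ such that $\sigma'=P(\sigma)$ for some polynomial $P\in\mathbb{R}[X]$. For $\sigma:\mathbb{R}\to\mathbb{R}$, $\overrightarrow{\sigma}$ denotes componentwise application to vectors. $\odot$ is the componentwise (Hadamard) product. **ODE-RNN ($\mathcal{F}_1$).** Systems $\dot x(t)=\overrightarrow{\sigma}(Ax(t)+Bu(t))$, $y(t)=Cx(t)$, $x(0)=x_0\in\mathbb{R}^n$, with $\sigma\in\mathcal{C}_1^\omega(\mathbb{R})$ Lipschitz and $A\in\mathbb{R}^{n\times n}$, $B\in\mathbb{R}^{n\times m}$, $C\in\mathbb{R}^{\mathrm{p}\times n}$. **ODE-LSTM ($\mathcal{F}_2$).** Systems with state $s(t)=(x(t)^T,z(t)^T)^T\in\mathbb{R}^{2n}$ given by $$\dot x(t)=\mathfrak{U}^0x(t)+g^2(t)\odot x(t)+g^3(t)\odot g^1(t),\quad \dot z(t)=g^4(t),\quad y(t)=Cs(t),\quad s(0)=s_0\in\mathbb{R}^{2n},$$ where $g^i(t)=\overrightarrow{\sigma_i}(\mathfrak{U}^ih(t)+\mathfrak{W}^iu(t)+b^i)$ for $i=1,\dots,4$,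 $h(t)=z(t)\odot\overrightarrow{\sigma_5}(x(t))$, $\sigma_1,\dots,\sigma_5\in\mathcal{C}_1^\omega(\mathbb{R})$ are Lipschitz, $\mathfrak{U}^0,\dots,\mathfrak{U}^4\in\mathbb{R}^{n\times n}$, $\mathfrak{W}^1,\dots,\mathfrak{W}^4\in\mathbb{R}^{n\times m}$, $C\in\mathbb{R}^{\mathrm{p}\times 2n}$, $b^1,\dots,b^4\in\mathbb{R}^n$. Standing convention: for systems in $\mathcal{F}_1$ and $\mathcal{F}_2$, for each initial state and each $u\in\mathcal{U}_{pco}$ there is a unique solution, defined on all of $[0,+\infty[$. **Polynomial systems.** $\mathcal{F}_0\subset\mathcal{F}$ is the class of systems $\mathscr{P}=(\{P_\alpha\}_{\alpha\in U},g,v_0)$: $\dot v(t)=P_{u(t)}(v(t))$, $y(t)=g(v(t))$, $v(0)=v_0\in\mathbb{R}^N$, where each $P_\alpha:\mathbb{R}^N\to\mathbb{R}^N$ and $g:\mathbb{R}^N\to\mathbb{R}^{\mathrm{p}}$ have polynomial components. A polynomial system $\mathscr{P}$ is a *polynomial embedding* of $\Sigma\in\mathcal{F}$ if for any solution $(x,u,y)$ of $\Sigma$ there is a continuous injection $F$ (from the state space of $\Sigma$ to that of $\mathscr{P}$) such that $(F(x),u,y)$ is a solution of $\mathscr{P}$, where $F(x)(t)=F(x(t))$. **Realization.** $\Sigma\in\mathcal{F}$ with initial state $x_0$ is a realization of $p:\mathcal{U}_{pco}\to\mathcal{S}_{pc}$ if for all $u\in\mathcal{U}_{pco}$ the unique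 solution $(x,u,y)$ of $\Sigma$ with $x(0)=x_0$ satisfies $p(u)=y$. **Causal, analytic.** $p$ is *causal* if for all $u,v\in\mathcal{U}_{pco}$, $t\ge0$: $u=v$ on $[0,t]$ implies $p(u)=p(v)$ on $[0,t]$. $p=(p_1,\dots,p_{\mathrm{p}})$ is *analytic* if for all $k\in\{1,\dots,\mathrm{p}\}$, $l>0$, $\beta_1,\dots,\beta_l\in U$, the function $([0,+\infty[)^l\to\mathbb{R}$, $(t_1,\dots,t_l)\mapsto p_k(u_{t_1,\ldots,t_l}^{\beta_1,\ldots,\beta_l})(T_l)$, is analytic. **Observation algebra.** $\mathcal{A}(\mathcal{U}_{pco})$ is the $\mathbb{R}$-algebra of causal analytic maps from $\mathcal{U}_{pco}$ to the piecewise-continuous functions $[0,+\infty[\to\mathbb{R}$; it is an integral domain. For $\alpha\in U$, $t\ge 0$, $u\in\mathcal{U}_{pco}$ let $u_{t,\alpha}$ equal $u$ on $[0,t[$ and $\alpha$ on $[t,+\infty[$; the derivation $D_\alpha$ on $\mathcal{A}(\mathcal{U}_{pco})$ is $(D_\alpha\varphi(u))(t)=\frac{d}{ds}\big(\varphi(u_{t,\alpha})(t+s)\big)_{|s=0}$. For causal analytic $p$, $\mathcal{A}_{obs}(p)$ is the smallest subalgebra of $\mathcal{A}(\mathcal{U}_{pco})$ containing $p_1,\dots,p_{\mathrm{p}}$ and closed under $D_\alpha$ for all $\alpha\in U$. For an integral domain $R$ over $\mathbb{R}$, $\mathrm{trdeg}\,R$ is the transcendence degree over $\mathbb{R}$ of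 its field of fractions. *)

theory Defs
  imports "HOL-Analysis.Analysis" "HOL-Algebra.Subrings"
begin

text \<open>
  All dimensions are natural numbers, because a polynomial embedding quantifies existentially over
  the dimension of its state space. A vector of dimension \<open>n\<close> is a function \<open>nat \<Rightarrow> real\<close> that vanishes
  from index \<open>n\<close> on, i.e. a point of \<^const>\<open>Euclidean_space\<close>; coordinates are numbered from 0.
  A function with domain \<open>[0, \<infinity>[\<close> or \<open>\<U>\<^sub>p\<^sub>c\<^sub>o\<close> is extensional (\<^const>\<open>PiE\<close>, \<^const>\<open>restrict\<close>), so that
  HOL equality is equality of functions on that domain.
\<close>

type_synonym rvec = "nat \<Rightarrow> real"
type_synonym 'z signal = "real \<Rightarrow> 'z"

abbreviation rspace :: "nat \<Rightarrow> rvec set" where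
  "rspace n \<equiv> topspace (Euclidean_space n)"

definition mat_vec :: "nat \<Rightarrow> nat \<Rightarrow> (nat \<Rightarrow> nat \<Rightarrow> real) \<Rightarrow> rvec \<Rightarrow> rvec" where
  "mat_vec r c A x = (\<lambda>i. if i < r then \<Sum>j<c. A i j * x j else 0)"


section \<open>Polynomial and analytic functions\<close>

definition multi_index :: "nat \<Rightarrow> (nat \<Rightarrow> nat) set" where
  "multi_index n = {k. \<forall>i\<ge>n. k i = 0}"

definition monomial :: "nat \<Rightarrow> (nat \<Rightarrow> nat) \<Rightarrow> rvec \<Rightarrow> real" where
  "monomial n k x = (\<Prod>i<n. x i ^ k i)"

definition polynomial_on_rspace :: "nat \<Rightarrow> (rvec \<Rightarrow> real) \<Rightarrow> bool" where
  "polynomial_on_rspace n f \<longleftrightarrow>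
     (\<exists>M c. finite M \<and> M \<subseteq> multi_index n \<and>
        (\<forall>x\<in>rspace n. f x = (\<Sum>k\<in>M. c k * monomial n k x)))"

text \<open>
  \<open>D\<close> need not be open: around each point of \<open>D\<close> there is a power series representing \<open>f\<close> on the part
  of \<open>D\<close> near that point. For \<open>D = [0, \<infinity>[\<^sup>n\<close> absolute convergence on that part already forces convergence
  on a full neighbourhood, so this is the same as having local analytic extensions.
\<close>
definition real_analytic_on :: "nat \<Rightarrow> rvec set \<Rightarrow> (rvec \<Rightarrow> real) \<Rightarrow> bool" where
  "real_analytic_on n D f \<longleftrightarrow>
     (\<forall>a\<in>D. \<exists>c. \<exists>r>0. \<forall>x\<in>D. (\<forall>i<n. \<bar>x i - a i\<bar> < r) \<longrightarrow>
        ((\<lambda>k. c k * monomial n k (\<lambda>i. x i - a i)) has_sum f x) (multi_index n))"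

definition C1_omega :: "(real \<Rightarrow> real) set" where
  "C1_omega = {\<sigma>.
     (\<forall>a. \<exists>c. \<exists>r>0. \<forall>x. \<bar>x - a\<bar> < r \<longrightarrow> (\<lambda>k. c k * (x - a) ^ k) sums \<sigma> x) \<and>
     (\<exists>P :: real poly. \<forall>x. (\<sigma> has_real_derivative poly P (\<sigma> x)) (at x))}"

definition activation :: "(real \<Rightarrow> real) \<Rightarrow> bool" where
  "activation \<sigma> \<longleftrightarrow> \<sigma> \<in> C1_omega \<and> (\<exists>L. L-lipschitz_on UNIV \<sigma>)"


section \<open>Function spaces\<close>

text \<open>Locally finitely many discontinuities, each with finite one-sided limits.\<close>
definition piecewise_continuous :: "real signal \<Rightarrow> bool" where
  "piecewise_continuous f \<longleftrightarrow>
     (\<forall>T. finite {t \<in> {0..T}. \<not> continuous (at t within {0..}) f}) \<and>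
     (\<forall>t\<ge>0. \<exists>L. (f \<longlongrightarrow> L) (at_right t)) \<and>
     (\<forall>t>0. \<exists>L. (f \<longlongrightarrow> L) (at_left t))"

text \<open>\<open>D\<close> ranges over the finite families of non-overlapping compact subintervals of \<open>[a, b]\<close>.\<close>
definition abs_continuous_on :: "real \<Rightarrow> real \<Rightarrow> (real \<Rightarrow> real) \<Rightarrow> bool" where
  "abs_continuous_on a b f \<longleftrightarrow>
     (\<forall>\<epsilon>>0. \<exists>\<delta>>0. \<forall>D. D division_of \<Union>D \<and> \<Union>D \<subseteq> {a..b} \<and> (\<Sum>K\<in>D. Sup K - Inf K) < \<delta>
        \<longrightarrow> (\<Sum>K\<in>D. \<bar>f (Sup K) - f (Inf K)\<bar>) < \<epsilon>)"

definition real_pc :: "real signal set" where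
  "real_pc = {y \<in> extensional {0..}. piecewise_continuous y}"

definition space_pc :: "nat \<Rightarrow> rvec signal set" where
  "space_pc n = {y \<in> {0..} \<rightarrow>\<^sub>E rspace n. \<forall>k<n. piecewise_continuous (\<lambda>t. y t k)}"

text \<open>On the unbounded interval \<open>[0, \<infinity>[\<close>, absolute continuity is local: on every \<open>[0, T]\<close>.\<close>
definition space_ac :: "nat \<Rightarrow> rvec signal set" where
  "space_ac n = {x \<in> {0..} \<rightarrow>\<^sub>E rspace n. \<forall>i<n. \<forall>T\<ge>0. abs_continuous_on 0 T (\<lambda>t. x t i)}"

text \<open>
  The input \<open>u\<close> with values \<open>\<beta> 0, \<dots>, \<beta> (l - 1)\<close> and durations \<open>t 0, \<dots>, t (l - 1)\<close>: value \<open>\<beta> i\<close> on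
  \<open>[t 0 + \<dots> + t (i - 1), t 0 + \<dots> + t i[\<close>, and \<open>\<beta> (l - 1)\<close> from the last switching time on.
\<close>
definition pc_input :: "nat \<Rightarrow> (nat \<Rightarrow> 'z) \<Rightarrow> (nat \<Rightarrow> real) \<Rightarrow> 'z signal" where
  "pc_input l \<beta> t = (\<lambda>\<tau>\<in>{0..}. \<beta> (LEAST i. \<tau> < (\<Sum>j\<le>i. t j) \<or> i = l - 1))"

definition inputs_pco :: "'z set \<Rightarrow> 'z signal set" where
  "inputs_pco U = {pc_input l \<beta> t | l \<beta> t. l > 0 \<and> (\<forall>i<l. \<beta> i \<in> U) \<and> (\<forall>i<l. 0 \<le> t i)}"


section \<open>Systems\<close>

record control_system =
  sdim :: nat
  dyn :: "rvec \<Rightarrow> rvec \<Rightarrow> rvec"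
  out :: "rvec \<Rightarrow> rvec"
  init :: rvec

text \<open>
  As the state is absolutely continuous and the input jumps, the differential equation is required
  almost everywhere.
\<close>
definition solution ::
    "rvec set \<Rightarrow> nat \<Rightarrow> control_system \<Rightarrow> rvec signal \<Rightarrow> rvec signal \<Rightarrow> rvec signal \<Rightarrow> bool" where
  "solution U q S x u y \<longleftrightarrow>
     x \<in> space_ac (sdim S) \<and> u \<in> inputs_pco U \<and> y \<in> space_pc q \<and>
     x 0 = init S \<and>
     (AE t in lebesgue. 0 \<le> t \<longrightarrow>
        (\<forall>i<sdim S. ((\<lambda>\<tau>. x \<tau> i) has_real_derivative dyn S (x t) (u t) i) (at t within {0..}))) \<and>
     (\<forall>t\<ge>0. y t = out S (x t))"

definition ode_rnn :: "nat \<Rightarrow> nat \<Rightarrow> control_system set" where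
  "ode_rnn m q =
     {\<lparr>sdim = n,
       dyn = (\<lambda>x u i. if i < n then \<sigma> (mat_vec n n A x i + mat_vec n m B u i) else 0),
       out = mat_vec q n C,
       init = x0\<rparr> | n \<sigma> A B C x0.
      activation \<sigma> \<and> x0 \<in> rspace n}"

text \<open>
  The state is \<open>s = (x, z)\<close> with \<open>x\<close> in coordinates \<open>0, \<dots>, n - 1\<close> and \<open>z\<close> in coordinates \<open>n, \<dots>, 2 n - 1\<close>.
  \<open>\<sigma> 1, \<dots>, \<sigma> 5\<close> are the activation functions, \<open>V 0, \<dots>, V 4\<close> act on the hidden state,
  \<open>W 1, \<dots>, W 4\<close> on the input, \<open>b 1, \<dots>, b 4\<close> are the biases.
\<close>
definition lstm_gate ::
    "nat \<Rightarrow> nat \<Rightarrow> (nat \<Rightarrow> real \<Rightarrow> real) \<Rightarrow> (nat \<Rightarrow> nat \<Rightarrow> nat \<Rightarrow> real) \<Rightarrow> (nat \<Rightarrow> nat \<Rightarrow> nat \<Rightarrow> real) \<Rightarrow>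
     (nat \<Rightarrow> rvec) \<Rightarrow> nat \<Rightarrow> rvec \<Rightarrow> rvec \<Rightarrow> rvec" where
  "lstm_gate n m \<sigma> V W b k s u =
     (let h = (\<lambda>i. if i < n then s (n + i) * \<sigma> 5 (s i) else 0)
      in (\<lambda>i. if i < n then \<sigma> k (mat_vec n n (V k) h i + mat_vec n m (W k) u i + b k i) else 0))"

definition lstm_dyn ::
    "nat \<Rightarrow> nat \<Rightarrow> (nat \<Rightarrow> real \<Rightarrow> real) \<Rightarrow> (nat \<Rightarrow> nat \<Rightarrow> nat \<Rightarrow> real) \<Rightarrow> (nat \<Rightarrow> nat \<Rightarrow> nat \<Rightarrow> real) \<Rightarrow>
     (nat \<Rightarrow> rvec) \<Rightarrow> rvec \<Rightarrow> rvec \<Rightarrow> rvec" where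
  "lstm_dyn n m \<sigma> V W b s u =
     (let g = (\<lambda>k. lstm_gate n m \<sigma> V W b k s u)
      in (\<lambda>i. if i < n then mat_vec n n (V 0) s i + g 2 i * s i + g 3 i * g 1 i
              else if i < 2 * n then g 4 (i - n)
              else 0))"

definition ode_lstm :: "nat \<Rightarrow> nat \<Rightarrow> control_system set" where
  "ode_lstm m q =
     {\<lparr>sdim = 2 * n,
       dyn = lstm_dyn n m \<sigma> V W b,
       out = mat_vec q (2 * n) C,
       init = s0\<rparr> | n \<sigma> V W b C s0.
      (\<forall>k\<in>{1..5}. activation (\<sigma> k)) \<and> s0 \<in> rspace (2 * n)}"

definition polynomial_system :: "rvec set \<Rightarrow> nat \<Rightarrow> control_system \<Rightarrow> bool" where
  "polynomial_system U q P \<longleftrightarrow>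
     init P \<in> rspace (sdim P) \<and>
     (\<forall>\<alpha>\<in>U. (\<forall>v\<in>rspace (sdim P). dyn P v \<alpha> \<in> rspace (sdim P)) \<and>
        (\<forall>i<sdim P. polynomial_on_rspace (sdim P) (\<lambda>v. dyn P v \<alpha> i))) \<and>
     (\<forall>v\<in>rspace (sdim P). out P v \<in> rspace q) \<and>
     (\<forall>k<q. polynomial_on_rspace (sdim P) (\<lambda>v. out P v k))"

definition polynomial_embedding ::
    "rvec set \<Rightarrow> nat \<Rightarrow> control_system \<Rightarrow> control_system \<Rightarrow> bool" where
  "polynomial_embedding U q P S \<longleftrightarrow>
     polynomial_system U q P \<and>
     (\<forall>x u y. solution U q S x u y \<longrightarrow>
        (\<exists>F. continuous_map (Euclidean_space (sdim S)) (Euclidean_space (sdim P)) F \<and>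
             inj_on F (rspace (sdim S)) \<and>
             solution U q P (\<lambda>t\<in>{0..}. F (x t)) u y))"

definition realization ::
    "rvec set \<Rightarrow> nat \<Rightarrow> control_system \<Rightarrow> (rvec signal \<Rightarrow> rvec signal) \<Rightarrow> bool" where
  "realization U q S p \<longleftrightarrow>
     (\<forall>u\<in>inputs_pco U.
        (\<exists>!(x, y). solution U q S x u y) \<and>
        (\<forall>x y. solution U q S x u y \<longrightarrow> p u = y))"


section \<open>Input-output maps and the observation algebra\<close>

definition causal :: "rvec set \<Rightarrow> (rvec signal \<Rightarrow> 'z signal) \<Rightarrow> bool" where
  "causal U p \<longleftrightarrow>
     (\<forall>u\<in>inputs_pco U. \<forall>v\<in>inputs_pco U. \<forall>t\<ge>0.
        (\<forall>s\<in>{0..t}. u s = v s) \<longrightarrow> (\<forall>s\<in>{0..t}. p u s = p v s))"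

definition io_analytic :: "rvec set \<Rightarrow> (rvec signal \<Rightarrow> real signal) \<Rightarrow> bool" where
  "io_analytic U \<phi> \<longleftrightarrow>
     (\<forall>l>0. \<forall>\<beta>. (\<forall>i<l. \<beta> i \<in> U) \<longrightarrow>
        real_analytic_on l {t \<in> rspace l. \<forall>i<l. 0 \<le> t i} (\<lambda>t. \<phi> (pc_input l \<beta> t) (\<Sum>i<l. t i)))"

definition io_component ::
    "rvec set \<Rightarrow> (rvec signal \<Rightarrow> rvec signal) \<Rightarrow> nat \<Rightarrow> rvec signal \<Rightarrow> real signal" where
  "io_component U p k = (\<lambda>u\<in>inputs_pco U. \<lambda>t\<in>{0..}. p u t k)"

definition io_const :: "rvec set \<Rightarrow> real \<Rightarrow> rvec signal \<Rightarrow> real signal" where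
  "io_const U c = (\<lambda>u\<in>inputs_pco U. \<lambda>t\<in>{0..}. c)"

definition io_algebra :: "rvec set \<Rightarrow> (rvec signal \<Rightarrow> real signal) ring" where
  "io_algebra U =
     \<lparr>carrier = {\<phi> \<in> inputs_pco U \<rightarrow>\<^sub>E real_pc. causal U \<phi> \<and> io_analytic U \<phi>},
      mult = (\<lambda>\<phi> \<psi>. \<lambda>u\<in>inputs_pco U. \<lambda>t\<in>{0..}. \<phi> u t * \<psi> u t),
      one = io_const U 1,
      zero = io_const U 0,
      add = (\<lambda>\<phi> \<psi>. \<lambda>u\<in>inputs_pco U. \<lambda>t\<in>{0..}. \<phi> u t + \<psi> u t)\<rparr>"

definition switch_to :: "'z signal \<Rightarrow> real \<Rightarrow> 'z \<Rightarrow> 'z signal" where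
  "switch_to u t \<alpha> = (\<lambda>\<tau>\<in>{0..}. if \<tau> < t then u \<tau> else \<alpha>)"

text \<open>
  The derivative at \<open>s = 0\<close> is one-sided (\<open>s \<ge> 0\<close>): for \<open>s < 0\<close> the value at time \<open>t + s\<close> does not
  depend on \<open>\<alpha>\<close>, and in general the two one-sided derivatives differ.
\<close>
definition io_deriv ::
    "rvec set \<Rightarrow> rvec \<Rightarrow> (rvec signal \<Rightarrow> real signal) \<Rightarrow> rvec signal \<Rightarrow> real signal" where
  "io_deriv U \<alpha> \<phi> =
     (\<lambda>u\<in>inputs_pco U. \<lambda>t\<in>{0..}.
        vector_derivative (\<lambda>s. \<phi> (switch_to u t \<alpha>) (t + s)) (at 0 within {0..}))"

definition obs_algebra ::
    "rvec set \<Rightarrow> nat \<Rightarrow> (rvec signal \<Rightarrow> rvec signal) \<Rightarrow> (rvec signal \<Rightarrow> real signal) ring" where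
  "obs_algebra U q p =
     (io_algebra U)\<lparr>carrier :=
        \<Inter>{B. subring B (io_algebra U) \<and> range (io_const U) \<subseteq> B \<and>
             (\<forall>k<q. io_component U p k \<in> B) \<and>
             (\<forall>\<alpha>\<in>U. \<forall>\<phi>\<in>B. io_deriv U \<alpha> \<phi> \<in> B)}\<rparr>"


section \<open>Transcendence degree of an integral domain\<close>

definition frac_rel :: "('a, 'b) ring_scheme \<Rightarrow> (('a \<times> 'a) \<times> ('a \<times> 'a)) set" where
  "frac_rel R =
     {((a, b), (c, d)). a \<in> carrier R \<and> b \<in> carrier R - {\<zero>\<^bsub>R\<^esub>} \<and>
        c \<in> carrier R \<and> d \<in> carrier R - {\<zero>\<^bsub>R\<^esub>} \<and> a \<otimes>\<^bsub>R\<^esub> d = c \<otimes>\<^bsub>R\<^esub> b}"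

definition frac :: "('a, 'b) ring_scheme \<Rightarrow> 'a \<Rightarrow> 'a \<Rightarrow> ('a \<times> 'a) set" where
  "frac R a b = frac_rel R `` {(a, b)}"

definition frac_field :: "('a, 'b) ring_scheme \<Rightarrow> ('a \<times> 'a) set ring" where
  "frac_field R =
     \<lparr>carrier = (carrier R \<times> (carrier R - {\<zero>\<^bsub>R\<^esub>})) // frac_rel R,
      mult = (\<lambda>X Y. \<Union>(a, b)\<in>X. \<Union>(c, d)\<in>Y. frac R (a \<otimes>\<^bsub>R\<^esub> c) (b \<otimes>\<^bsub>R\<^esub> d)),
      one = frac R \<one>\<^bsub>R\<^esub> \<one>\<^bsub>R\<^esub>,
      zero = frac R \<zero>\<^bsub>R\<^esub> \<one>\<^bsub>R\<^esub>,
      add = (\<lambda>X Y. \<Union>(a, b)\<in>X. \<Union>(c, d)\<in>Y.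
               frac R (a \<otimes>\<^bsub>R\<^esub> d \<oplus>\<^bsub>R\<^esub> c \<otimes>\<^bsub>R\<^esub> b) (b \<otimes>\<^bsub>R\<^esub> d))\<rparr>"

text \<open>
  No nontrivial polynomial relation with coefficients in \<open>K\<close> between the elements of the finite set \<open>S\<close>;
  a monomial in the elements of \<open>S\<close> is given by its exponents \<open>e\<close>.
\<close>
definition alg_independent :: "('a, 'b) ring_scheme \<Rightarrow> 'a set \<Rightarrow> 'a set \<Rightarrow> bool" where
  "alg_independent L K S \<longleftrightarrow>
     (\<forall>M c. finite M \<and> M \<subseteq> (S \<rightarrow>\<^sub>E (UNIV :: nat set)) \<and> c \<in> M \<rightarrow> K \<and>
        (\<Oplus>\<^bsub>L\<^esub>e\<in>M. c e \<otimes>\<^bsub>L\<^esub> (\<Otimes>\<^bsub>L\<^esub>s\<in>S. s [^]\<^bsub>L\<^esub> e s)) = \<zero>\<^bsub>L\<^esub>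
        \<longrightarrow> (\<forall>e\<in>M. c e = \<zero>\<^bsub>L\<^esub>))"

text \<open>
  The transcendence degree of the field of fractions of \<open>R\<close> over the subfield \<open>K\<close> of \<open>R\<close>, as the
  largest size of an algebraically independent set (\<open>\<infinity>\<close> if there are arbitrarily large finite ones).
\<close>
definition trdeg :: "'a set \<Rightarrow> ('a, 'b) ring_scheme \<Rightarrow> enat" where
  "trdeg K R =
     (SUP S\<in>{S. finite S \<and> S \<subseteq> carrier (frac_field R) \<and>
                alg_independent (frac_field R) ((\<lambda>c. frac R c \<one>\<^bsub>R\<^esub>) ` K) S}. enat (card S))"

end

theory Submission
  imports Defs "HOL-Complex_Analysis.Cauchy_Integral_Formula"
begin

text \<open>
  An activation function satisfies \<open>\<sigma>' = P(\<sigma>)\<close>. Adjoining to the state the values of the activations (for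
  each of the finitely many input values) therefore turns the system into a polynomial one.

  For a polynomial system the Lie series expresses the flow, for short times, as a power series in the
  time with coefficients polynomial in the initial state. Substituting convergent power series for both
  and composing finitely many short steps shows that the state reached under a piecewise constant input
  is analytic in the switching durations; the same series gives uniqueness, hence causality. The
  functions \<open>q(v(t))\<close> of the state, \<open>q\<close> polynomial, form a subalgebra closed under the derivations
  \<open>D\<^sub>\<alpha>\<close>, so it contains the observation algebra. It has no zero divisors because any two reachable
  states are joined by an analytic path of reachable states, and more than \<open>N\<close> fractions of polynomials
  in the \<open>N\<close> state coordinates are algebraically dependent, by counting monomials.
\<close>

section \<open>Absolute continuity\<close>

text \<open>A state is only absolutely continuous and solves its equation almost everywhere, whereas
  the series need classical derivatives. While the input is constant, the right-hand side is
  continuous along the state, so a fundamental theorem of calculus for absolutely continuous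
  functions yields a classical solution, endpoints included.

  No flow is constructed: trajectories come from the realization, and a statement on flows says that
  any integral curve with given initial data equals a given series. The series live on full
  polydiscs, but are claimed to agree with the trajectory only where all durations are nonnegative.

  An activation that reads the input is adjoined with the input frozen at each possible value, since
  its value at the current input would jump.

  The length of a short step depends on a bound for the state. After each step the polydisc is
  shrunk until the norms of the germs are close to their central values, so the bound, and with it
  the step length, can be used again.\<close>

lemma division_interval:
  assumes "D division_of \<Union>D" "\<Union>D \<subseteq> {a..b}" "K \<in> D"
  obtains s t :: real where "K = {s..t}" "a \<le> s" "s \<le> t" "t \<le> b" "Inf K = s" "Sup K = t"
proof -
  obtain s t where K: "K = cbox s t" using division_ofD(4)[OF assms(1,3)] by blast
  have ne: "K \<noteq> {}" using division_ofD(3)[OF assms(1,3)] .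
  have st: "K = {s..t}" "s \<le> t" using K ne by auto
  have "K \<subseteq> {a..b}" using assms by blast
  then show thesis using that[of s t] st by auto
qed

text \<open>The same division controls \<open>f\<close> and \<open>g\<close> at once, so a linear
  bound on increments passes to the sums over divisions. Sums, multiples, products and Lipschitz
  images are all instances.\<close>

lemma abs_continuous_on_increment:
  assumes f: "abs_continuous_on a b f" and g: "abs_continuous_on a b g"
    and le: "\<And>s t. a \<le> s \<Longrightarrow> s \<le> t \<Longrightarrow> t \<le> b \<Longrightarrow> \<bar>h t - h s\<bar> \<le> c * \<bar>f t - f s\<bar> + d * \<bar>g t - g s\<bar>"
  shows "abs_continuous_on a b h"
  unfolding abs_continuous_on_def
proof (intro allI impI)
  fix e :: real assume e: "e > 0"
  \<comment> \<open>The \<open>+ 1\<close> keeps \<open>m\<close> positive even for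
    \<open>c = d = 0\<close>, so that \<open>e / (2 * m)\<close> is a legitimate tolerance.\<close>
  define m where "m = \<bar>c\<bar> + \<bar>d\<bar> + 1"
  have m: "m > 0" "\<bar>c\<bar> \<le> m" "\<bar>d\<bar> \<le> m" unfolding m_def by auto
  have em: "e / (2 * m) > 0" using e m by simp
  obtain d1 where d1: "d1 > 0" "\<And>D. D division_of \<Union>D \<Longrightarrow> \<Union>D \<subseteq> {a..b} \<Longrightarrow> (\<Sum>K\<in>D. Sup K - Inf K) < d1
        \<Longrightarrow> (\<Sum>K\<in>D. \<bar>f (Sup K) - f (Inf K)\<bar>) < e / (2 * m)"
    using f em unfolding abs_continuous_on_def by meson
  obtain d2 where d2: "d2 > 0" "\<And>D. D division_of \<Union>D \<Longrightarrow> \<Union>D \<subseteq> {a..b} \<Longrightarrow> (\<Sum>K\<in>D. Sup K - Inf K) < d2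
        \<Longrightarrow> (\<Sum>K\<in>D. \<bar>g (Sup K) - g (Inf K)\<bar>) < e / (2 * m)"
    using g em unfolding abs_continuous_on_def by meson
  show "\<exists>\<delta>>0. \<forall>D. D division_of \<Union>D \<and> \<Union>D \<subseteq> {a..b} \<and> (\<Sum>K\<in>D. Sup K - Inf K) < \<delta>
        \<longrightarrow> (\<Sum>K\<in>D. \<bar>h (Sup K) - h (Inf K)\<bar>) < e"
  proof (intro exI[of _ "min d1 d2"] conjI allI impI; (elim conjE)?)
    show "min d1 d2 > 0" using d1 d2 by simp
    fix D assume D: "D division_of \<Union>D" "\<Union>D \<subseteq> {a..b}" "(\<Sum>K\<in>D. Sup K - Inf K) < min d1 d2"
    have "(\<Sum>K\<in>D. \<bar>h (Sup K) - h (Inf K)\<bar>)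
        \<le> (\<Sum>K\<in>D. m * \<bar>f (Sup K) - f (Inf K)\<bar> + m * \<bar>g (Sup K) - g (Inf K)\<bar>)"
    proof (rule sum_mono)
      fix K assume "K \<in> D"
      then obtain s t where K: "a \<le> s" "s \<le> t" "t \<le> b" "Inf K = s" "Sup K = t"
        using division_interval[OF D(1,2)] by metis
      have "c * \<bar>f t - f s\<bar> \<le> m * \<bar>f t - f s\<bar>" "d * \<bar>g t - g s\<bar> \<le> m * \<bar>g t - g s\<bar>"
        using m by (intro mult_right_mono; linarith)+
      then show "\<bar>h (Sup K) - h (Inf K)\<bar> \<le> m * \<bar>f (Sup K) - f (Inf K)\<bar> + m * \<bar>g (Sup K) - g (Inf K)\<bar>"
        using le[OF K(1-3)] K by simp
    qed
    also have "\<dots> = m * (\<Sum>K\<in>D. \<bar>f (Sup K) - f (Inf K)\<bar>) + m * (\<Sum>K\<in>D. \<bar>g (Sup K) - g (Inf K)\<bar>)"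
      by (simp add: sum.distrib sum_distrib_left)
    also have "\<dots> < m * (e / (2 * m)) + m * (e / (2 * m))"
      using d1(2)[OF D(1,2)] d2(2)[OF D(1,2)] D(3) m
      by (intro add_strict_mono mult_strict_left_mono) auto
    also have "\<dots> = e" using m by (simp add: field_simps)
    finally show "(\<Sum>K\<in>D. \<bar>h (Sup K) - h (Inf K)\<bar>) < e" .
  qed
qed

lemma abs_continuous_on_const: "abs_continuous_on a b (\<lambda>_. c)"
  unfolding abs_continuous_on_def by (auto intro: exI[of _ 1])

lemma abs_continuous_on_add:
  "abs_continuous_on a b f \<Longrightarrow> abs_continuous_on a b g \<Longrightarrow> abs_continuous_on a b (\<lambda>t. f t + g t)"
  by (erule (1) abs_continuous_on_increment[where c = 1 and d = 1]) simp

lemma abs_continuous_on_cmult: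
  "abs_continuous_on a b f \<Longrightarrow> abs_continuous_on a b (\<lambda>t. c * f t)"
  by (rule abs_continuous_on_increment[where f = f and g = f and c = "\<bar>c\<bar>" and d = 0])
    (simp_all add: abs_mult[symmetric] right_diff_distrib)

lemma abs_continuous_on_sum:
  assumes "\<And>i. i \<in> I \<Longrightarrow> abs_continuous_on a b (f i)"
  shows "abs_continuous_on a b (\<lambda>t. \<Sum>i\<in>I. f i t)"
  using assms
  by (induction I rule: infinite_finite_induct) (auto intro: abs_continuous_on_const abs_continuous_on_add)

lemma abs_continuous_on_lipschitz:
  assumes "abs_continuous_on a b f" "L-lipschitz_on UNIV g"
  shows "abs_continuous_on a b (\<lambda>t. g (f t))"
  using lipschitz_onD[OF assms(2)]
  by (intro abs_continuous_on_increment[OF assms(1) assms(1), where c = L and d = 0]) (simp add: dist_real_def)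

lemma abs_continuous_on_cong:
  assumes "\<And>t. a \<le> t \<Longrightarrow> t \<le> b \<Longrightarrow> f t = g t" "abs_continuous_on a b f"
  shows "abs_continuous_on a b g"
  by (rule abs_continuous_on_increment[OF assms(2,2), where c = 1 and d = 0])
    (simp add: assms(1)[symmetric])

lemma abs_continuous_on_imp_continuous_on:
  assumes "abs_continuous_on a b f"
  shows "continuous_on {a..b} f"
  unfolding continuous_on_iff
proof (intro ballI allI impI)
  fix x e assume x: "x \<in> {a..b}" and e: "(e :: real) > 0"
  obtain d where d: "d > 0" "\<And>D. D division_of \<Union>D \<Longrightarrow> \<Union>D \<subseteq> {a..b} \<Longrightarrow> (\<Sum>K\<in>D. Sup K - Inf K) < d
        \<Longrightarrow> (\<Sum>K\<in>D. \<bar>f (Sup K) - f (Inf K)\<bar>) < e"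
    using assms e unfolding abs_continuous_on_def by meson
  \<comment> \<open>The definition is applied to the division with the single member
    \<open>{s..t}\<close>.\<close>
  have *: "\<bar>f t - f s\<bar> < e" if "s \<in> {a..b}" "t \<in> {a..b}" "s \<le> t" "t - s < d" for s t
    using d(2)[of "{{s..t}}"] that division_of_self[of s t] by auto
  show "\<exists>d>0. \<forall>x'\<in>{a..b}. dist x' x < d \<longrightarrow> dist (f x') (f x) < e"
  proof (intro exI[of _ d] conjI ballI impI d)
    fix y assume y: "y \<in> {a..b}" "dist y x < d"
    show "dist (f y) (f x) < e"
      using *[of x y] *[of y x] x y by (cases "x \<le> y") (auto simp: dist_real_def)
  qed
qed

text \<open>On the compact interval both factors are continuous, hence bounded, and these bounds are
  the coefficients that \<open>abs_continuous_on_increment\<close> asks for.\<close>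

lemma abs_continuous_on_mult:
  assumes f: "abs_continuous_on a b f" and g: "abs_continuous_on a b g"
  shows "abs_continuous_on a b (\<lambda>t. f t * g t)"
proof -
  have bounded: "\<exists>B. \<forall>t\<in>{a..b}. \<bar>h t\<bar> \<le> B" if "abs_continuous_on a b h" for h
    using compact_imp_bounded[OF compact_continuous_image[OF abs_continuous_on_imp_continuous_on[OF that]]]
    by (auto simp: bounded_iff)
  obtain A where A: "\<And>t. t \<in> {a..b} \<Longrightarrow> \<bar>f t\<bar> \<le> A" using bounded[OF f] by blast
  obtain B where B: "\<And>t. t \<in> {a..b} \<Longrightarrow> \<bar>g t\<bar> \<le> B" using bounded[OF g] by blast
  show ?thesis
  proof (rule abs_continuous_on_increment[OF f g])
    fix s t assume st: "a \<le> s" "s \<le> t" "t \<le> b"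
    have "f t * g t - f s * g s = g t * (f t - f s) + f s * (g t - g s)" by (simp add: algebra_simps)
    then have "\<bar>f t * g t - f s * g s\<bar> \<le> \<bar>g t\<bar> * \<bar>f t - f s\<bar> + \<bar>f s\<bar> * \<bar>g t - g s\<bar>"
      by (metis abs_mult abs_triangle_ineq)
    also have "\<dots> \<le> B * \<bar>f t - f s\<bar> + A * \<bar>g t - g s\<bar>"
      using A[of s] B[of t] st by (intro add_mono mult_right_mono) auto
    finally show "\<bar>f t * g t - f s * g s\<bar> \<le> B * \<bar>f t - f s\<bar> + A * \<bar>g t - g s\<bar>" .
  qed
qed

section \<open>Integrating the derivative of an absolutely continuous function\<close>

lemma division_measurable:
  fixes D :: "real set set"
  assumes "D division_of S"
  shows "S \<in> lmeasurable"
  using assms unfolding division_of_def by (auto intro: fmeasurable.finite_Union)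

text \<open>Two members of a division meet in a convex set with empty interior, which is negligible;
  so measures add up despite shared endpoints.\<close>

lemma division_measure:
  fixes D :: "real set set"
  assumes "D division_of S"
  shows "measure lebesgue S = (\<Sum>K\<in>D. measure lborel K)"
proof -
  note D = division_ofD[OF assms]
  have cb: "\<exists>a b. K = cbox a b" if "K \<in> D" for K using D(4) that by blast
  have "measure lebesgue (\<Union>D) = (\<Sum>K\<in>D. measure lebesgue K)"
  proof (rule measure_negligible_finite_Union[OF D(1)])
    show "K \<in> lmeasurable" if "K \<in> D" for K using cb[OF that] by auto
    show "pairwise (\<lambda>S T. negligible (S \<inter> T)) D"
    proof (rule pairwiseI)
      fix S T assume ST: "S \<in> D" "T \<in> D" "S \<noteq> T"
      have "convex (S \<inter> T)" using cb ST by (metis convex_Int convex_box(1))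
      moreover have "interior (S \<inter> T) = {}" using D(5)[OF ST] by simp
      ultimately show "negligible (S \<inter> T)" using negligible_convex_interior by blast
    qed
  qed
  also have "\<dots> = (\<Sum>K\<in>D. measure lborel K)"
    using cb by (intro sum.cong refl measure_completion) fastforce
  finally show ?thesis using D(6) by simp
qed

text \<open>
  In a fine enough tagged division, the intervals tagged in the exceptional null set \<open>N\<close> lie in an open
  set of small measure, and absolute continuity bounds the increments of \<open>f\<close> over them.
\<close>
lemma abs_continuous_on_has_integral:
  fixes f h :: "real \<Rightarrow> real"
  assumes ab: "a \<le> b" and ac: "abs_continuous_on a b f" and N: "negligible N"
    and deriv: "\<And>t. t \<in> {a..b} - N \<Longrightarrow> (f has_real_derivative h t) (at t within {a..b})"
  shows "(h has_integral (f b - f a)) {a..b}"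
proof -
  \<comment> \<open>Nothing is known about \<open>h\<close> on \<open>N\<close>. The value 0 there
    leaves, for an interval tagged in \<open>N\<close>, only the increment of \<open>f\<close> as
    error.\<close>
  define h0 where "h0 t = (if t \<in> N then 0 else h t)" for t
  have "(h0 has_integral (f b - f a)) {a..b}"
    unfolding has_integral_real
  proof (intro allI impI)
    fix e :: real assume e: "e > 0"
    \<comment> \<open>The errors at the other tags are at most \<open>e1\<close> times the interval
      length, so they sum to at most \<open>e / 2\<close>; the \<open>+ 1\<close> covers
      \<open>a = b\<close>.\<close>
    define e1 where "e1 = e / (2 * (b - a + 1))"
    have e1: "e1 > 0" "e1 * (b - a) \<le> e / 2"
      using e ab unfolding e1_def by (auto simp: field_simps)
    obtain d where d: "d > 0" "\<And>D. D division_of \<Union>D \<Longrightarrow> \<Union>D \<subseteq> {a..b} \<Longrightarrow> (\<Sum>K\<in>D. Sup K - Inf K) < d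
        \<Longrightarrow> (\<Sum>K\<in>D. \<bar>f (Sup K) - f (Inf K)\<bar>) < e / 2"
      using ac e unfolding abs_continuous_on_def by (meson half_gt_zero)
    obtain G where G: "open G" "N \<subseteq> G" "G \<in> lmeasurable" "measure lebesgue G < d"
    proof -
      obtain T where T: "open T" "N \<subseteq> T" "T - N \<in> lmeasurable" "emeasure lebesgue (T - N) < d"
        using sets_lebesgue_outer_open[of N d] d N negligible_imp_sets by blast
      have Nn: "N \<in> null_sets lebesgue" using N negligible_iff_null_sets by blast
      have "T \<in> lmeasurable" using T N
        by (metis Diff_partition fmeasurable.Un negligible_imp_measurable)
      moreover have "measure lebesgue T = measure lebesgue (T - N)"
        using Nn T(1) by (metis borel_open measure_Diff_null_set sets_completionI_sets sets_lborel)
      moreover have "measure lebesgue (T - N) < d"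
        using T(3,4) d(1) by (simp add: emeasure_eq_measure2 ennreal_less_iff)
      ultimately show thesis using that[of T] T by auto
    qed
    have "\<exists>r>0. \<forall>y\<in>{a..b}. \<bar>y - x\<bar> < r \<longrightarrow> \<bar>f y - f x - h x * (y - x)\<bar> \<le> e1 * \<bar>y - x\<bar>"
      if x: "x \<in> {a..b} - N" for x
    proof -
      have "(f has_derivative (\<lambda>y. h x * y)) (at x within {a..b})"
        using deriv[OF x] by (simp add: has_field_derivative_def mult_commute_abs)
      then show ?thesis using e1(1) unfolding has_derivative_within_alt by (simp add: mult.commute)
    qed
    then obtain r where r: "\<And>x. x \<in> {a..b} - N \<Longrightarrow> r x > 0"
      "\<And>x y. x \<in> {a..b} - N \<Longrightarrow> y \<in> {a..b} \<Longrightarrow> \<bar>y - x\<bar> < r x \<Longrightarrow> \<bar>f y - f x - h x * (y - x)\<bar> \<le> e1 * \<bar>y - x\<bar>"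
      by metis
    define \<gamma> where "\<gamma> x = (if x \<in> N then G else if x \<in> {a..b} then ball x (r x) else UNIV)" for x
    have gauge: "gauge \<gamma>"
      unfolding gauge_def \<gamma>_def using G r(1) by auto
    show "\<exists>\<gamma>. gauge \<gamma> \<and> (\<forall>D. D tagged_division_of {a..b} \<and> \<gamma> fine D \<longrightarrow>
        norm ((\<Sum>(x,k)\<in>D. measure lborel k *\<^sub>R h0 x) - (f b - f a)) < e)"
    proof (intro exI[of _ \<gamma>] conjI gauge allI impI; elim conjE)
      fix p assume p: "p tagged_division_of {a..b}" and fine: "\<gamma> fine p"
      note pD = tagged_division_ofD[OF p]
      have itv: "\<exists>s t. K = {s..t} \<and> s \<le> x \<and> x \<le> t \<and> a \<le> s \<and> t \<le> b \<and> Inf K = s \<and> Sup K = t \<and> measure lborel K = t - s"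
        if xK: "(x, K) \<in> p" for x K
      proof -
        obtain s t where K: "K = cbox s t" using pD(4)[OF xK] by blast
        have "x \<in> K" using pD(2)[OF xK] .
        moreover have "K \<subseteq> {a..b}" using pD(3)[OF xK] .
        ultimately show ?thesis using K by (intro exI[of _ s] exI[of _ t]) auto
      qed
      define err where "err = (\<lambda>(x,K). measure lborel K * h0 x - (f (Sup K) - f (Inf K)))"
      define p1 where "p1 = {(x,K)\<in>p. x \<in> N}"
      define p2 where "p2 = {(x,K)\<in>p. x \<notin> N}"
      have pu: "p = p1 \<union> p2" "p1 \<inter> p2 = {}" "p1 \<subseteq> p" "p2 \<subseteq> p" unfolding p1_def p2_def by auto
      have fin: "finite p1" "finite p2" using pD(1) pu finite_subset by blast+
      have s1: "(\<Sum>z\<in>p1. \<bar>err z\<bar>) < e / 2"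
      proof -
        have p1pd: "p1 tagged_partial_division_of {a..b}"
          by (rule tagged_partial_division_subset[OF _ pu(3)]) (use p in \<open>simp add: tagged_division_of_def\<close>)
        have p1t: "p1 tagged_division_of (\<Union>(snd ` p1))"
          by (rule tagged_partial_division_of_Union_self[OF p1pd])
        have dv: "snd ` p1 division_of \<Union>(snd ` p1)" by (rule partial_division_of_tagged_division[OF p1pd])
        have sub: "\<Union>(snd ` p1) \<subseteq> {a..b}" 
          using pD(3) pu(3) by (intro Union_least) (metis imageE prod.collapse subsetD)
        have subG: "\<Union>(snd ` p1) \<subseteq> G"
        proof
          fix y assume "y \<in> \<Union>(snd ` p1)"
          then obtain x K where "(x, K) \<in> p1" "y \<in> K" by auto
          then have "(x, K) \<in> p" "x \<in> N" "y \<in> K" unfolding p1_def by auto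
          then show "y \<in> G" using fineD[OF fine, of x K] unfolding \<gamma>_def by auto
        qed
        have "(\<Sum>K\<in>snd ` p1. Sup K - Inf K) = (\<Sum>K\<in>snd ` p1. measure lborel K)"
        proof (rule sum.cong[OF refl])
          fix K assume "K \<in> snd ` p1"
          then obtain x where "(x, K) \<in> p" using pu(3) by auto
          from itv[OF this] show "Sup K - Inf K = measure lborel K" by auto
        qed
        also have "\<dots> = measure lebesgue (\<Union>(snd ` p1))"
          by (rule division_measure[OF dv, symmetric])
        also have "\<dots> \<le> measure lebesgue G"
          by (rule measure_mono_fmeasurable[OF subG _ G(3)])
            (use division_measurable[OF dv] in auto)
        also have "\<dots> < d" by (rule G(4))
        finally have "(\<Sum>K\<in>snd ` p1. \<bar>f (Sup K) - f (Inf K)\<bar>) < e / 2"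
          by (intro d(2) dv sub)
        moreover have "(\<Sum>(x,K)\<in>p1. \<bar>f (Sup K) - f (Inf K)\<bar>) = (\<Sum>K\<in>snd ` p1. \<bar>f (Sup K) - f (Inf K)\<bar>)"
        proof -
          \<comment> \<open>\<open>sum.over_tagged_division_lemma\<close> asks for the value 0 on
            every interval without interior, including the empty set, where \<open>Inf\<close> and
            \<open>Sup\<close> are unspecified.\<close>
          define g where "g K = (if K = {} then 0 else \<bar>f (Sup K) - f (Inf K)\<bar>)" for K
          have g: "\<bar>f (Sup K) - f (Inf K)\<bar> = g K" if "(x, K) \<in> p1" for x K
            using pD(2) pu(3) that unfolding g_def by auto
          have "(\<Sum>(x,K)\<in>p1. g K) = (\<Sum>K\<in>snd ` p1. g K)"
          proof (rule sum.over_tagged_division_lemma[OF p1t])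
            fix u v :: real assume "box u v = {}"
            then show "g (cbox u v) = 0" unfolding g_def by (cases "u = v") auto
          qed
          moreover have "(\<Sum>(x,K)\<in>p1. \<bar>f (Sup K) - f (Inf K)\<bar>) = (\<Sum>(x,K)\<in>p1. g K)"
            by (rule sum.cong[OF refl]) (auto simp: g)
          moreover have "(\<Sum>K\<in>snd ` p1. \<bar>f (Sup K) - f (Inf K)\<bar>) = (\<Sum>K\<in>snd ` p1. g K)"
            by (rule sum.cong[OF refl]) (auto simp: g)
          ultimately show ?thesis by simp
        qed
        moreover have "(\<Sum>z\<in>p1. \<bar>err z\<bar>) = (\<Sum>(x,K)\<in>p1. \<bar>f (Sup K) - f (Inf K)\<bar>)"
          by (intro sum.cong) (auto simp: err_def p1_def h0_def)
        ultimately show ?thesis by simp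
      qed
      have s2: "(\<Sum>z\<in>p2. \<bar>err z\<bar>) \<le> e / 2"
      proof -
        have "(\<Sum>z\<in>p2. \<bar>err z\<bar>) \<le> (\<Sum>(x,K)\<in>p2. e1 * measure lborel K)"
        proof (rule sum_mono, clarify)
          fix x K assume xK: "(x, K) \<in> p2"
          then have xKp: "(x, K) \<in> p" and xN: "x \<notin> N" unfolding p2_def by auto
          obtain s t where K: "K = {s..t}" "s \<le> x" "x \<le> t" "a \<le> s" "t \<le> b" "Inf K = s" "Sup K = t" "measure lborel K = t - s"
            using itv[OF xKp] by blast
          have x: "x \<in> {a..b} - N" using K xN by auto
          have "K \<subseteq> ball x (r x)" using fineD[OF fine xKp] x xN unfolding \<gamma>_def by (simp split: if_splits)
          moreover have "s \<in> K" "t \<in> K" using K by auto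
          ultimately have "s \<in> ball x (r x)" "t \<in> ball x (r x)" by blast+
          then have "\<bar>s - x\<bar> < r x" "\<bar>t - x\<bar> < r x" by (auto simp: dist_real_def)
          \<comment> \<open>The increment is split at the tag \<open>x\<close>: the errors on its
            two sides add up to \<open>e1\<close> times the whole length.\<close>
          then have "\<bar>f s - f x - h x * (s - x)\<bar> \<le> e1 * (x - s)" "\<bar>f t - f x - h x * (t - x)\<bar> \<le> e1 * (t - x)"
            using r(2)[OF x, of s] r(2)[OF x, of t] K by auto
          moreover have "(t - s) * h x = h x * (t - x) - h x * (s - x)"
            "e1 * (t - s) = e1 * (x - s) + e1 * (t - x)" by (simp_all add: algebra_simps)
          ultimately show "\<bar>err (x, K)\<bar> \<le> e1 * measure lborel K"
            unfolding err_def h0_def using xN K by simp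
        qed
        also have "\<dots> \<le> (\<Sum>(x,K)\<in>p. e1 * measure lborel K)"
          using pu(4) pD(1) e1 by (intro sum_mono2) auto
        also have "\<dots> = e1 * (\<Sum>(x,K)\<in>p. measure lborel K)" by (simp add: sum_distrib_left split_def)
        also have "\<dots> = e1 * (b - a)"
          using additive_content_tagged_division[of p a b] p ab by (simp add: cbox_interval)
        finally show ?thesis using e1 by simp
      qed
      have "(\<Sum>(x,k)\<in>p. measure lborel k *\<^sub>R h0 x) - (f b - f a) = (\<Sum>z\<in>p. err z)"
        unfolding additive_tagged_division_1[OF ab p, of f, symmetric] err_def
        by (simp add: sum_subtractf split_def)
      then have "norm ((\<Sum>(x,k)\<in>p. measure lborel k *\<^sub>R h0 x) - (f b - f a)) \<le> (\<Sum>z\<in>p. \<bar>err z\<bar>)"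
        by simp
      also have "\<dots> = (\<Sum>z\<in>p1. \<bar>err z\<bar>) + (\<Sum>z\<in>p2. \<bar>err z\<bar>)"
        unfolding pu(1) by (rule sum.union_disjoint[OF fin pu(2)])
      finally show "norm ((\<Sum>(x,k)\<in>p. measure lborel k *\<^sub>R h0 x) - (f b - f a)) < e" using s1 s2 by simp
    qed
  qed
  then show ?thesis
    by (rule has_integral_spike[OF N, rotated]) (auto simp: h0_def)
qed

lemma abs_continuous_on_subset:
  assumes "abs_continuous_on a b f" "a \<le> c" "d \<le> b"
  shows "abs_continuous_on c d f"
  unfolding abs_continuous_on_def
proof (intro allI impI)
  fix e :: real assume "e > 0"
  then obtain \<delta> where "\<delta> > 0" "\<And>D. D division_of \<Union>D \<Longrightarrow> \<Union>D \<subseteq> {a..b} \<Longrightarrow> (\<Sum>K\<in>D. Sup K - Inf K) < \<delta>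
        \<Longrightarrow> (\<Sum>K\<in>D. \<bar>f (Sup K) - f (Inf K)\<bar>) < e"
    using assms(1) unfolding abs_continuous_on_def by meson
  moreover have "{c..d} \<subseteq> {a..b}" using assms by auto
  ultimately show "\<exists>\<delta>>0. \<forall>D. D division_of \<Union>D \<and> \<Union>D \<subseteq> {c..d} \<and> (\<Sum>K\<in>D. Sup K - Inf K) < \<delta>
        \<longrightarrow> (\<Sum>K\<in>D. \<bar>f (Sup K) - f (Inf K)\<bar>) < e" by (meson subset_trans)
qed

text \<open>\<open>f\<close> is, up to a constant, the integral of \<open>h\<close>, and the
  integral of a continuous function is differentiable everywhere. This removes the exceptional null
  set from the differential equation as long as the input is constant.\<close>

lemma abs_continuous_on_C1:
  fixes f h :: "real \<Rightarrow> real"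
  assumes ac: "abs_continuous_on a b f" and h: "continuous_on {a..b} h" and N: "negligible N"
    and deriv: "\<And>t. t \<in> {a..b} - N \<Longrightarrow> (f has_real_derivative h t) (at t within {a..b})"
    and t: "t \<in> {a..b}"
  shows "(f has_real_derivative h t) (at t within {a..b})"
proof -
  have eq: "integral {a..s} h = f s - f a" if "s \<in> {a..b}" for s
  proof (rule integral_unique[OF abs_continuous_on_has_integral[OF _ _ N]])
    show "a \<le> s" using that by simp
    show "abs_continuous_on a s f" using ac that by (auto intro: abs_continuous_on_subset)
    show "(f has_real_derivative h t) (at t within {a..s})" if "t \<in> {a..s} - N" for t
      using that \<open>s \<in> {a..b}\<close> by (intro DERIV_subset[OF deriv]) auto
  qed
  have "((\<lambda>s. integral {a..s} h + f a) has_real_derivative h t) (at t within {a..b})"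
    using integral_has_real_derivative[OF h t] by (auto intro!: derivative_eq_intros)
  then show ?thesis
    by (rule has_field_derivative_transform_within[where d = 1]) (use t eq in auto)
qed

lemma has_real_derivative_shift:
  assumes "(g has_real_derivative D) (at (a + t) within {a..b})"
  shows "((\<lambda>\<tau>. g (a + \<tau>)) has_real_derivative D) (at t within {0..b - a})"
proof -
  have "(+) a ` {0..b - a} = {a..b}" by (simp add: image_add_atLeastAtMost)
  with assms have "(g has_real_derivative D) (at (a + t) within (+) a ` {0..b - a})" by simp
  moreover have "((+) a has_real_derivative 1) (at t within {0..b - a})"
    by (auto intro!: derivative_eq_intros)
  ultimately have "(g \<circ> (+) a has_real_derivative D * 1) (at t within {0..b - a})"
    by (rule DERIV_image_chain)
  then show ?thesis by (simp add: o_def)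
qed

section \<open>Convergent power series in several variables\<close>

text \<open>The ball of radius \<open>B\<close> in the Banach algebra of power series that converge absolutely on the polydisc of radius \<open>r\<close>.\<close>
definition analytic_germ :: "nat \<Rightarrow> real \<Rightarrow> real \<Rightarrow> (rvec \<Rightarrow> real) \<Rightarrow> bool" where
  "analytic_germ n r B f \<longleftrightarrow>
     (\<exists>c. (\<lambda>k. \<bar>c k\<bar> * monomial n k (\<lambda>_. r)) summable_on multi_index n \<and>
        (\<Sum>\<^sub>\<infinity>k\<in>multi_index n. \<bar>c k\<bar> * monomial n k (\<lambda>_. r)) \<le> B \<and>
        (\<forall>s. (\<forall>i<n. \<bar>s i\<bar> \<le> r) \<longrightarrow> ((\<lambda>k. c k * monomial n k s) has_sum f s) (multi_index n)))"

lemma monomial_nonneg: "(\<And>i. i < n \<Longrightarrow> 0 \<le> x i) \<Longrightarrow> 0 \<le> monomial n k x"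
  unfolding monomial_def by (intro prod_nonneg) auto

lemma monomial_pos: "(\<And>i. i < n \<Longrightarrow> 0 < x i) \<Longrightarrow> 0 < monomial n k x"
  unfolding monomial_def by (intro prod_pos) auto

lemma abs_monomial_le:
  assumes "\<And>i. i < n \<Longrightarrow> \<bar>x i\<bar> \<le> y i"
  shows "\<bar>monomial n k x\<bar> \<le> monomial n k y"
  unfolding monomial_def abs_prod
  by (intro prod_mono) (auto simp: power_abs intro!: power_mono assms)

lemma monomial_plus: "monomial n (\<lambda>i. k i + l i) x = monomial n k x * monomial n l x"
  unfolding monomial_def by (simp add: power_add prod.distrib)

lemma monomial_zero: "monomial n (\<lambda>_. 0) x = 1"
  unfolding monomial_def by simp

lemma monomial_single: "j < n \<Longrightarrow> monomial n (\<lambda>i. if i = j then 1 else 0) x = x j"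
proof -
  assume "j < n"
  then have "(\<Prod>i<n. x i ^ (if i = j then 1 else 0)) = (\<Prod>i<n. if j = i then x i else 1)"
    by (intro prod.cong) auto
  then show ?thesis using \<open>j < n\<close> unfolding monomial_def by simp
qed

lemma multi_index_closed:
  "(\<lambda>_. 0) \<in> multi_index n"
  "k \<in> multi_index n \<Longrightarrow> l \<in> multi_index n \<Longrightarrow> (\<lambda>i. k i + l i) \<in> multi_index n"
  "j < n \<Longrightarrow> (\<lambda>i. if i = j then 1 else 0) \<in> multi_index n"
  unfolding multi_index_def by auto

lemma abs_summable_on_dominated:
  fixes f :: "'a \<Rightarrow> real"
  assumes "g summable_on A" "\<And>x. x \<in> A \<Longrightarrow> \<bar>f x\<bar> \<le> g x"
  shows "f summable_on A"
  by (rule Infinite_Sum.abs_summable_summable, rule Infinite_Sum.abs_summable_on_comparison_test'[OF assms(1)])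
    (use assms(2) in auto)

text \<open>Terms with the same exponent need not be collected beforehand.\<close>
lemma analytic_germI:
  fixes I :: "'i set" and e :: "'i \<Rightarrow> nat \<Rightarrow> nat" and c :: "'i \<Rightarrow> real"
  assumes r: "r > 0" and e: "\<And>i. i \<in> I \<Longrightarrow> e i \<in> multi_index n"
    and major: "((\<lambda>i. \<bar>c i\<bar> * monomial n (e i) (\<lambda>_. r)) has_sum S) I" "S \<le> B"
    and f: "\<And>s. (\<And>i. i < n \<Longrightarrow> \<bar>s i\<bar> \<le> r) \<Longrightarrow> ((\<lambda>i. c i * monomial n (e i) s) has_sum f s) I"
  shows "analytic_germ n r B f"
proof -
  \<comment> \<open>The terms are grouped by exponent, so the sum over \<open>I\<close> becomes an
    iterated one over exponents and their fibres. \<open>C k\<close> is the collected coefficient,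
    and \<open>A k\<close> dominates its absolute value.\<close>
  define J where "J k = {i \<in> I. e i = k}" for k
  have bij: "bij_betw snd (Sigma (multi_index n) J) I"
    unfolding bij_betw_def J_def using e by (auto simp: inj_on_def image_iff)
  have reindex: "(g has_sum T) I \<Longrightarrow> ((\<lambda>p. g (snd p)) has_sum T) (Sigma (multi_index n) J)" for g :: "'i \<Rightarrow> real" and T
    using has_sum_reindex_bij_betw[OF bij, of g T] by simp
  have pos: "monomial n k (\<lambda>_. r) > 0" for k using r by (intro monomial_pos)
  define A where "A k = (\<Sum>\<^sub>\<infinity>i\<in>J k. \<bar>c i\<bar>)" for k
  define C where "C k = (\<Sum>\<^sub>\<infinity>i\<in>J k. c i)" for k
  have abs: "(\<lambda>i. \<bar>c i\<bar>) summable_on J k" for k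
  proof -
    have "(\<lambda>i. \<bar>c i\<bar> * monomial n (e i) (\<lambda>_. r)) summable_on J k"
      by (rule summable_on_subset_banach[OF has_sum_imp_summable[OF major(1)]]) (auto simp: J_def)
    then have "(\<lambda>i. \<bar>c i\<bar> * monomial n k (\<lambda>_. r)) summable_on J k"
      by (rule summable_on_cong[THEN iffD1, rotated]) (auto simp: J_def)
    then show ?thesis using pos[of k] by (simp add: summable_on_cmult_left')
  qed
  have sumC: "(c has_sum C k) (J k)" for k
    unfolding C_def by (intro has_sum_infsum abs_summable_on_dominated[OF abs]) simp
  have sumA: "((\<lambda>i. \<bar>c i\<bar>) has_sum A k) (J k)" for k
    unfolding A_def by (intro has_sum_infsum abs)
  have CA: "\<bar>C k\<bar> \<le> A k" for k
    unfolding C_def A_def using norm_infsum_bound[of c "J k"] abs[of k] by simp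
  have hA: "((\<lambda>k. A k * monomial n k (\<lambda>_. r)) has_sum S) (multi_index n)"
  proof (rule has_sum_SigmaD[OF reindex[OF major(1)]])
    fix k
    have "((\<lambda>i. \<bar>c i\<bar> * monomial n k (\<lambda>_. r)) has_sum A k * monomial n k (\<lambda>_. r)) (J k)"
      by (rule has_sum_cmult_left[OF sumA])
    then show "((\<lambda>i. \<bar>c (snd (k, i))\<bar> * monomial n (e (snd (k, i))) (\<lambda>_. r)) has_sum A k * monomial n k (\<lambda>_. r)) (J k)"
      by (rule has_sum_cong[THEN iffD1, rotated]) (auto simp: J_def)
  qed
  have CS: "(\<lambda>k. \<bar>C k\<bar> * monomial n k (\<lambda>_. r)) summable_on multi_index n"
    using CA pos by (intro abs_summable_on_dominated[OF has_sum_imp_summable[OF hA]])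
      (auto simp: abs_mult less_imp_le intro!: mult_right_mono)
  have "(\<Sum>\<^sub>\<infinity>k\<in>multi_index n. \<bar>C k\<bar> * monomial n k (\<lambda>_. r)) \<le> S"
    using CA pos by (intro has_sum_mono[OF has_sum_infsum[OF CS] hA] mult_right_mono) (auto simp: less_imp_le)
  moreover have "((\<lambda>k. C k * monomial n k s) has_sum f s) (multi_index n)"
    if s: "\<forall>i<n. \<bar>s i\<bar> \<le> r" for s
  proof (rule has_sum_SigmaD[OF reindex[OF f]])
    fix k
    have "((\<lambda>i. c i * monomial n k s) has_sum C k * monomial n k s) (J k)"
      by (rule has_sum_cmult_left[OF sumC])
    then show "((\<lambda>i. c (snd (k, i)) * monomial n (e (snd (k, i))) s) has_sum C k * monomial n k s) (J k)"
      by (rule has_sum_cong[THEN iffD1, rotated]) (auto simp: J_def)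
  qed (use s in auto)
  ultimately show ?thesis
    unfolding analytic_germ_def using CS major(2) by (intro exI[of _ C]) auto
qed

lemma analytic_germE:
  assumes "analytic_germ n r B f"
  obtains c A where "((\<lambda>k. \<bar>c k\<bar> * monomial n k (\<lambda>_. r)) has_sum A) (multi_index n)" "A \<le> B"
    "\<And>s. (\<And>i. i < n \<Longrightarrow> \<bar>s i\<bar> \<le> r) \<Longrightarrow> ((\<lambda>k. c k * monomial n k s) has_sum f s) (multi_index n)"
proof -
  obtain c where c: "(\<lambda>k. \<bar>c k\<bar> * monomial n k (\<lambda>_. r)) summable_on multi_index n"
    "(\<Sum>\<^sub>\<infinity>k\<in>multi_index n. \<bar>c k\<bar> * monomial n k (\<lambda>_. r)) \<le> B"
    "\<forall>s. (\<forall>i<n. \<bar>s i\<bar> \<le> r) \<longrightarrow> ((\<lambda>k. c k * monomial n k s) has_sum f s) (multi_index n)"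
    using assms unfolding analytic_germ_def by blast
  show thesis by (rule that[OF has_sum_infsum[OF c(1)] c(2)]) (use c(3) in blast)
qed

lemma analytic_germ_const:
  assumes "r > 0" "\<bar>a\<bar> \<le> B"
  shows "analytic_germ n r B (\<lambda>_. a)"
  by (rule analytic_germI[where I = "{()}" and c = "\<lambda>_. a" and e = "\<lambda>_ _. 0" and S = "\<bar>a\<bar>"])
    (use assms in \<open>auto simp: monomial_zero multi_index_closed intro!: has_sum_finiteI\<close>)

lemma analytic_germ_coord:
  assumes "r > 0" "j < n"
  shows "analytic_germ n r r (\<lambda>s. s j)"
  by (rule analytic_germI[where I = "{()}" and c = "\<lambda>_. 1" and e = "\<lambda>_ i. if i = j then 1 else 0" and S = r])
    (use assms in \<open>auto simp: monomial_single multi_index_closed intro!: has_sum_finiteI\<close>)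

text \<open>The Cauchy product, indexed by pairs of exponents and left to
  \<open>analytic_germI\<close> to collect. Absolute summability over pairs justifies the
  rearrangement and makes the norm submultiplicative.\<close>

lemma analytic_germ_mult:
  assumes r: "r > 0" and f: "analytic_germ n r B f" and g: "analytic_germ n r C g"
  shows "analytic_germ n r (B * C) (\<lambda>s. f s * g s)"
proof -
  let ?I = "multi_index n"
  obtain c A where c: "((\<lambda>k. \<bar>c k\<bar> * monomial n k (\<lambda>_. r)) has_sum A) ?I" "A \<le> B"
    "\<And>s. (\<And>i. i < n \<Longrightarrow> \<bar>s i\<bar> \<le> r) \<Longrightarrow> ((\<lambda>k. c k * monomial n k s) has_sum f s) ?I"
    by (rule analytic_germE[OF f]) blast
  obtain d D where d: "((\<lambda>k. \<bar>d k\<bar> * monomial n k (\<lambda>_. r)) has_sum D) ?I" "D \<le> C"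
    "\<And>s. (\<And>i. i < n \<Longrightarrow> \<bar>s i\<bar> \<le> r) \<Longrightarrow> ((\<lambda>k. d k * monomial n k s) has_sum g s) ?I"
    by (rule analytic_germE[OF g]) blast
  have mr: "monomial n k (\<lambda>_. r) \<ge> 0" for k using r by (intro monomial_nonneg) simp
  have nn: "A \<ge> 0" "D \<ge> 0"
    using has_sum_nonneg[OF c(1)] has_sum_nonneg[OF d(1)] mr by auto
  define e where "e p = (\<lambda>i. fst p i + snd p i)" for p :: "(nat \<Rightarrow> nat) \<times> (nat \<Rightarrow> nat)"
  define a where "a p = c (fst p) * d (snd p)" for p
  have split: "a (k, l) * monomial n (e (k, l)) s = (c k * monomial n k s) * (d l * monomial n l s)" for k l s
    by (simp add: a_def e_def monomial_plus)
  have split': "\<bar>a (k, l)\<bar> * monomial n (e (k, l)) s = (\<bar>c k\<bar> * monomial n k s) * (\<bar>d l\<bar> * monomial n l s)" for k l s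
    by (simp add: a_def e_def monomial_plus abs_mult)
  have inner: "((\<lambda>l. \<bar>a (k, l)\<bar> * monomial n (e (k, l)) (\<lambda>_. r)) has_sum (\<bar>c k\<bar> * monomial n k (\<lambda>_. r)) * D) ?I" for k
    unfolding split' by (rule has_sum_cmult_right[OF d(1)])
  have outer: "((\<lambda>k. (\<bar>c k\<bar> * monomial n k (\<lambda>_. r)) * D) has_sum A * D) ?I"
    by (rule has_sum_cmult_left[OF c(1)])
  have sm: "(\<lambda>p. \<bar>a p\<bar> * monomial n (e p) (\<lambda>_. r)) summable_on ?I \<times> ?I"
    using mr by (intro summable_on_SigmaI[OF inner has_sum_imp_summable[OF outer]]) simp
  show ?thesis
  proof (rule analytic_germI[where I = "?I \<times> ?I" and e = e and c = a and S = "A * D", OF r])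
    show "e p \<in> ?I" if "p \<in> ?I \<times> ?I" for p
      using that unfolding e_def by (auto intro: multi_index_closed)
    show "((\<lambda>p. \<bar>a p\<bar> * monomial n (e p) (\<lambda>_. r)) has_sum A * D) (?I \<times> ?I)"
      by (rule has_sum_SigmaI[OF inner outer sm])
    show "A * D \<le> B * C" using c(2) d(2) nn by (intro mult_mono) auto
    fix s assume s: "\<And>i. i < n \<Longrightarrow> \<bar>s i\<bar> \<le> r"
    show "((\<lambda>p. a p * monomial n (e p) s) has_sum f s * g s) (?I \<times> ?I)"
    proof (rule has_sum_SigmaI)
      show "((\<lambda>l. a (k, l) * monomial n (e (k, l)) s) has_sum (c k * monomial n k s) * g s) ?I" for k
        unfolding split by (rule has_sum_cmult_right[OF d(3)[OF s]])
      show "((\<lambda>k. (c k * monomial n k s) * g s) has_sum f s * g s) ?I"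
        by (rule has_sum_cmult_left[OF c(3)[OF s]])
      show "(\<lambda>p. a p * monomial n (e p) s) summable_on ?I \<times> ?I"
        by (rule abs_summable_on_dominated[OF sm])
          (auto simp: abs_mult intro!: mult_left_mono abs_monomial_le s)
    qed
  qed
qed

text \<open>Completeness of the algebra of germs: summable norm bounds make the double family of
  terms absolutely summable, so the order of summation can be exchanged. This is what turns a Lie
  series of germs into a germ.\<close>

lemma analytic_germ_suminf:
  assumes r: "r > 0" and f: "\<And>m :: nat. analytic_germ n r (B m) (f m)"
    and B: "B sums C" and g: "\<And>s. (\<And>i. i < n \<Longrightarrow> \<bar>s i\<bar> \<le> r) \<Longrightarrow> (\<lambda>m. f m s) sums g s"
  shows "analytic_germ n r C g"
proof -
  let ?I = "multi_index n"
  obtain c A where c: "\<And>m. ((\<lambda>k. \<bar>c m k\<bar> * monomial n k (\<lambda>_. r)) has_sum A m) ?I" "\<And>m. A m \<le> B m"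
    "\<And>m s. (\<And>i. i < n \<Longrightarrow> \<bar>s i\<bar> \<le> r) \<Longrightarrow> ((\<lambda>k. c m k * monomial n k s) has_sum f m s) ?I"
  proof -
    have "\<forall>m. \<exists>c A. ((\<lambda>k. \<bar>c k\<bar> * monomial n k (\<lambda>_. r)) has_sum A) ?I \<and> A \<le> B m \<and>
      (\<forall>s. (\<forall>i<n. \<bar>s i\<bar> \<le> r) \<longrightarrow> ((\<lambda>k. c k * monomial n k s) has_sum f m s) ?I)"
      by (rule allI, rule analytic_germE[OF f]) blast
    from choice[OF this] obtain c where "\<forall>m. \<exists>A. ((\<lambda>k. \<bar>c m k\<bar> * monomial n k (\<lambda>_. r)) has_sum A) ?I \<and> A \<le> B m \<and>
      (\<forall>s. (\<forall>i<n. \<bar>s i\<bar> \<le> r) \<longrightarrow> ((\<lambda>k. c m k * monomial n k s) has_sum f m s) ?I)" ..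
    from choice[OF this] obtain A where "\<forall>m. ((\<lambda>k. \<bar>c m k\<bar> * monomial n k (\<lambda>_. r)) has_sum A m) ?I \<and> A m \<le> B m \<and>
      (\<forall>s. (\<forall>i<n. \<bar>s i\<bar> \<le> r) \<longrightarrow> ((\<lambda>k. c m k * monomial n k s) has_sum f m s) ?I)" ..
    then show thesis by (intro that[of c A]) blast+
  qed
  have mr: "monomial n k (\<lambda>_. r) \<ge> 0" for k using r by (intro monomial_nonneg) simp
  have A0: "A m \<ge> 0" for m using has_sum_nonneg[OF c(1)] mr by auto
  have Bs: "(B has_sum C) UNIV"
    using B by (rule sums_nonneg_imp_has_sum) (rule order_trans[OF A0 c(2)])
  have As: "A summable_on UNIV"
    using A0 c(2) by (intro abs_summable_on_dominated[OF has_sum_imp_summable[OF Bs]]) auto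
  have AC: "infsum A UNIV \<le> C" by (rule has_sum_mono[OF has_sum_infsum[OF As] Bs]) (rule c(2))
  define e where "e p = snd p" for p :: "nat \<times> (nat \<Rightarrow> nat)"
  define a where "a p = c (fst p) (snd p)" for p
  have sm: "(\<lambda>p. \<bar>a p\<bar> * monomial n (e p) (\<lambda>_. r)) summable_on UNIV \<times> ?I"
    using mr by (intro summable_on_SigmaI[OF _ As]) (auto simp: a_def e_def c(1))
  show ?thesis
  proof (rule analytic_germI[where I = "UNIV \<times> ?I" and e = e and c = a, OF r _ _ AC])
    show "e p \<in> ?I" if "p \<in> UNIV \<times> ?I" for p
      using that unfolding e_def by auto
    show "((\<lambda>p. \<bar>a p\<bar> * monomial n (e p) (\<lambda>_. r)) has_sum infsum A UNIV) (UNIV \<times> ?I)"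
      by (rule has_sum_SigmaI[OF _ has_sum_infsum[OF As] sm]) (simp add: a_def e_def c(1))
    fix s assume s: "\<And>i. i < n \<Longrightarrow> \<bar>s i\<bar> \<le> r"
    have sm': "(\<lambda>p. a p * monomial n (e p) s) summable_on UNIV \<times> ?I"
      by (rule abs_summable_on_dominated[OF sm])
        (auto simp: abs_mult intro!: mult_left_mono abs_monomial_le s)
    have "((\<lambda>m. f m s) has_sum infsum (\<lambda>p. a p * monomial n (e p) s) (UNIV \<times> ?I)) UNIV"
      by (rule has_sum_SigmaD[OF has_sum_infsum[OF sm']]) (simp add: a_def e_def c(3)[OF s])
    then have "(\<lambda>m. f m s) sums infsum (\<lambda>p. a p * monomial n (e p) s) (UNIV \<times> ?I)"
      by (rule has_sum_imp_sums)
    then have "infsum (\<lambda>p. a p * monomial n (e p) s) (UNIV \<times> ?I) = g s"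
      by (rule sums_unique2[OF _ g[OF s]])
    then show "((\<lambda>p. a p * monomial n (e p) s) has_sum g s) (UNIV \<times> ?I)"
      using has_sum_infsum[OF sm'] by simp
  qed
qed

lemma analytic_germ_mono: "analytic_germ n r B f \<Longrightarrow> B \<le> C \<Longrightarrow> analytic_germ n r C f"
  unfolding analytic_germ_def
  by (elim exE conjE, intro exI conjI, assumption, erule (1) order_trans, assumption)

text \<open>Treated as a series with at most two nonzero terms, so that
  \<open>analytic_germ_suminf\<close> does the rearrangement.\<close>

lemma analytic_germ_add:
  assumes r: "r > 0" and f: "analytic_germ n r B f" and g: "analytic_germ n r C g"
  shows "analytic_germ n r (B + C) (\<lambda>s. f s + g s)"
proof (rule analytic_germ_suminf[where f = "\<lambda>m s. if m = 0 then f s else if m = 1 then g s else 0"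
      and B = "\<lambda>m. if m = 0 then B else if m = 1 then C else 0", OF r])
  have two: "(\<lambda>m :: nat. if m = 0 then x else if m = 1 then y else 0) sums (x + y)" for x y :: real
  proof -
    have "(\<lambda>m :: nat. if m = 0 then x else if m = 1 then y else 0) sums (\<Sum>m\<in>{0, 1 :: nat}. if m = 0 then x else if m = 1 then y else 0)"
      by (rule sums_finite) auto
    then show ?thesis by simp
  qed
  show "(\<lambda>m. if m = 0 then f s else if m = 1 then g s else 0) sums (f s + g s)" for s by (rule two)
  show "(\<lambda>m :: nat. if m = 0 then B else if m = 1 then C else 0) sums (B + C)" by (rule two)
  show "analytic_germ n r (if m = 0 then B else if m = 1 then C else 0)
      (\<lambda>s. if m = 0 then f s else if m = 1 then g s else 0)" for m :: nat
    using f g analytic_germ_const[OF r, of 0 0 n] by (cases "m = 0"; cases "m = 1") simp_all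
qed

lemma analytic_germ_power:
  assumes r: "r > 0" and f: "analytic_germ n r B f"
  shows "analytic_germ n r (B ^ k) (\<lambda>s. f s ^ k)"
proof (induction k)
  case 0
  show ?case using analytic_germ_const[OF r, of 1 1] by simp
next
  case (Suc k)
  show ?case using analytic_germ_mult[OF r f Suc] by simp
qed

lemma monomial_scale:
  "monomial n k (\<lambda>_. q * r) = q ^ (\<Sum>i<n. k i) * monomial n k (\<lambda>_. r)"
  unfolding monomial_def by (simp add: power_mult_distrib prod.distrib power_sum)

lemma monomial_at_zero:
  "k \<in> multi_index n \<Longrightarrow> monomial n k (\<lambda>_. 0) = (if k = (\<lambda>_. 0) then 1 else 0)"
proof (cases "k = (\<lambda>_. 0)")
  case False
  assume "k \<in> multi_index n"
  moreover obtain i where "k i \<noteq> 0" using False by (auto simp: fun_eq_iff)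
  ultimately have "i < n" "k i \<noteq> 0" unfolding multi_index_def by (cases "i < n"; simp)+
  then show ?thesis using False unfolding monomial_def by (auto intro!: bexI[of _ i])
qed (simp add: monomial_zero)

lemma has_sum_single_eq:
  fixes f :: "'a \<Rightarrow> real"
  assumes "i \<in> I" "\<And>j. j \<in> I \<Longrightarrow> j \<noteq> i \<Longrightarrow> f j = 0"
  shows "(f has_sum f i) I"
proof -
  have "(f has_sum f i) {i}" by (rule has_sum_finiteI) auto
  then show ?thesis using has_sum_cong_neutral[of I "{i}" f f "f i"] assms by auto
qed

text \<open>Scaling the radius by \<open>q \<le> 1\<close> scales every nonconstant monomial by at
  least one factor \<open>q\<close>, so the norm can be pushed arbitrarily close to the absolute
  value at the centre.\<close>

lemma analytic_germ_shrink:
  assumes r: "r > 0" and f: "analytic_germ n r B f" and d: "d > 0"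
  shows "\<exists>r0>0. r0 \<le> r \<and> (\<forall>r'>0. r' \<le> r0 \<longrightarrow> analytic_germ n r' (\<bar>f (\<lambda>_. 0)\<bar> + d) f)"
proof -
  let ?I = "multi_index n"
  let ?z = "\<lambda>_ :: nat. 0 :: nat"
  obtain c A where c: "((\<lambda>k. \<bar>c k\<bar> * monomial n k (\<lambda>_. r)) has_sum A) ?I" "A \<le> B"
    "\<And>s. (\<And>i. i < n \<Longrightarrow> \<bar>s i\<bar> \<le> r) \<Longrightarrow> ((\<lambda>k. c k * monomial n k s) has_sum f s) ?I"
    by (rule analytic_germE[OF f]) blast
  have mr: "monomial n k (\<lambda>_. r) \<ge> 0" for k using r by (intro monomial_nonneg) simp
  have A0: "A \<ge> 0" using has_sum_nonneg[OF c(1)] mr by auto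
  have "((\<lambda>k. c k * monomial n k (\<lambda>_. 0)) has_sum c ?z * monomial n ?z (\<lambda>_. 0)) ?I"
    by (rule has_sum_single_eq) (auto simp: multi_index_closed monomial_at_zero)
  then have f0: "f (\<lambda>_. 0) = c ?z"
    using has_sum_unique[OF c(3)[of "\<lambda>_. 0"]] r by (simp add: monomial_zero)
  \<comment> \<open>Chosen so that the nonconstant part, of norm at most \<open>A\<close>,
    contributes at most \<open>d\<close>; the \<open>+ 1\<close> avoids division by 0.\<close>
  define q where "q = min 1 (d / (A + 1))"
  have q: "q > 0" "q \<le> 1" "q * A \<le> d"
  proof -
    have "q * A \<le> d / (A + 1) * A" unfolding q_def using A0 by (intro mult_right_mono) auto
    also have "\<dots> \<le> d" using A0 d by (simp add: field_simps)
    finally show "q * A \<le> d" .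
  qed (use d A0 in \<open>auto simp: q_def\<close>)
  show ?thesis
  proof (intro exI[of _ "q * r"] conjI allI impI)
    show "q * r > 0" using q r by simp
    show "q * r \<le> r" using q r by (simp add: mult_le_cancel_right1)
    fix r' assume r': "r' > 0" "r' \<le> q * r"
    have "r' \<le> r" using r'(2) \<open>q * r \<le> r\<close> by simp
    define g where "g k = (if k = ?z then \<bar>c ?z\<bar> else 0) + q * (\<bar>c k\<bar> * monomial n k (\<lambda>_. r))" for k
    have gs: "(g has_sum \<bar>c ?z\<bar> + q * A) ?I"
      unfolding g_def using has_sum_single_eq[of ?z ?I "\<lambda>k. if k = ?z then \<bar>c ?z\<bar> else 0"]
      by (intro has_sum_add has_sum_cmult_right c(1)) (auto simp: multi_index_closed)
    have le: "\<bar>c k\<bar> * monomial n k (\<lambda>_. r') \<le> g k" if k: "k \<in> ?I" for k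
    proof (cases "k = ?z")
      case True
      then show ?thesis using q mr[of k] by (simp add: g_def monomial_zero)
    next
      case False
      then obtain i where i0: "k i \<noteq> 0" by (auto simp: fun_eq_iff)
      then have i: "i < n" using k unfolding multi_index_def by (cases "i < n") auto
      with i0 have "(\<Sum>i<n. k i) \<ge> 1" using member_le_sum[of i "{..<n}" k] by auto
      then have "q ^ (\<Sum>i<n. k i) \<le> q ^ 1" using q by (intro power_decreasing) auto
      then have "monomial n k (\<lambda>_. q * r) \<le> q * monomial n k (\<lambda>_. r)"
        unfolding monomial_scale using mr by (simp add: mult_right_mono)
      moreover have "monomial n k (\<lambda>_. r') \<le> monomial n k (\<lambda>_. q * r)"
        using abs_monomial_le[of n "\<lambda>_. r'" "\<lambda>_. q * r" k] r' by simp
      ultimately have "monomial n k (\<lambda>_. r') \<le> q * monomial n k (\<lambda>_. r)" by simp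
      then have "\<bar>c k\<bar> * monomial n k (\<lambda>_. r') \<le> \<bar>c k\<bar> * (q * monomial n k (\<lambda>_. r))"
        by (rule mult_left_mono) simp
      then show ?thesis using False by (simp add: g_def mult.left_commute)
    qed
    have m0: "0 \<le> monomial n k (\<lambda>_. r')" for k using r' by (intro monomial_nonneg) simp
    have sm: "(\<lambda>k. \<bar>c k\<bar> * monomial n k (\<lambda>_. r')) summable_on ?I"
      by (rule abs_summable_on_dominated[OF has_sum_imp_summable[OF gs]]) (use le m0 in \<open>simp add: abs_mult\<close>)
    have le': "infsum (\<lambda>k. \<bar>c k\<bar> * monomial n k (\<lambda>_. r')) ?I \<le> \<bar>c ?z\<bar> + q * A"
      by (rule has_sum_mono[OF has_sum_infsum[OF sm] gs]) (rule le)
    show "analytic_germ n r' (\<bar>f (\<lambda>_. 0)\<bar> + d) f"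
      unfolding analytic_germ_def f0
    proof (intro exI[of _ c] conjI allI impI sm)
      show "infsum (\<lambda>k. \<bar>c k\<bar> * monomial n k (\<lambda>_. r')) ?I \<le> \<bar>c ?z\<bar> + d"
        using le' q(3) by linarith
      fix s assume "\<forall>i<n. \<bar>s i\<bar> \<le> r'"
      then show "((\<lambda>k. c k * monomial n k s) has_sum f s) ?I"
        using \<open>r' \<le> r\<close> by (intro c(3)) force
    qed
  qed
qed

lemma analytic_germ_bound:
  assumes f: "analytic_germ n r B f" and s: "\<And>i. i < n \<Longrightarrow> \<bar>s i\<bar> \<le> r"
  shows "\<bar>f s\<bar> \<le> B"
proof -
  obtain c A where c: "((\<lambda>k. \<bar>c k\<bar> * monomial n k (\<lambda>_. r)) has_sum A) (multi_index n)" "A \<le> B"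
    "\<And>s. (\<And>i. i < n \<Longrightarrow> \<bar>s i\<bar> \<le> r) \<Longrightarrow> ((\<lambda>k. c k * monomial n k s) has_sum f s) (multi_index n)"
    by (rule analytic_germE[OF f]) blast
  have le: "\<bar>c k * monomial n k s\<bar> \<le> \<bar>c k\<bar> * monomial n k (\<lambda>_. r)" for k
    unfolding abs_mult using s by (intro mult_left_mono abs_monomial_le) auto
  have "f s \<le> A" by (rule has_sum_mono[OF c(3)[OF s] c(1)]) (use le abs_le_D1 in auto)
  moreover have "- f s \<le> A"
    by (rule has_sum_mono[OF has_sum_uminusI[OF c(3)[OF s]] c(1)]) (use le abs_le_D2 in auto)
  ultimately show ?thesis using c(2) by linarith
qed

text \<open>The conclusion holds for all smaller radii, so that several such choices can be combined
  by taking a minimum.\<close>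

lemma analytic_germs_shrink:
  fixes N :: nat
  assumes "\<And>i. i < N \<Longrightarrow> \<exists>r>0. \<exists>B. analytic_germ n r B (w i)" "d > 0"
  shows "\<exists>r0>0. \<forall>r>0. r \<le> r0 \<longrightarrow> (\<forall>i<N. analytic_germ n r (\<bar>w i (\<lambda>_. 0)\<bar> + d) (w i))"
  using assms(1)
proof (induction N)
  case 0
  show ?case by (auto intro: exI[of _ 1])
next
  case (Suc N)
  then obtain r0 where r0: "r0 > 0" "\<And>r. r > 0 \<Longrightarrow> r \<le> r0 \<Longrightarrow> \<forall>i<N. analytic_germ n r (\<bar>w i (\<lambda>_. 0)\<bar> + d) (w i)"
    by (meson less_Suc_eq)
  obtain r1 B where r1: "r1 > 0" "analytic_germ n r1 B (w N)" using Suc.prems by blast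
  obtain r2 where r2: "r2 > 0" "\<And>r. r > 0 \<Longrightarrow> r \<le> r2 \<Longrightarrow> analytic_germ n r (\<bar>w N (\<lambda>_. 0)\<bar> + d) (w N)"
    using analytic_germ_shrink[OF r1 assms(2)] by blast
  show ?case
    by (rule exI[of _ "min r0 r2"]) (use r0 r2 in \<open>auto simp: less_Suc_eq\<close>)
qed

section \<open>Zeros of germs in one variable\<close>

lemma analytic_germ_powser:
  assumes X: "analytic_germ 1 r B X"
  shows "\<exists>c. \<forall>s. \<bar>s\<bar> \<le> r \<longrightarrow> (\<lambda>k. c k * s ^ k) sums X (\<lambda>_. s)"
proof -
  obtain c where c: "\<And>s. (\<And>i. i < 1 \<Longrightarrow> \<bar>s i\<bar> \<le> r) \<Longrightarrow>
      ((\<lambda>k. c k * monomial 1 k s) has_sum X s) (multi_index 1)"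
    using X by (rule analytic_germE) blast
  let ?e = "\<lambda>k i :: nat. if i = 0 then k else (0 :: nat)"
  have bij: "bij_betw ?e UNIV (multi_index 1)"
  proof (rule bij_betw_byWitness[where f' = "\<lambda>e. e 0"])
    show "\<forall>e\<in>multi_index 1. ?e (e 0) = e" by (auto simp: multi_index_def fun_eq_iff)
  qed (auto simp: multi_index_def)
  have "(\<lambda>k. c (?e k) * s ^ k) sums X (\<lambda>_. s)" if "\<bar>s\<bar> \<le> r" for s
  proof -
    have "((\<lambda>k. c k * monomial 1 k (\<lambda>_. s)) has_sum X (\<lambda>_. s)) (multi_index 1)"
      using that by (intro c) simp
    then have "((\<lambda>k. c (?e k) * monomial 1 (?e k) (\<lambda>_. s)) has_sum X (\<lambda>_. s)) UNIV"
      using has_sum_reindex_bij_betw[OF bij, of "\<lambda>k. c k * monomial 1 k (\<lambda>_. s)"] by simp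
    then have "(\<lambda>k. c (?e k) * monomial 1 (?e k) (\<lambda>_. s)) sums X (\<lambda>_. s)" by (rule has_sum_imp_sums)
    then show ?thesis by (simp add: monomial_def lessThan_Suc)
  qed
  then show ?thesis by (intro exI[of _ "\<lambda>k. c (?e k)"] allI impI)
qed

lemma analytic_germ_isolated_zeros:
  assumes r: "r > 0" and X: "analytic_germ 1 r B X"
  shows "(\<exists>\<delta>>0. \<forall>s. \<bar>s\<bar> < \<delta> \<longrightarrow> X (\<lambda>_. s) = 0) \<or>
    (\<exists>\<delta>>0. \<forall>s. s \<noteq> 0 \<longrightarrow> \<bar>s\<bar> < \<delta> \<longrightarrow> X (\<lambda>_. s) \<noteq> 0)"
proof -
  obtain c where c: "\<And>s. \<bar>s\<bar> \<le> r \<Longrightarrow> (\<lambda>k. c k * s ^ k) sums X (\<lambda>_. s)"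
    using analytic_germ_powser[OF X] by blast
  show ?thesis
  proof (cases "\<forall>k. c k = 0")
    case True
    have "X (\<lambda>_. s) = 0" if "\<bar>s\<bar> < r" for s
      using c[of s] that True sums_unique2[OF _ sums_zero] by auto
    then show ?thesis using r by (intro disjI1 exI[of _ r]) auto
  next
    case False
    then obtain m where m: "c m \<noteq> 0" by blast
    \<comment> \<open>The coefficients of \<open>s * X\<close>: this function vanishes at 0 whatever
      \<open>X\<close> does there, as \<open>powser_0_nonzero\<close> demands, and has the same
      zeros as \<open>X\<close> elsewhere.\<close>
    define d where "d k = (case k of 0 \<Rightarrow> 0 | Suc k \<Rightarrow> c k)" for k
    have d: "(\<lambda>k. d k * (s - 0) ^ k) sums (s * X (\<lambda>_. s))" if "norm (s - 0) < r" for s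
    proof -
      have "(\<lambda>k. s * (c k * s ^ k)) sums (s * X (\<lambda>_. s))"
        using that by (intro sums_mult c) simp
      then have "(\<lambda>k. d (Suc k) * s ^ Suc k) sums (s * X (\<lambda>_. s))"
        by (simp add: d_def mult_ac)
      then show ?thesis by (subst (asm) sums_Suc_iff) (simp add: d_def)
    qed
    obtain \<delta> where "\<delta> > 0" "\<And>s. s \<in> cball 0 \<delta> - {0} \<Longrightarrow> s * X (\<lambda>_. s) \<noteq> 0"
      by (rule powser_0_nonzero[OF r d, of "Suc m"]) (use m in \<open>auto simp: d_def\<close>)
    then show ?thesis by (intro disjI2 exI[of _ \<delta>]) auto
  qed
qed

text \<open>Zeros are isolated wherever a function does not vanish locally, so near each point
  \<open>F\<close> or \<open>G\<close> vanishes identically. The points where \<open>F\<close>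
  vanishes locally form a clopen subset of the connected interval. Evaluating \<open>F\<close> and
  \<open>G\<close> at opposite ends fits a path between two prescribed states.\<close>

lemma analytic_no_zero_divisors:
  fixes F G :: "real \<Rightarrow> real"
  assumes F: "\<And>x. x \<in> {0..1} \<Longrightarrow> \<exists>r>0. \<exists>B X. analytic_germ 1 r B X \<and>
      (\<forall>s. \<bar>s\<bar> \<le> r \<longrightarrow> x + s \<in> {0..1} \<longrightarrow> F (x + s) = X (\<lambda>_. s))"
    and G: "\<And>x. x \<in> {0..1} \<Longrightarrow> \<exists>r>0. \<exists>B X. analytic_germ 1 r B X \<and>
      (\<forall>s. \<bar>s\<bar> \<le> r \<longrightarrow> x + s \<in> {0..1} \<longrightarrow> G (x + s) = X (\<lambda>_. s))"
    and zero: "\<And>x. x \<in> {0..1} \<Longrightarrow> F x * G x = 0"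
  shows "F 0 = 0 \<or> G 1 = 0"
proof -
  \<comment> \<open>The interior of the zero set, relative to the unit interval.\<close>
  define Z where "Z H = {x \<in> {0..1}. \<exists>\<delta>>0. \<forall>y\<in>{0..1}. \<bar>y - x\<bar> < \<delta> \<longrightarrow> H y = 0}" for H :: "real \<Rightarrow> real"
  have isolated: "\<exists>\<delta>>0. \<forall>y\<in>{0..1}. y \<noteq> x \<longrightarrow> \<bar>y - x\<bar> < \<delta> \<longrightarrow> H y \<noteq> 0"
    if H: "\<And>x. x \<in> {0..1} \<Longrightarrow> \<exists>r>0. \<exists>B X. analytic_germ 1 r B X \<and>
      (\<forall>s. \<bar>s\<bar> \<le> r \<longrightarrow> x + s \<in> {0..1} \<longrightarrow> H (x + s) = X (\<lambda>_. s))"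
      and x: "x \<in> {0..1}" "x \<notin> Z H" for H x
  proof -
    obtain r B X where r: "r > 0" "analytic_germ 1 r B X"
      and X: "\<And>s. \<bar>s\<bar> \<le> r \<Longrightarrow> x + s \<in> {0..1} \<Longrightarrow> H (x + s) = X (\<lambda>_. s)" using H[OF x(1)] by blast
    have HX: "H y = X (\<lambda>_. y - x)" if "y \<in> {0..1}" "\<bar>y - x\<bar> < r" for y
      using X[of "y - x"] that by simp
    from analytic_germ_isolated_zeros[OF r] show ?thesis
    proof (elim disjE exE conjE)
      fix \<delta> assume \<delta>: "\<delta> > 0" "\<forall>s. \<bar>s\<bar> < \<delta> \<longrightarrow> X (\<lambda>_. s) = 0"
      have "\<forall>y\<in>{0..1}. \<bar>y - x\<bar> < min \<delta> r \<longrightarrow> H y = 0" using HX \<delta>(2) by simp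
      moreover have "min \<delta> r > 0" using \<delta> r by simp
      ultimately have "x \<in> Z H" using x(1) unfolding Z_def by blast
      then show ?thesis using x by simp
    next
      fix \<delta> assume \<delta>: "\<delta> > 0" "\<forall>s. s \<noteq> 0 \<longrightarrow> \<bar>s\<bar> < \<delta> \<longrightarrow> X (\<lambda>_. s) \<noteq> 0"
      have "\<forall>y\<in>{0..1}. y \<noteq> x \<longrightarrow> \<bar>y - x\<bar> < min \<delta> r \<longrightarrow> H y \<noteq> 0" using HX \<delta>(2) by simp
      moreover have "min \<delta> r > 0" using \<delta> r by simp
      ultimately show ?thesis by blast
    qed
  qed
  have cover: "x \<in> Z F \<or> x \<in> Z G" if x: "x \<in> {0..1}" for x
  proof (rule ccontr)
    assume "\<not> (x \<in> Z F \<or> x \<in> Z G)"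
    then obtain d e where d: "d > 0" "\<forall>y\<in>{0..1}. y \<noteq> x \<longrightarrow> \<bar>y - x\<bar> < d \<longrightarrow> F y \<noteq> 0"
      and e: "e > 0" "\<forall>y\<in>{0..1}. y \<noteq> x \<longrightarrow> \<bar>y - x\<bar> < e \<longrightarrow> G y \<noteq> 0"
      using isolated[OF F x] isolated[OF G x] by blast
    \<comment> \<open>With \<open>h\<close> at most one half, a move by \<open>h\<close> away from
      the nearer end, or to the right from the midpoint, stays in the interval and in both punctured
      neighbourhoods.\<close>
    define h where "h = min (1 / 2) (min d e / 2)"
    have h: "h > 0" "h < d" "h < e" "h \<le> 1 / 2" using d e unfolding h_def by auto
    define y where "y = (if x \<le> 1 / 2 then x + h else x - h)"
    have y: "y \<in> {0..1}" "y \<noteq> x" "\<bar>y - x\<bar> = h" using x h unfolding y_def by auto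
    then have "F y \<noteq> 0" "G y \<noteq> 0" using d e h by auto
    then show False using zero[OF y(1)] by simp
  qed
  have clopen: "Z F = {} \<or> Z F = {0..1}"
  proof -
    have sub: "Z F \<subseteq> {0..1}" unfolding Z_def by blast
    have "openin (top_of_set {0..1}) (Z F)"
      unfolding openin_euclidean_subtopology_iff
    proof (intro conjI sub ballI)
      fix x assume "x \<in> Z F"
      then obtain d where d: "d > 0" "\<forall>y\<in>{0..1}. \<bar>y - x\<bar> < d \<longrightarrow> F y = 0" unfolding Z_def by blast
      show "\<exists>e>0. \<forall>x'\<in>{0..1}. dist x' x < e \<longrightarrow> x' \<in> Z F"
      proof (intro exI[of _ "d / 2"] conjI ballI impI)
        fix x' :: real assume x': "x' \<in> {0..1}" "dist x' x < d / 2"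
        have "\<forall>y\<in>{0..1}. \<bar>y - x'\<bar> < d / 2 \<longrightarrow> F y = 0"
        proof (intro ballI impI)
          fix y :: real assume y: "y \<in> {0..1}" "\<bar>y - x'\<bar> < d / 2"
          have "\<bar>y - x\<bar> < d" using y x' unfolding dist_real_def by linarith
          then show "F y = 0" using d(2) y(1) by blast
        qed
        then show "x' \<in> Z F" using x'(1) d(1) unfolding Z_def by (auto intro!: exI[of _ "d / 2"])
      qed (use d in simp)
    qed
    moreover have "openin (top_of_set {0..1}) ({0..1} - Z F)"
      unfolding openin_euclidean_subtopology_iff
    proof (intro conjI ballI)
      fix x assume x: "x \<in> {0..1} - Z F"
      then obtain d where d: "d > 0" "\<forall>y\<in>{0..1}. y \<noteq> x \<longrightarrow> \<bar>y - x\<bar> < d \<longrightarrow> F y \<noteq> 0"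
        using isolated[OF F] by blast
      have notin: "y \<notin> Z F" if y: "y \<in> {0..1}" "F y \<noteq> 0" for y
      proof
        assume "y \<in> Z F"
        then obtain e where "e > 0" "\<forall>z\<in>{0..1}. \<bar>z - y\<bar> < e \<longrightarrow> F z = 0" unfolding Z_def by blast
        then have "F y = 0" using y(1) by (auto dest!: bspec[of _ _ y])
        then show False using y by simp
      qed
      show "\<exists>e>0. \<forall>x'\<in>{0..1}. dist x' x < e \<longrightarrow> x' \<in> {0..1} - Z F"
      proof (intro exI[of _ d] conjI ballI impI d(1))
        fix x' :: real assume x': "x' \<in> {0..1}" "dist x' x < d"
        show "x' \<in> {0..1} - Z F"
        proof (cases "x' = x")
          case False
          then have "F x' \<noteq> 0" using d(2) x' by (auto simp: dist_real_def)
          then show ?thesis using notin x'(1) by blast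
        qed (use x in simp)
      qed
    qed blast
    ultimately show ?thesis
      using connected_clopen[of "{0..1 :: real}"] sub unfolding closedin_def by auto
  qed
  have self: "x \<in> Z H \<Longrightarrow> H x = 0" for x H
    unfolding Z_def by (auto dest!: bspec[of _ _ x])
  show ?thesis
  proof (cases "Z F = {}")
    case True
    then show ?thesis using cover[of 1] self[of 1 G] by simp
  next
    case False
    then show ?thesis using clopen self[of 0 F] by simp
  qed
qed

section \<open>Polynomial functions\<close>

text \<open>Closure rules instead of coefficients make substitution and composition plain
  inductions. The index type is arbitrary because the enlarged systems name their coordinates by
  sums and tuples.\<close>

inductive polyfun :: "'i set \<Rightarrow> (('i \<Rightarrow> real) \<Rightarrow> real) \<Rightarrow> bool" for I where
  const: "polyfun I (\<lambda>_. a)"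
| coord: "i \<in> I \<Longrightarrow> polyfun I (\<lambda>x. x i)"
| add: "polyfun I p \<Longrightarrow> polyfun I q \<Longrightarrow> polyfun I (\<lambda>x. p x + q x)"
| mult: "polyfun I p \<Longrightarrow> polyfun I q \<Longrightarrow> polyfun I (\<lambda>x. p x * q x)"

lemma polyfun_sum:
  "(\<And>j. j \<in> J \<Longrightarrow> polyfun I (p j)) \<Longrightarrow> polyfun I (\<lambda>x. \<Sum>j\<in>J. p j x)"
  by (induction J rule: infinite_finite_induct) (auto intro: polyfun.intros)

lemma polyfun_prod:
  "(\<And>j. j \<in> J \<Longrightarrow> polyfun I (p j)) \<Longrightarrow> polyfun I (\<lambda>x. \<Prod>j\<in>J. p j x)"
  by (induction J rule: infinite_finite_induct) (auto intro: polyfun.intros)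

lemma polyfun_power: "polyfun I p \<Longrightarrow> polyfun I (\<lambda>x. p x ^ k)"
  by (induction k) (auto intro: polyfun.intros)

lemma polyfun_poly: "polyfun I p \<Longrightarrow> polyfun I (\<lambda>x. poly P (p x))"
  by (induction P) (auto intro: polyfun.intros)

lemma polyfun_neg: "polyfun I p \<Longrightarrow> polyfun I (\<lambda>x. - p x)"
  using polyfun.mult[OF polyfun.const[of I "- 1"], of p] by simp

lemma polyfun_continuous_on:
  assumes "polyfun I p" "\<And>i. i \<in> I \<Longrightarrow> continuous_on S (\<lambda>t. x t i)"
  shows "continuous_on S (\<lambda>t. p (x t))"
  using assms by (induction rule: polyfun.induct) (auto intro: continuous_intros)

lemma polyfun_subst:
  assumes "polyfun I p" "\<And>i. i \<in> I \<Longrightarrow> polyfun J (h i)"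
  shows "polyfun J (\<lambda>y. p (\<lambda>i. h i y))"
  using assms by (induction rule: polyfun.induct) (auto intro: polyfun.intros)

lemma polyfun_cong:
  assumes "polyfun I p" "\<And>i. i \<in> I \<Longrightarrow> x i = y i"
  shows "p x = p y"
  using assms by (induction rule: polyfun.induct) auto

section \<open>Degrees and the number of monomials\<close>

definition exponents :: "nat \<Rightarrow> nat \<Rightarrow> (nat \<Rightarrow> nat) set" where
  "exponents N D = {k \<in> multi_index N. \<forall>i<N. k i \<le> D}"

lemma exponents_finite_card: "finite (exponents N D)" "card (exponents N D) \<le> (D + 1) ^ N"
proof -
  let ?E = "{..<N} \<rightarrow>\<^sub>E {..D}"
  let ?ext = "\<lambda>k i. if i < N then k i else (0 :: nat)"
  have sub: "exponents N D \<subseteq> ?ext ` ?E"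
  proof
    fix k assume k: "k \<in> exponents N D"
    then have "k = ?ext (restrict k {..<N})"
      by (auto simp: exponents_def multi_index_def fun_eq_iff)
    moreover have "restrict k {..<N} \<in> ?E" using k by (auto simp: exponents_def)
    ultimately show "k \<in> ?ext ` ?E" by blast
  qed
  have fin: "finite ?E" by (intro finite_PiE) auto
  then show "finite (exponents N D)" using sub finite_subset by blast
  have "card (exponents N D) \<le> card ?E"
    using card_mono[OF finite_imageI[OF fin] sub] card_image_le[OF fin, of ?ext] by linarith
  also have "\<dots> = (D + 1) ^ N" by (subst card_PiE) auto
  finally show "card (exponents N D) \<le> (D + 1) ^ N" .
qed

text \<open>The degree is bounded in each variable separately, not in total: the admissible
  exponents form a box, which is easy to count, and degrees still add under products.\<close>

definition degree_le :: "nat \<Rightarrow> nat \<Rightarrow> (rvec \<Rightarrow> real) \<Rightarrow> bool" where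
  "degree_le N D p \<longleftrightarrow> (\<exists>c. \<forall>x. p x = (\<Sum>k\<in>exponents N D. c k * monomial N k x))"

text \<open>Exponents may repeat among the terms, as in \<open>analytic_germI\<close>, so a product
  can be indexed by pairs of exponents.\<close>

lemma degree_leI:
  assumes "finite I" "\<And>i. i \<in> I \<Longrightarrow> e i \<in> exponents N D"
    and p: "\<And>x. p x = (\<Sum>i\<in>I. c i * monomial N (e i) x)"
  shows "degree_le N D p"
  unfolding degree_le_def
proof (intro exI[of _ "\<lambda>k. \<Sum>i | i \<in> I \<and> e i = k. c i"] allI)
  fix x
  have "p x = (\<Sum>k\<in>exponents N D. \<Sum>i | i \<in> I \<and> e i = k. c i * monomial N (e i) x)"
    unfolding p by (rule sum.group[symmetric]) (use assms exponents_finite_card in auto)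
  also have "\<dots> = (\<Sum>k\<in>exponents N D. (\<Sum>i | i \<in> I \<and> e i = k. c i) * monomial N k x)"
    by (auto intro!: sum.cong simp: sum_distrib_right)
  finally show "p x = (\<Sum>k\<in>exponents N D. (\<Sum>i | i \<in> I \<and> e i = k. c i) * monomial N k x)" .
qed

lemma degree_le_const: "degree_le N D (\<lambda>_. a)"
  by (rule degree_leI[where I = "{()}" and e = "\<lambda>_ _. 0" and c = "\<lambda>_. a"])
    (auto simp: exponents_def multi_index_closed monomial_zero)

lemma degree_le_coord: "j < N \<Longrightarrow> degree_le N 1 (\<lambda>x. x j)"
  by (rule degree_leI[where I = "{()}" and e = "\<lambda>_ i. if i = j then 1 else 0" and c = "\<lambda>_. 1"])
    (use multi_index_closed(3) monomial_single in \<open>auto simp: exponents_def\<close>)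

lemma degree_le_mono:
  assumes "degree_le N D p" "D \<le> E"
  shows "degree_le N E p"
proof -
  obtain c where "\<And>x. p x = (\<Sum>k\<in>exponents N D. c k * monomial N k x)"
    using assms(1) unfolding degree_le_def by blast
  then show ?thesis
    by (intro degree_leI[where I = "exponents N D" and e = id and c = c])
      (use assms(2) exponents_finite_card in \<open>auto simp: exponents_def\<close>)
qed

lemma degree_le_add:
  assumes "degree_le N D p" "degree_le N D q"
  shows "degree_le N D (\<lambda>x. p x + q x)"
proof -
  obtain c d where "\<And>x. p x = (\<Sum>k\<in>exponents N D. c k * monomial N k x)"
    "\<And>x. q x = (\<Sum>k\<in>exponents N D. d k * monomial N k x)"
    using assms unfolding degree_le_def by blast
  then show ?thesis
    unfolding degree_le_def
    by (intro exI[of _ "\<lambda>k. c k + d k"]) (simp add: sum.distrib distrib_right)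
qed

lemma degree_le_mult:
  assumes "degree_le N D p" "degree_le N E q"
  shows "degree_le N (D + E) (\<lambda>x. p x * q x)"
proof -
  obtain c d where c: "\<And>x. p x = (\<Sum>k\<in>exponents N D. c k * monomial N k x)"
    and d: "\<And>x. q x = (\<Sum>k\<in>exponents N E. d k * monomial N k x)"
    using assms unfolding degree_le_def by blast
  show ?thesis
  proof (rule degree_leI[where I = "exponents N D \<times> exponents N E" and e = "\<lambda>(k, l) i. k i + l i"
        and c = "\<lambda>(k, l). c k * d l"])
    show "finite (exponents N D \<times> exponents N E)" using exponents_finite_card by blast
    show "(case p of (k, l) \<Rightarrow> \<lambda>i. k i + l i) \<in> exponents N (D + E)"
      if "p \<in> exponents N D \<times> exponents N E" for p
      using that by (auto simp: exponents_def multi_index_closed intro!: add_mono)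
    show "p x * q x = (\<Sum>i\<in>exponents N D \<times> exponents N E.
          (case i of (k, l) \<Rightarrow> c k * d l) * monomial N (case i of (k, l) \<Rightarrow> \<lambda>i. k i + l i) x)" for x
      unfolding c d sum_product sum.cartesian_product
      by (rule sum.cong[OF refl]) (auto simp: monomial_plus)
  qed
qed

lemma degree_le_power: "degree_le N D p \<Longrightarrow> degree_le N (k * D) (\<lambda>x. p x ^ k)"
  by (induction k) (auto intro: degree_le_const degree_le_mult)

lemma degree_le_prod:
  assumes "finite J" "\<And>j. j \<in> J \<Longrightarrow> degree_le N D (p j)"
  shows "degree_le N (card J * D) (\<lambda>x. \<Prod>j\<in>J. p j x)"
  using assms by (induction J) (auto intro: degree_le_const degree_le_mult)

lemma polyfun_degree_le:
  assumes "polyfun {..<N} p"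
  shows "\<exists>D. degree_le N D p"
  using assms
proof (induction rule: polyfun.induct)
  case (add p q)
  then obtain D E where "degree_le N D p" "degree_le N E q" by blast
  then have "degree_le N (max D E) (\<lambda>x. p x + q x)"
    by (intro degree_le_add) (auto intro: degree_le_mono)
  then show ?case by blast
qed (auto intro: degree_le_const degree_le_coord degree_le_mult)

lemma polyfun_imp_polynomial_on_rspace:
  assumes "polyfun {..<N} p"
  shows "polynomial_on_rspace N p"
proof -
  obtain D c where c: "\<And>x. p x = (\<Sum>k\<in>exponents N D. c k * monomial N k x)"
    using polyfun_degree_le[OF assms] unfolding degree_le_def by blast
  show ?thesis
    unfolding polynomial_on_rspace_def
    by (rule exI[of _ "exponents N D"], rule exI[of _ c])
      (use c exponents_finite_card in \<open>auto simp: exponents_def\<close>)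
qed

lemma polynomial_on_rspace_imp_polyfun:
  assumes "polynomial_on_rspace N p"
  shows "\<exists>p'. polyfun {..<N} p' \<and> (\<forall>x\<in>rspace N. p x = p' x)"
proof -
  obtain M c where "\<forall>x\<in>rspace N. p x = (\<Sum>k\<in>M. c k * monomial N k x)"
    using assms unfolding polynomial_on_rspace_def by blast
  moreover have "polyfun {..<N} (\<lambda>x. \<Sum>k\<in>M. c k * monomial N k x)"
    unfolding monomial_def
    by (intro polyfun_sum polyfun.mult polyfun.const polyfun_prod polyfun_power polyfun.coord) auto
  ultimately show ?thesis by (intro exI conjI) auto
qed

text \<open>
  \<open>C\<close> bounds the sum of the absolute values of the coefficients weighted by powers of \<open>B\<close>, hence the
  values on the cube of radius \<open>B\<close> and on every Banach algebra.
\<close>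
inductive bounded_poly :: "nat \<Rightarrow> real \<Rightarrow> nat \<Rightarrow> real \<Rightarrow> (rvec \<Rightarrow> real) \<Rightarrow> bool" for N B where
  const: "\<bar>a\<bar> \<le> C \<Longrightarrow> bounded_poly N B D C (\<lambda>_. a)"
| coord_mult: "i < N \<Longrightarrow> bounded_poly N B D C q \<Longrightarrow> bounded_poly N B (Suc D) (B * C) (\<lambda>x. x i * q x)"
| add: "bounded_poly N B D C p \<Longrightarrow> bounded_poly N B D E q \<Longrightarrow> bounded_poly N B D (C + E) (\<lambda>x. p x + q x)"

lemma bounded_poly_nonneg: "bounded_poly N B D C q \<Longrightarrow> B \<ge> 1 \<Longrightarrow> C \<ge> 0"
  by (induction rule: bounded_poly.induct) auto

lemma bounded_poly_mono:
  assumes "bounded_poly N B D C q" "B \<ge> 1" "D \<le> D'" "C \<le> C'"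
  shows "bounded_poly N B D' C' q"
  using assms
proof (induction arbitrary: D' C' rule: bounded_poly.induct)
  case (coord_mult i D C q)
  then obtain E where E: "D' = Suc E" "D \<le> E" by (cases D') auto
  have "bounded_poly N B E (C' / B) q"
    using coord_mult.prems E by (intro coord_mult.IH) (auto simp: field_simps)
  from bounded_poly.coord_mult[OF coord_mult.hyps(1) this] show ?case using E coord_mult.prems by simp
next
  case (add D C p E q)
  have "bounded_poly N B D' (C + (C' - C)) (\<lambda>x. p x + q x)"
    by (intro bounded_poly.add add.IH) (use add.prems in auto)
  then show ?case by simp
qed (auto intro: bounded_poly.const)

lemma bounded_poly_cmult:
  "bounded_poly N B D C q \<Longrightarrow> bounded_poly N B D (\<bar>a\<bar> * C) (\<lambda>x. a * q x)"
proof (induction rule: bounded_poly.induct)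
  case (const b C D)
  then show ?case by (auto intro!: bounded_poly.const mult_left_mono simp: abs_mult)
next
  case (coord_mult i D C q)
  from bounded_poly.coord_mult[OF coord_mult.hyps(1) coord_mult.IH] show ?case
    by (simp add: mult.left_commute)
next
  case (add D C p E q)
  from bounded_poly.add[OF add.IH] show ?case by (simp add: distrib_left)
qed

lemma bounded_poly_mult:
  assumes "bounded_poly N B D C p" "bounded_poly N B E F q" "B \<ge> 1"
  shows "bounded_poly N B (D + E) (C * F) (\<lambda>x. p x * q x)"
  using assms
proof (induction rule: bounded_poly.induct)
  case (const a C D)
  have "\<bar>a\<bar> * F \<le> C * F"
    using const bounded_poly_nonneg[OF const.prems] by (intro mult_right_mono) auto
  then show ?case
    by (intro bounded_poly_mono[OF bounded_poly_cmult[OF const.prems(1)] const.prems(2)]) auto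
next
  case (coord_mult i D C p)
  from bounded_poly.coord_mult[OF coord_mult.hyps(1) coord_mult.IH[OF coord_mult.prems]] show ?case
    by (simp add: mult.assoc)
next
  case (add D C p E' p')
  from bounded_poly.add[OF add.IH(1)[OF add.prems] add.IH(2)[OF add.prems]] show ?case
    by (simp add: distrib_right)
qed

lemma bounded_poly_coord:
  assumes "i < N"
  shows "bounded_poly N B 1 B (\<lambda>x. x i)"
  using bounded_poly.coord_mult[OF assms bounded_poly.const[of 1 1 N B 0]] by simp

lemma polyfun_bounded_poly:
  assumes "polyfun {..<N} p" "B \<ge> 1"
  shows "\<exists>D C. bounded_poly N B D C p"
  using assms
proof (induction rule: polyfun.induct)
  case (add p q)
  then obtain D C E F where *: "bounded_poly N B D C p" "bounded_poly N B E F q" by blast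
  have "bounded_poly N B (max D E) (C + F) (\<lambda>x. p x + q x)"
    by (intro bounded_poly.add bounded_poly_mono[OF *(1)] bounded_poly_mono[OF *(2)]) (use assms in auto)
  then show ?case by blast
next
  case (mult p q)
  then obtain D C E F where "bounded_poly N B D C p" "bounded_poly N B E F q" by blast
  from bounded_poly_mult[OF this assms(2)] show ?case by blast
qed (auto intro: bounded_poly.const bounded_poly_coord)

lemma bounded_poly_polyfun:
  "bounded_poly N B D C p \<Longrightarrow> polyfun {..<N} p"
  by (induction rule: bounded_poly.induct) (auto intro: polyfun.intros)

lemma bounded_poly_bound:
  assumes "bounded_poly N B D C q" "\<And>i. i < N \<Longrightarrow> \<bar>x i\<bar> \<le> B"
  shows "\<bar>q x\<bar> \<le> C"
  using assms
proof (induction rule: bounded_poly.induct)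
  case (coord_mult i D C q)
  then have "\<bar>x i\<bar> \<le> B" "\<bar>q x\<bar> \<le> C" by auto
  then show ?case unfolding abs_mult by (intro mult_mono) auto
next
  case (add D C p E q)
  then show ?case by (meson abs_triangle_ineq add_mono order_trans)
qed auto

text \<open>This is why \<open>C\<close> measures coefficients: a bound on real values alone would
  not control the norm after substituting germs.\<close>

lemma bounded_poly_germ:
  assumes "bounded_poly N B D C q" "r > 0" "\<And>i. i < N \<Longrightarrow> analytic_germ n r B (w i)"
  shows "analytic_germ n r C (\<lambda>s. q (\<lambda>i. w i s))"
  using assms
  by (induction rule: bounded_poly.induct)
    (auto intro: analytic_germ_const analytic_germ_add analytic_germ_mult)

text \<open>The derivative of \<open>q\<close> along the field \<open>f\<close>, characterized by
  the chain rule it satisfies on curves instead of by partial derivatives. The set \<open>S\<close>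
  admits one-sided derivatives.\<close>

definition lie_derivative :: "nat \<Rightarrow> (nat \<Rightarrow> rvec \<Rightarrow> real) \<Rightarrow> (rvec \<Rightarrow> real) \<Rightarrow> (rvec \<Rightarrow> real) \<Rightarrow> bool" where
  "lie_derivative N f q q' \<longleftrightarrow> (\<forall>\<gamma> t S.
     (\<forall>i<N. ((\<lambda>\<tau>. \<gamma> \<tau> i) has_real_derivative f i (\<gamma> t)) (at t within S)) \<longrightarrow>
     ((\<lambda>\<tau>. q (\<gamma> \<tau>)) has_real_derivative q' (\<gamma> t)) (at t within S))"

text \<open>The product rule differentiates each of at most \<open>D\<close> factors of a monomial,
  replacing a coordinate of weight \<open>B\<close> by a field component of weight \<open>M\<close>.
  As \<open>B \<ge> 1\<close>, dropping that factor \<open>B\<close> cannot increase the weight,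
  hence the bound \<open>D * M * C\<close>.\<close>

lemma bounded_poly_lie_derivative:
  assumes "bounded_poly N B D C q" "B \<ge> 1" "M \<ge> 0" "\<And>i. i < N \<Longrightarrow> bounded_poly N B d M (f i)"
  shows "\<exists>q'. bounded_poly N B (D + d) (real D * M * C) q' \<and> lie_derivative N f q q'"
  using assms
proof (induction rule: bounded_poly.induct)
  case (const a C D)
  have "bounded_poly N B (D + d) (real D * M * C) (\<lambda>_. 0)"
    using const by (intro bounded_poly.const) auto
  then show ?case by (auto simp: lie_derivative_def intro!: exI[of _ "\<lambda>_. 0"])
next
  case (coord_mult i D C q)
  then obtain q' where q': "bounded_poly N B (D + d) (real D * M * C) q'" "lie_derivative N f q q'"
    by blast
  have C: "C \<ge> 0" using bounded_poly_nonneg[OF coord_mult.hyps(2)] coord_mult.prems by simp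
  have "1 * (M * C) \<le> B * (M * C)" using coord_mult.prems C by (intro mult_right_mono) auto
  then have le: "M * C + B * (real D * M * C) \<le> real (Suc D) * M * (B * C)"
    by (simp add: algebra_simps)
  have "bounded_poly N B (Suc D + d) (M * C) (\<lambda>x. f i x * q x)"
    by (rule bounded_poly_mono[OF bounded_poly_mult[OF coord_mult.prems(3)[OF coord_mult.hyps(1)] coord_mult.hyps(2)]])
      (use coord_mult.prems in auto)
  from bounded_poly.add[OF this] bounded_poly.coord_mult[OF coord_mult.hyps(1) q'(1)]
  have "bounded_poly N B (Suc D + d) (M * C + B * (real D * M * C)) (\<lambda>x. f i x * q x + x i * q' x)"
    by simp
  then have "bounded_poly N B (Suc D + d) (real (Suc D) * M * (B * C)) (\<lambda>x. f i x * q x + x i * q' x)"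
    by (rule bounded_poly_mono) (use le coord_mult.prems in auto)
  moreover have "lie_derivative N f (\<lambda>x. x i * q x) (\<lambda>x. f i x * q x + x i * q' x)"
    unfolding lie_derivative_def
  proof (intro allI impI)
    fix \<gamma> t S assume *: "\<forall>i<N. ((\<lambda>\<tau>. \<gamma> \<tau> i) has_real_derivative f i (\<gamma> t)) (at t within S)"
    have "((\<lambda>\<tau>. \<gamma> \<tau> i) has_real_derivative f i (\<gamma> t)) (at t within S)"
      using * coord_mult.hyps(1) by blast
    moreover have "((\<lambda>\<tau>. q (\<gamma> \<tau>)) has_real_derivative q' (\<gamma> t)) (at t within S)"
      using * q'(2) unfolding lie_derivative_def by blast
    ultimately show "((\<lambda>\<tau>. \<gamma> \<tau> i * q (\<gamma> \<tau>)) has_real_derivative f i (\<gamma> t) * q (\<gamma> t) + \<gamma> t i * q' (\<gamma> t)) (at t within S)"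
      by (auto intro!: derivative_eq_intros)
  qed
  ultimately show ?case by blast
next
  case (add D C p E q)
  then obtain p' q' where *: "bounded_poly N B (D + d) (real D * M * C) p'" "lie_derivative N f p p'"
    "bounded_poly N B (D + d) (real D * M * E) q'" "lie_derivative N f q q'" by blast
  have "bounded_poly N B (D + d) (real D * M * (C + E)) (\<lambda>x. p' x + q' x)"
    using bounded_poly.add[OF *(1,3)] by (simp add: distrib_left)
  moreover have "lie_derivative N f (\<lambda>x. p x + q x) (\<lambda>x. p' x + q' x)"
    using *(2,4) unfolding lie_derivative_def by (auto intro!: DERIV_add)
  ultimately show ?case by blast
qed

lemma polyfun_common_bound:
  assumes "\<And>i. i < N \<Longrightarrow> polyfun {..<N} (f i)" "B \<ge> 1"
  shows "\<exists>d M. M \<ge> 0 \<and> (\<forall>i<N. bounded_poly N B d M (f i))"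
proof -
  have "\<forall>i\<in>{..<N}. \<exists>d M. bounded_poly N B d M (f i)" using polyfun_bounded_poly assms by blast
  then obtain d M where dM: "\<And>i. i < N \<Longrightarrow> bounded_poly N B (d i) (M i) (f i)"
    by (metis lessThan_iff)
  have M0: "M i \<ge> 0" if "i < N" for i using bounded_poly_nonneg[OF dM[OF that] assms(2)] .
  have "bounded_poly N B (\<Sum>i<N. d i) (\<Sum>i<N. M i) (f i)" if "i < N" for i
    using that M0 by (intro bounded_poly_mono[OF dM[OF that] assms(2)] member_le_sum) auto
  moreover have "(\<Sum>i<N. M i) \<ge> 0" using M0 by (intro sum_nonneg) auto
  ultimately show ?thesis by blast
qed

lemma polyfun_lie_derivative:
  assumes "\<And>i. i < N \<Longrightarrow> polyfun {..<N} (f i)" "polyfun {..<N} q"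
  shows "\<exists>q'. polyfun {..<N} q' \<and> lie_derivative N f q q'"
proof -
  obtain d M where dM: "M \<ge> 0" "\<forall>i<N. bounded_poly N 1 d M (f i)"
    using polyfun_common_bound[of N f 1] assms(1) by auto
  obtain D C where q: "bounded_poly N 1 D C q" using polyfun_bounded_poly[OF assms(2), of 1] by auto
  show ?thesis using bounded_poly_lie_derivative[OF q _ dM(1)] dM(2) bounded_poly_polyfun by (metis order_refl)
qed

text \<open>The \<open>k\<close>-th Lie derivative of a coordinate has degree at most
  \<open>1 + k * d\<close>, so the next one costs a factor
  \<open>(1 + k * d) * M \<le> (k + 1) * L\<close> with \<open>L = (d + 1) * (M + 1)\<close>. The
  factors multiply to \<open>L ^ k * fact k\<close>, and the factorial cancels in the Taylor
  coefficient.\<close>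

lemma polyfun_lie_series:
  assumes f: "\<And>i. i < N \<Longrightarrow> polyfun {..<N} (f i)" and B: "B \<ge> 1"
  shows "\<exists>L>0. \<forall>j<N. \<exists>Q. Q 0 = (\<lambda>x. x j) \<and>
    (\<forall>k. (\<exists>D. bounded_poly N B D (B * L ^ k * fact k) (Q k)) \<and> lie_derivative N f (Q k) (Q (Suc k)))"
proof -
  obtain d M where dM: "M \<ge> 0" "\<forall>i<N. bounded_poly N B d M (f i)"
    using polyfun_common_bound[of N f B] f B by auto
  define L where "L = (real d + 1) * (M + 1)"
  have L: "L > 0" using dM unfolding L_def by simp
  show ?thesis
  proof (intro exI[of _ L] conjI L allI impI)
    fix j assume j: "j < N"
    define P where "P k q \<longleftrightarrow> bounded_poly N B (1 + k * d) (B * L ^ k * fact k) q \<and> (k = 0 \<longrightarrow> q = (\<lambda>x. x j))" for k q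
    have "\<exists>Q. \<forall>k. P k (Q k) \<and> lie_derivative N f (Q k) (Q (Suc k))"
    proof (rule dependent_nat_choice)
      show "\<exists>q. P 0 q" unfolding P_def using bounded_poly_coord[OF j, of B] by auto
      fix q k assume "P k q"
      then have q: "bounded_poly N B (1 + k * d) (B * L ^ k * fact k) q" unfolding P_def by blast
      then obtain q' where q': "bounded_poly N B (1 + k * d + d) (real (1 + k * d) * M * (B * L ^ k * fact k)) q'"
        "lie_derivative N f q q'"
        using bounded_poly_lie_derivative[OF q B dM(1)] dM(2) by blast
      have nn: "B * L ^ k * fact k \<ge> 0" using B L by simp
      have "real (1 + k * d) * M \<le> (real (Suc k) * (real d + 1)) * (M + 1)"
        using dM(1) by (intro mult_mono) (auto simp: algebra_simps)
      also have "\<dots> = real (Suc k) * L" unfolding L_def by simp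
      finally have "real (1 + k * d) * M * (B * L ^ k * fact k) \<le> real (Suc k) * L * (B * L ^ k * fact k)"
        using nn by (rule mult_right_mono)
      also have "\<dots> = B * L ^ Suc k * fact (Suc k)" by (simp add: algebra_simps)
      finally have "P (Suc k) q'"
        unfolding P_def by (intro conjI bounded_poly_mono[OF q'(1) B]) auto
      then show "\<exists>q'. P (Suc k) q' \<and> lie_derivative N f q q'" using q'(2) by blast
    qed
    then obtain Q where Q: "\<And>k. P k (Q k)" "\<And>k. lie_derivative N f (Q k) (Q (Suc k))" by blast
    then show "\<exists>Q. Q 0 = (\<lambda>x. x j) \<and>
      (\<forall>k. (\<exists>D. bounded_poly N B D (B * L ^ k * fact k) (Q k)) \<and> lie_derivative N f (Q k) (Q (Suc k)))"
      unfolding P_def by blast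
  qed
qed

lemma polyfun_germ:
  fixes N :: nat
  assumes q: "polyfun {..<N} q" and W: "\<And>j. j < N \<Longrightarrow> \<exists>r>0. \<exists>B. analytic_germ n r B (W j)"
  shows "\<exists>r0>0. \<forall>r>0. r \<le> r0 \<longrightarrow> (\<exists>C. analytic_germ n r C (\<lambda>s. q (\<lambda>j. W j s)))"
proof -
  obtain r0 where r0: "r0 > 0" "\<And>r. r > 0 \<Longrightarrow> r \<le> r0 \<Longrightarrow> \<forall>i<N. analytic_germ n r (\<bar>W i (\<lambda>_. 0)\<bar> + 1) (W i)"
    using analytic_germs_shrink[of N n W 1, OF W] by auto
  define B where "B = (\<Sum>i<N. \<bar>W i (\<lambda>_. 0)\<bar>) + 1"
  have B: "B \<ge> 1" unfolding B_def by (simp add: sum_nonneg)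
  obtain D C where DC: "bounded_poly N B D C q" using polyfun_bounded_poly[OF q B] by blast
  show ?thesis
  proof (rule exI[of _ r0], rule conjI[OF r0(1)], intro allI impI exI)
    fix r :: real assume r: "r > 0" "r \<le> r0"
    show "analytic_germ n r C (\<lambda>s. q (\<lambda>j. W j s))"
    proof (rule bounded_poly_germ[OF DC r(1)])
      fix i assume i: "i < N"
      have "\<bar>W i (\<lambda>_. 0)\<bar> + 1 \<le> B"
        using member_le_sum[of i "{..<N}" "\<lambda>i. \<bar>W i (\<lambda>_. 0)\<bar>"] i unfolding B_def by auto
      then show "analytic_germ n r B (W i)" using r0(2)[OF r] i analytic_germ_mono by blast
    qed
  qed
qed

section \<open>Flows of polynomial vector fields\<close>

definition integral_curve :: "nat \<Rightarrow> (nat \<Rightarrow> rvec \<Rightarrow> real) \<Rightarrow> real \<Rightarrow> (real \<Rightarrow> rvec) \<Rightarrow> bool" where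
  "integral_curve N f h \<gamma> \<longleftrightarrow>
     (\<forall>i<N. \<forall>t\<in>{0..h}. ((\<lambda>\<tau>. \<gamma> \<tau> i) has_real_derivative f i (\<gamma> t)) (at t within {0..h}))"

lemma integral_curve_shift:
  assumes "integral_curve N f h \<gamma>" "0 \<le> a" "a + b \<le> h"
  shows "integral_curve N f b (\<lambda>t. \<gamma> (a + t))"
  unfolding integral_curve_def
proof (intro allI impI ballI)
  fix i t assume i: "i < N" and t: "t \<in> {0..b}"
  have "((\<lambda>\<tau>. \<gamma> \<tau> i) has_real_derivative f i (\<gamma> (a + t))) (at (a + t) within {0..h})"
    using assms i t unfolding integral_curve_def by auto
  then have "((\<lambda>\<tau>. \<gamma> \<tau> i) has_real_derivative f i (\<gamma> (a + t))) (at (a + t) within {a..a + b})"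
    by (rule DERIV_subset) (use assms in auto)
  from has_real_derivative_shift[OF this]
  show "((\<lambda>\<tau>. \<gamma> (a + \<tau>) i) has_real_derivative f i (\<gamma> (a + t))) (at t within {0..b})" by simp
qed

lemma integral_curve_continuous:
  "integral_curve N f h \<gamma> \<Longrightarrow> i < N \<Longrightarrow> continuous_on {0..h} (\<lambda>t. \<gamma> t i)"
  unfolding integral_curve_def by (intro DERIV_continuous_on[where D = "\<lambda>t. f i (\<gamma> t)"]) auto

text \<open>Until some coordinate first reaches \<open>2 * B\<close>, all speeds are at most
  \<open>M\<close>, so by the mean value theorem no coordinate moves by \<open>B\<close> within time
  \<open>h\<close>.\<close>

lemma integral_curve_bound:
  assumes \<gamma>: "integral_curve N f h \<gamma>" and hM: "h * M < B"
    and M: "\<And>i x. i < N \<Longrightarrow> (\<And>j. j < N \<Longrightarrow> \<bar>x j\<bar> \<le> 2 * B) \<Longrightarrow> \<bar>f i x\<bar> \<le> M"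
    and start: "\<And>i. i < N \<Longrightarrow> \<bar>\<gamma> 0 i\<bar> \<le> B"
    and t: "t \<in> {0..h}" "i < N"
  shows "\<bar>\<gamma> t i\<bar> \<le> 2 * B"
proof (rule ccontr)
  assume contr: "\<not> \<bar>\<gamma> t i\<bar> \<le> 2 * B"
  define A where "A = (\<Union>j<N. {s \<in> {0..h}. 2 * B \<le> \<bar>\<gamma> s j\<bar>})"
  have "closed A"
    unfolding A_def
    by (intro closed_UN continuous_closed_preimage_constant finite_lessThan ballI
        continuous_on_closed_Collect_le[OF continuous_on_const] continuous_on_rabs
        integral_curve_continuous[OF \<gamma>]) auto
  moreover have "t \<in> A" using contr t unfolding A_def by (intro UN_I[of i]) auto
  moreover have bdd: "bdd_below A" unfolding A_def by (auto intro: bdd_belowI[of _ 0])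
  ultimately have inf: "Inf A \<in> A" using closed_contains_Inf by blast
  \<comment> \<open>The first exit time; the infimum is attained because \<open>A\<close> is
    closed.\<close>
  define t0 where "t0 = Inf A"
  obtain j where j: "j < N" "t0 \<in> {0..h}" "2 * B \<le> \<bar>\<gamma> t0 j\<bar>"
    using inf unfolding t0_def A_def by auto
  have B: "B \<ge> 0" using start[OF t(2)] by linarith
  have M0: "M \<ge> 0" using M[OF t(2), of "\<lambda>_. 0"] B by auto
  have "h * M \<ge> 0" using t M0 by simp
  then have B0: "B > 0" using hM by linarith
  have before: "\<bar>\<gamma> s k\<bar> < 2 * B" if "0 \<le> s" "s < t0" "k < N" for s k
  proof (rule ccontr)
    assume "\<not> \<bar>\<gamma> s k\<bar> < 2 * B"
    then have "s \<in> A" using that j(2) unfolding A_def by (intro UN_I[of k]) auto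
    then have "t0 \<le> s" unfolding t0_def by (rule cInf_lower[OF _ bdd])
    then show False using that by simp
  qed
  have t0: "t0 > 0" using j start[OF j(1)] B0 by (cases "t0 = 0") auto
  have der: "((\<lambda>\<tau>. \<gamma> \<tau> j) has_derivative (\<lambda>x. f j (\<gamma> s) * x)) (at s)" if "0 < s" "s < t0" for s
  proof -
    have "((\<lambda>\<tau>. \<gamma> \<tau> j) has_real_derivative f j (\<gamma> s)) (at s within {0..h})"
      using \<gamma> j that unfolding integral_curve_def by auto
    moreover have "at s within {0..h} = at s"
      using that j by (intro at_within_interior) auto
    ultimately show ?thesis by (simp add: has_field_derivative_def mult_commute_abs)
  qed
  have "continuous_on {0..t0} (\<lambda>\<tau>. \<gamma> \<tau> j)"
    using integral_curve_continuous[OF \<gamma> j(1)] by (rule continuous_on_subset) (use j in auto)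
  from mvt[OF t0 this der] obtain s where s: "0 < s" "s < t0" "\<gamma> t0 j - \<gamma> 0 j = f j (\<gamma> s) * (t0 - 0)"
    by auto
  have "\<bar>f j (\<gamma> s)\<bar> \<le> M" using before[of s] s by (intro M j(1)) (auto intro: less_imp_le)
  then have "\<bar>\<gamma> t0 j - \<gamma> 0 j\<bar> \<le> M * h"
    unfolding s(3) abs_mult using t0 j(2) M0 by (intro mult_mono) auto
  then show False using start[OF j(1)] hM j(3) by (simp add: mult.commute)
qed

text \<open>Along the curve, \<open>Q k\<close> is the \<open>k\<close>-th time derivative of
  coordinate \<open>j\<close>, so this is Taylor's formula. The growth bound on \<open>Q k\<close>
  makes the remainder tend to 0 once \<open>h * L \<le> 1 / 2\<close>.\<close>

lemma integral_curve_series: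
  assumes \<gamma>: "integral_curve N f h \<gamma>" and h: "0 \<le> h" "h * L \<le> 1 / 2" and L: "L > 0"
    and Q: "Q 0 = (\<lambda>x. x j)" "\<And>k. bounded_poly N B (D k) (B * L ^ k * fact k) (Q k)"
      "\<And>k. lie_derivative N f (Q k) (Q (Suc k))"
    and B: "\<And>t i. t \<in> {0..h} \<Longrightarrow> i < N \<Longrightarrow> \<bar>\<gamma> t i\<bar> \<le> B" "B \<ge> 1"
  shows "(\<lambda>k. Q k (\<gamma> 0) * h ^ k / fact k) sums \<gamma> h j"
proof -
  have err: "\<bar>\<gamma> h j - (\<Sum>k\<le>n. Q k (\<gamma> 0) * h ^ k / fact k)\<bar> \<le> B * (real (Suc n) * (1 / 2) ^ Suc n)" for n
  proof -
    \<comment> \<open>\<open>field_Taylor\<close> divides the remainder by \<open>fact n\<close>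
      instead of \<open>fact (Suc n)\<close>; this leaves a factor \<open>Suc n\<close>, which the
      geometric decay absorbs.\<close>
    have "norm (Q 0 (\<gamma> h) - (\<Sum>k\<le>n. Q k (\<gamma> 0) * (h - 0) ^ k / fact k))
        \<le> (B * L ^ Suc n * fact (Suc n)) * norm (h - 0) ^ Suc n / fact n"
    proof (rule field_Taylor[where S = "{0..h}" and f = "\<lambda>k t. Q k (\<gamma> t)"])
      show "((\<lambda>t. Q k (\<gamma> t)) has_real_derivative Q (Suc k) (\<gamma> t)) (at t within {0..h})"
        if "t \<in> {0..h}" for k t
        using Q(3) \<gamma> that unfolding lie_derivative_def integral_curve_def by blast
      show "norm (Q (Suc n) (\<gamma> t)) \<le> B * L ^ Suc n * fact (Suc n)" if "t \<in> {0..h}" for t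
        unfolding real_norm_def by (rule bounded_poly_bound[OF Q(2)]) (use B(1)[OF that] in auto)
    qed (use h in auto)
    also have "\<dots> = B * (real (Suc n) * (h * L) ^ Suc n)"
      using h by (simp add: power_mult_distrib field_simps)
    also have "\<dots> \<le> B * (real (Suc n) * (1 / 2) ^ Suc n)"
      using h L B(2) by (intro mult_left_mono power_mono) auto
    finally show ?thesis by (simp add: Q(1))
  qed
  have "(\<lambda>n. B * (real (Suc n) * (1 / 2) ^ Suc n)) \<longlonglongrightarrow> B * 0"
    by (intro tendsto_mult_left LIMSEQ_Suc[OF powser_times_n_limit_0]) auto
  then have lim: "(\<lambda>n. B * (real (Suc n) * (1 / 2) ^ Suc n)) \<longlonglongrightarrow> 0" by simp
  have "(\<lambda>n. \<gamma> h j - (\<Sum>k\<le>n. Q k (\<gamma> 0) * h ^ k / fact k)) \<longlonglongrightarrow> 0"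
    by (rule Lim_null_comparison[OF _ lim]) (use err in \<open>auto intro!: always_eventually\<close>)
  from tendsto_diff[OF tendsto_const[of "\<gamma> h j"] this]
  have "(\<lambda>n. \<Sum>k\<le>n. Q k (\<gamma> 0) * h ^ k / fact k) \<longlonglongrightarrow> \<gamma> h j" by simp
  then show ?thesis unfolding sums_def_le .
qed

text \<open>
  For short times the Lie series expresses the flow by a power series in the time whose coefficients
  are polynomials in the initial state; germs may be substituted for both.
\<close>
lemma flow_step:
  assumes f: "\<And>i. i < N \<Longrightarrow> polyfun {..<N} (f i)" and B: "B \<ge> 1"
  shows "\<exists>\<epsilon>>0. \<exists>K. \<forall>n r w \<tau>. r > 0 \<longrightarrow> (\<forall>i<N. analytic_germ n r B (w i)) \<longrightarrow> analytic_germ n r \<epsilon> \<tau> \<longrightarrow>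
    (\<exists>W. (\<forall>j<N. analytic_germ n r K (W j)) \<and>
      (\<forall>s \<gamma>. (\<forall>i<n. \<bar>s i\<bar> \<le> r) \<longrightarrow> 0 \<le> \<tau> s \<longrightarrow> integral_curve N f (\<tau> s) \<gamma> \<longrightarrow>
         (\<forall>i<N. \<gamma> 0 i = w i s) \<longrightarrow> (\<forall>j<N. \<gamma> (\<tau> s) j = W j s)))"
proof -
  \<comment> \<open>Initial values are bounded by \<open>B\<close>; the doubled bound gives the
    curve room to move.\<close>
  define B2 where "B2 = 2 * B"
  have B2: "B2 \<ge> 1" "B \<le> B2" using B unfolding B2_def by auto
  obtain L where L: "L > 0" and "\<forall>j<N. \<exists>Q. Q 0 = (\<lambda>x. x j) \<and>
    (\<forall>k. (\<exists>D. bounded_poly N B2 D (B2 * L ^ k * fact k) (Q k)) \<and> lie_derivative N f (Q k) (Q (Suc k)))"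
    using polyfun_lie_series[of N f, OF f B2(1)] by blast
  then have "\<forall>j. \<exists>Q. j < N \<longrightarrow> Q 0 = (\<lambda>x. x j) \<and>
    (\<forall>k. (\<exists>D. bounded_poly N B2 D (B2 * L ^ k * fact k) (Q k)) \<and> lie_derivative N f (Q k) (Q (Suc k)))"
    by blast
  from choice[OF this] obtain Q where Q: "\<And>j. j < N \<Longrightarrow> Q j 0 = (\<lambda>x. x j)"
    "\<And>j k. j < N \<Longrightarrow> \<exists>D. bounded_poly N B2 D (B2 * L ^ k * fact k) (Q j k)"
    "\<And>j k. j < N \<Longrightarrow> lie_derivative N f (Q j k) (Q j (Suc k))"
    by blast
  obtain d M where M: "M \<ge> 0" "\<forall>i<N. bounded_poly N B2 d M (f i)"
    using polyfun_common_bound[of N f B2] f B2 by auto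
  \<comment> \<open>The first term bounds the ratio of the Lie series by one half, the second keeps
    the curve within \<open>2 * B\<close>. Only the field and \<open>B\<close> enter, so one step
    length serves for all germs of norm at most \<open>B\<close>.\<close>
  define \<epsilon> where "\<epsilon> = min (1 / (2 * L)) (B / (2 * (M + 1)))"
  have \<epsilon>: "\<epsilon> > 0" using L B M unfolding \<epsilon>_def by auto
  have \<epsilon>L: "h * L \<le> 1 / 2" if "h \<le> \<epsilon>" for h
  proof -
    have "h * L \<le> 1 / (2 * L) * L" using that L unfolding \<epsilon>_def by (intro mult_right_mono) auto
    then show ?thesis using L by simp
  qed
  have \<epsilon>M: "h * M < B" if "h \<le> \<epsilon>" for h
  proof -
    have "h * M \<le> B / (2 * (M + 1)) * M" using that M unfolding \<epsilon>_def by (intro mult_right_mono) auto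
    also have "\<dots> < B"
    proof -
      have "B * M + B * 2 > 0" using M B by (intro add_nonneg_pos) auto
      then show ?thesis using M by (simp add: field_simps)
    qed
    finally show ?thesis .
  qed
  have geo: "(\<lambda>k. B2 * (1 / 2) ^ k) sums (B2 * 2)"
    using sums_mult[OF geometric_sums[of "1 / 2 :: real"], of B2] by simp
  show ?thesis
  proof (rule exI[of _ \<epsilon>], rule conjI[OF \<epsilon>], rule exI[of _ "B2 * 2"], intro allI impI)
    fix n r w \<tau>
    assume r: "(r :: real) > 0" and w: "\<forall>i<N. analytic_germ n r B (w i)" and \<tau>: "analytic_germ n r \<epsilon> \<tau>"
    \<comment> \<open>The \<open>k\<close>-th term of the Lie series, with the germs
      \<open>w\<close> put in for the initial state and \<open>\<tau>\<close> for the time.\<close>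
    define T where "T j k s = Q j k (\<lambda>i. w i s) * \<tau> s ^ k / fact k" for j k s
    have T: "analytic_germ n r (B2 * (1 / 2) ^ k) (T j k)" if j: "j < N" for j k
    proof -
      obtain D where D: "bounded_poly N B2 D (B2 * L ^ k * fact k) (Q j k)" using Q(2)[OF j] by blast
      have "analytic_germ n r (B2 * L ^ k * fact k) (\<lambda>s. Q j k (\<lambda>i. w i s))"
        by (rule bounded_poly_germ[OF D r]) (use w B2(2) in \<open>auto intro: analytic_germ_mono\<close>)
      from analytic_germ_mult[OF r analytic_germ_mult[OF r this analytic_germ_power[OF r \<tau>, of k]]
          analytic_germ_const[OF r order_refl, of n "1 / fact k"]]
      have "analytic_germ n r (B2 * L ^ k * fact k * \<epsilon> ^ k * \<bar>1 / fact k\<bar>) (T j k)"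
        unfolding T_def by simp
      moreover have "B2 * L ^ k * fact k * \<epsilon> ^ k * \<bar>1 / fact k\<bar> = B2 * (\<epsilon> * L) ^ k"
        by (simp add: power_mult_distrib)
      moreover have "B2 * (\<epsilon> * L) ^ k \<le> B2 * (1 / 2) ^ k"
        using \<epsilon>L[OF order_refl] \<epsilon> L B2(1) by (intro mult_left_mono power_mono) auto
      ultimately show ?thesis using analytic_germ_mono by metis
    qed
    define W where "W j s = (\<Sum>k. T j k s)" for j s
    have sums: "(\<lambda>k. T j k s) sums W j s" if j: "j < N" and s: "\<And>i. i < n \<Longrightarrow> \<bar>s i\<bar> \<le> r" for j s
      unfolding W_def
    proof (rule summable_sums, rule summable_comparison_test'[of _ 0])
      show "summable (\<lambda>k. B2 * (1 / 2) ^ k)" using geo sums_summable by blast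
      show "norm (T j k s) \<le> B2 * (1 / 2) ^ k" for k
        using analytic_germ_bound[OF T[OF j] s] by simp
    qed
    show "\<exists>W. (\<forall>j<N. analytic_germ n r (B2 * 2) (W j)) \<and>
      (\<forall>s \<gamma>. (\<forall>i<n. \<bar>s i\<bar> \<le> r) \<longrightarrow> 0 \<le> \<tau> s \<longrightarrow> integral_curve N f (\<tau> s) \<gamma> \<longrightarrow>
         (\<forall>i<N. \<gamma> 0 i = w i s) \<longrightarrow> (\<forall>j<N. \<gamma> (\<tau> s) j = W j s))"
    proof (intro exI[of _ W] conjI allI impI)
      show "analytic_germ n r (B2 * 2) (W j)" if "j < N" for j
        by (rule analytic_germ_suminf[OF r T[OF that] geo sums[OF that]])
      fix s \<gamma> j
      assume s: "\<forall>i<n. \<bar>s i\<bar> \<le> r" and pos: "0 \<le> \<tau> s" and \<gamma>: "integral_curve N f (\<tau> s) \<gamma>"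
        and start: "\<forall>i<N. \<gamma> 0 i = w i s" and j: "j < N"
      have le: "\<tau> s \<le> \<epsilon>" using analytic_germ_bound[OF \<tau>, of s] s by auto
      obtain D where D: "\<And>k. bounded_poly N B2 (D k) (B2 * L ^ k * fact k) (Q j k)"
        using Q(2)[OF j] by metis
      have bd: "\<bar>\<gamma> t i\<bar> \<le> B2" if "t \<in> {0..\<tau> s}" "i < N" for t i
        unfolding B2_def
      proof (rule integral_curve_bound[OF \<gamma> \<epsilon>M[OF le] _ _ that])
        show "\<bar>f i x\<bar> \<le> M" if "i < N" "\<And>j. j < N \<Longrightarrow> \<bar>x j\<bar> \<le> 2 * B" for i x
          using bounded_poly_bound M(2) that unfolding B2_def by blast
        show "\<bar>\<gamma> 0 i\<bar> \<le> B" if "i < N" for i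
          using analytic_germ_bound[of n r B "w i" s] w s start that by auto
      qed
      have "(\<lambda>k. Q j k (\<gamma> 0) * \<tau> s ^ k / fact k) sums \<gamma> (\<tau> s) j"
        by (rule integral_curve_series[where Q = "Q j" and D = D and B = B2, OF \<gamma> pos \<epsilon>L[OF le] L Q(1)[OF j] D Q(3)[OF j] bd B2(1)])
      moreover have "Q j k (\<gamma> 0) = Q j k (\<lambda>i. w i s)" for k
        by (rule polyfun_cong[OF bounded_poly_polyfun[OF D]]) (use start in auto)
      ultimately have "(\<lambda>k. T j k s) sums \<gamma> (\<tau> s) j" unfolding T_def by simp
      then show "\<gamma> (\<tau> s) j = W j s" by (rule sums_unique2[OF _ sums[OF j]]) (use s in auto)
    qed
  qed
qed

text \<open>The reference curve at the centre is continuous on a compact interval, hence bounded.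
  The duration is cut into \<open>m\<close> equal steps covered by \<open>flow_step\<close>; the
  germs stay close to the reference curve after shrinking, so the same bound \<open>B\<close> holds
  at the start of every step.\<close>

lemma flow_germ:
  assumes "\<forall>i<N. polyfun {..<N} (f i)"
    and "\<forall>i<N. \<exists>r>0. \<exists>B. analytic_germ n r B (w i)"
    and \<tau>: "\<exists>r>0. \<exists>B. analytic_germ n r B \<tau>" and \<tau>0: "\<tau> (\<lambda>_. 0) \<ge> 0"
    and \<gamma>0: "integral_curve N f (\<tau> (\<lambda>_. 0)) \<gamma>0" "\<forall>i<N. \<gamma>0 0 i = w i (\<lambda>_. 0)"
  shows "\<exists>r>0. \<exists>W. (\<forall>j<N. \<exists>B. analytic_germ n r B (W j)) \<and>
    (\<forall>s \<gamma>. (\<forall>i<n. \<bar>s i\<bar> \<le> r) \<longrightarrow> 0 \<le> \<tau> s \<longrightarrow> integral_curve N f (\<tau> s) \<gamma> \<longrightarrow>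
       (\<forall>i<N. \<gamma> 0 i = w i s) \<longrightarrow> (\<forall>j<N. \<gamma> (\<tau> s) j = W j s))"
proof -
  let ?z = "\<lambda>_ :: nat. 0 :: real"
  note f = assms(1)[rule_format] and w = assms(2)[rule_format]
  have "\<exists>B0. \<forall>t\<in>{0..\<tau> ?z}. \<bar>\<gamma>0 t i\<bar> \<le> B0" if "i < N" for i
    using compact_imp_bounded[OF compact_continuous_image[OF integral_curve_continuous[OF \<gamma>0(1) that] compact_Icc]]
    by (auto simp: bounded_iff)
  then have "\<forall>i. \<exists>B0. i < N \<longrightarrow> (\<forall>t\<in>{0..\<tau> ?z}. \<bar>\<gamma>0 t i\<bar> \<le> B0)" by blast
  from choice[OF this] obtain B0 where B0: "\<And>i t. i < N \<Longrightarrow> t \<in> {0..\<tau> ?z} \<Longrightarrow> \<bar>\<gamma>0 t i\<bar> \<le> B0 i" by blast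
  \<comment> \<open>A bound for the whole reference curve, with 1 to spare for the difference
    between the norm of a shrunk germ and its central value.\<close>
  define B where "B = (\<Sum>i<N. \<bar>B0 i\<bar>) + 1"
  have B: "B \<ge> 1" unfolding B_def by (simp add: sum_nonneg)
  have \<gamma>B: "\<bar>\<gamma>0 t i\<bar> + 1 \<le> B" if "i < N" "t \<in> {0..\<tau> ?z}" for i t
    using B0[OF that] member_le_sum[of i "{..<N}" "\<lambda>i. \<bar>B0 i\<bar>"] that unfolding B_def by auto
  obtain \<epsilon> K where \<epsilon>: "\<epsilon> > 0" and step: "\<And>n r w \<tau>. r > 0 \<Longrightarrow> \<forall>i<N. analytic_germ n r B (w i) \<Longrightarrow> analytic_germ n r \<epsilon> \<tau> \<Longrightarrow>
    \<exists>W. (\<forall>j<N. analytic_germ n r K (W j)) \<and>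
      (\<forall>s \<gamma>. (\<forall>i<n. \<bar>s i\<bar> \<le> r) \<longrightarrow> 0 \<le> \<tau> s \<longrightarrow> integral_curve N f (\<tau> s) \<gamma> \<longrightarrow>
         (\<forall>i<N. \<gamma> 0 i = w i s) \<longrightarrow> (\<forall>j<N. \<gamma> (\<tau> s) j = W j s))"
    using flow_step[of N f, OF f B] by blast
  \<comment> \<open>Only half of the step length is used at the centre; the other half is left for
    the variation of \<open>\<tau>\<close> around it.\<close>
  obtain m :: nat where m: "m > 0" "\<tau> ?z / m \<le> \<epsilon> / 2"
  proof -
    obtain k :: nat where "\<tau> ?z / (\<epsilon> / 2) < k" using reals_Archimedean2 by blast
    then have "\<tau> ?z / Suc k \<le> \<epsilon> / 2" using \<epsilon> by (simp add: field_simps)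
    then show thesis using that[of "Suc k"] by simp
  qed
  have "\<exists>r>0. \<exists>W. (\<forall>j<N. \<exists>B. analytic_germ n r B (W j)) \<and>
    (\<forall>s \<gamma>. (\<forall>i<n. \<bar>s i\<bar> \<le> r) \<longrightarrow> 0 \<le> \<tau> s \<longrightarrow> integral_curve N f (\<tau> s) \<gamma> \<longrightarrow>
       (\<forall>i<N. \<gamma> 0 i = w i s) \<longrightarrow> (\<forall>j<N. \<gamma> (k * (\<tau> s / m)) j = W j s))" if "k \<le> m" for k :: nat
    using that
  proof (induction k)
    case 0
    obtain r0 where r0: "r0 > 0" "\<And>r. r > 0 \<Longrightarrow> r \<le> r0 \<Longrightarrow> \<forall>i<N. analytic_germ n r (\<bar>w i ?z\<bar> + 1) (w i)"
      using analytic_germs_shrink[of N n w 1, OF w] by auto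
    show ?case
    proof (rule exI[of _ r0], rule conjI[OF r0(1)], rule exI[of _ w], intro conjI allI impI)
      show "\<exists>B. analytic_germ n r0 B (w j)" if "j < N" for j
        using r0(2)[OF r0(1) order_refl] that by blast
    qed simp
  next
    case (Suc k)
    from Suc.IH[OF Suc_leD[OF Suc.prems]] obtain r W where r: "r > 0" and W: "\<forall>j<N. \<exists>B. analytic_germ n r B (W j)"
      and WE: "\<And>s \<gamma>. \<lbrakk>\<forall>i<n. \<bar>s i\<bar> \<le> r; 0 \<le> \<tau> s; integral_curve N f (\<tau> s) \<gamma>;
        \<forall>i<N. \<gamma> 0 i = w i s\<rbrakk> \<Longrightarrow> \<forall>j<N. \<gamma> (k * (\<tau> s / m)) j = W j s"
      by (elim exE conjE, intro that) (assumption, assumption, blast)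
    have inside: "real k * (x / m) + x / m \<le> x" "real k * (x / m) \<le> x" "0 \<le> real k * (x / m)" if "x \<ge> 0" for x
    proof -
      have "(real k + 1) * x \<le> real m * x" using Suc.prems that by (intro mult_right_mono) auto
      then show "real k * (x / m) + x / m \<le> x" using m by (simp add: field_simps)
      moreover have "0 \<le> x / m" using that by simp
      ultimately show "real k * (x / m) \<le> x" by linarith
    qed (use that in auto)
    obtain r1 where r1: "r1 > 0" "\<And>r. r > 0 \<Longrightarrow> r \<le> r1 \<Longrightarrow> \<forall>i<N. analytic_germ n r (\<bar>W i ?z\<bar> + 1) (W i)"
      using analytic_germs_shrink[of N n W 1] W r by (auto simp: Ball_def) blast
    obtain r2 B2 where r2: "r2 > 0" "analytic_germ n r2 B2 \<tau>" using \<tau> by blast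
    have \<tau>m: "analytic_germ n r2 (B2 * \<bar>1 / m\<bar>) (\<lambda>s. \<tau> s * (1 / m))"
      by (rule analytic_germ_mult[OF r2 analytic_germ_const[OF r2(1) order_refl]])
    obtain r3 where r3: "r3 > 0" "\<And>r. r > 0 \<Longrightarrow> r \<le> r3 \<Longrightarrow> analytic_germ n r (\<bar>\<tau> ?z * (1 / m)\<bar> + \<epsilon> / 2) (\<lambda>s. \<tau> s * (1 / m))"
      using analytic_germ_shrink[OF r2(1) \<tau>m, of "\<epsilon> / 2"] \<epsilon> by auto
    define r' where "r' = min r (min r1 r3)"
    have r': "r' > 0" "r' \<le> r" "r' \<le> r1" "r' \<le> r3" using r r1 r3 unfolding r'_def by auto
    \<comment> \<open>The induction hypothesis at the centre identifies the central values of
      \<open>W\<close> with a point of the reference curve, which brings their norms back below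
      \<open>B\<close>.\<close>
    have "\<forall>j<N. \<gamma>0 (k * (\<tau> ?z / m)) j = W j ?z"
      using r \<tau>0 \<gamma>0 by (intro WE) auto
    then have "\<forall>i<N. \<bar>W i ?z\<bar> + 1 \<le> B" using \<gamma>B inside[OF \<tau>0] by (metis atLeastAtMost_iff)
    then have 1: "\<forall>i<N. analytic_germ n r' B (W i)"
      using r1(2)[OF r'(1,3)] analytic_germ_mono by blast
    have 2: "analytic_germ n r' \<epsilon> (\<lambda>s. \<tau> s / m)"
      using analytic_germ_mono[OF r3(2)[OF r'(1,4)], of \<epsilon>] m(2) \<tau>0 by simp
    from step[OF r'(1) 1 2] obtain V where V: "\<forall>j<N. analytic_germ n r' K (V j)"
      and VE: "\<And>s \<gamma>. \<lbrakk>\<forall>i<n. \<bar>s i\<bar> \<le> r'; 0 \<le> \<tau> s / m; integral_curve N f (\<tau> s / m) \<gamma>;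
         \<forall>i<N. \<gamma> 0 i = W i s\<rbrakk> \<Longrightarrow> \<forall>j<N. \<gamma> (\<tau> s / m) j = V j s" by blast
    show ?case
    proof (rule exI[of _ r'], rule conjI[OF r'(1)], rule exI[of _ V], intro conjI allI impI)
      show "\<exists>B. analytic_germ n r' B (V j)" if "j < N" for j using V that by blast
      fix s \<gamma> j
      assume s: "\<forall>i<n. \<bar>s i\<bar> \<le> r'" and pos: "0 \<le> \<tau> s" and \<gamma>: "integral_curve N f (\<tau> s) \<gamma>"
        and start: "\<forall>i<N. \<gamma> 0 i = w i s" and j: "j < N"
      have "\<forall>i<n. \<bar>s i\<bar> \<le> r" using s r'(2) by (meson order_trans)
      from WE[OF this pos \<gamma> start] have *: "\<forall>j<N. \<gamma> (k * (\<tau> s / m) + 0) j = W j s" by simp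
      have "integral_curve N f (\<tau> s / m) (\<lambda>t. \<gamma> (k * (\<tau> s / m) + t))"
        by (rule integral_curve_shift[OF \<gamma>]) (use inside[OF pos] in auto)
      from VE[OF s _ this *] pos j have "\<gamma> (k * (\<tau> s / m) + \<tau> s / m) j = V j s" by simp
      moreover have "Suc k * (\<tau> s / m) = k * (\<tau> s / m) + \<tau> s / m" by (simp only: of_nat_Suc distrib_right mult_1 add.commute)
      ultimately show "\<gamma> (Suc k * (\<tau> s / m)) j = V j s" by (simp only:)
    qed
  qed
  from this[OF order_refl] show ?thesis using m by simp
qed

text \<open>With \<open>n = 0\<close> parameters germs are constants, and \<open>flow_step\<close>
  says that both curves arrive at the value of one and the same series.\<close>

lemma integral_curve_unique_local:
  assumes f: "\<And>i. i < N \<Longrightarrow> polyfun {..<N} (f i)"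
  shows "\<exists>\<epsilon>>0. \<forall>h \<gamma> \<delta>. 0 \<le> h \<longrightarrow> h \<le> \<epsilon> \<longrightarrow> integral_curve N f h \<gamma> \<longrightarrow> integral_curve N f h \<delta> \<longrightarrow>
    (\<forall>i<N. \<gamma> 0 i = x i \<and> \<delta> 0 i = x i) \<longrightarrow> (\<forall>i<N. \<gamma> h i = \<delta> h i)"
proof -
  define B where "B = (\<Sum>i<N. \<bar>x i\<bar>) + 1"
  have B: "B \<ge> 1" unfolding B_def by (simp add: sum_nonneg)
  have xB: "\<bar>x i\<bar> \<le> B" if "i < N" for i
    using member_le_sum[of i "{..<N}" "\<lambda>i. \<bar>x i\<bar>"] that unfolding B_def by auto
  obtain \<epsilon> K where \<epsilon>: "\<epsilon> > 0" and step: "\<And>n r w \<tau>. r > 0 \<Longrightarrow> \<forall>i<N. analytic_germ n r B (w i) \<Longrightarrow> analytic_germ n r \<epsilon> \<tau> \<Longrightarrow>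
    \<exists>W. (\<forall>j<N. analytic_germ n r K (W j)) \<and>
      (\<forall>s \<gamma>. (\<forall>i<n. \<bar>s i\<bar> \<le> r) \<longrightarrow> 0 \<le> \<tau> s \<longrightarrow> integral_curve N f (\<tau> s) \<gamma> \<longrightarrow>
         (\<forall>i<N. \<gamma> 0 i = w i s) \<longrightarrow> (\<forall>j<N. \<gamma> (\<tau> s) j = W j s))"
    using flow_step[of N f, OF f B] by blast
  show ?thesis
  proof (intro exI[of _ \<epsilon>] conjI \<epsilon> allI impI)
    fix h \<gamma> \<delta> i
    assume h: "0 \<le> h" "h \<le> \<epsilon>" and c: "integral_curve N f h \<gamma>" "integral_curve N f h \<delta>"
      and start: "\<forall>i<N. \<gamma> 0 i = x i \<and> \<delta> 0 i = x i" and i: "i < N"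
    have 1: "\<forall>i<N. analytic_germ 0 1 B (\<lambda>_. x i)" using xB by (auto intro: analytic_germ_const)
    have 2: "analytic_germ 0 1 \<epsilon> (\<lambda>_. h)" using h by (auto intro: analytic_germ_const)
    from step[OF zero_less_one 1 2] obtain W where W: "\<And>s \<gamma>. \<lbrakk>\<forall>i<(0 :: nat). \<bar>s i\<bar> \<le> (1 :: real); 0 \<le> h; integral_curve N f h \<gamma>;
         \<forall>i<N. \<gamma> 0 i = x i\<rbrakk> \<Longrightarrow> \<forall>j<N. \<gamma> h j = W j s" by blast
    show "\<gamma> h i = \<delta> h i" using W[of "\<lambda>_. 0", OF _ h(1) c(1)] W[of "\<lambda>_. 0", OF _ h(1) c(2)] start i by auto
  qed
qed

section \<open>Piecewise constant inputs\<close>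

text \<open>Durations may be 0: every piece before \<open>i\<close> ends no later than
  \<open>\<tau>\<close>, so the least index skips it, empty or not.\<close>

lemma pc_input_eq:
  assumes i: "i < l" and t: "\<And>j. j < l \<Longrightarrow> 0 \<le> t j"
    and \<tau>: "(\<Sum>j<i. t j) \<le> \<tau>" "\<tau> < (\<Sum>j\<le>i. t j) \<or> i = l - 1"
  shows "pc_input l \<beta> t \<tau> = \<beta> i"
proof -
  have "0 \<le> (\<Sum>j<i. t j)" using i t by (intro sum_nonneg) auto
  then have "\<tau> \<ge> 0" using \<tau>(1) by linarith
  moreover have "(LEAST i. \<tau> < (\<Sum>j\<le>i. t j) \<or> i = l - 1) = i"
  proof (rule Least_equality)
    fix y assume y: "\<tau> < (\<Sum>j\<le>y. t j) \<or> y = l - 1"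
    show "i \<le> y"
    proof (rule ccontr)
      assume "\<not> i \<le> y"
      then have yi: "y < i" by simp
      have "(\<Sum>j\<le>y. t j) \<le> (\<Sum>j<i. t j)"
        using yi i t by (intro sum_mono2) auto
      then show False using y yi i \<tau>(1) by auto
    qed
  qed (use \<tau>(2) in auto)
  ultimately show ?thesis unfolding pc_input_def by simp
qed

lemma partial_sum_interval:
  fixes t :: "nat \<Rightarrow> real"
  assumes "0 \<le> \<tau>" "\<tau> < (\<Sum>j<l. t j)"
  shows "\<exists>i<l. (\<Sum>j<i. t j) \<le> \<tau> \<and> \<tau> < (\<Sum>j\<le>i. t j)"
  using assms
proof (induction l)
  case (Suc l)
  show ?case
  proof (cases "\<tau> < (\<Sum>j<l. t j)")
    case True
    then show ?thesis using Suc.IH[OF Suc.prems(1)] less_SucI by blast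
  next
    case False
    then show ?thesis using Suc.prems by (intro exI[of _ l]) (auto simp: lessThan_Suc_atMost)
  qed
qed simp

lemma inputs_pco_I: "l > 0 \<Longrightarrow> (\<And>i. i < l \<Longrightarrow> \<beta> i \<in> U) \<Longrightarrow> (\<And>i. i < l \<Longrightarrow> 0 \<le> t i) \<Longrightarrow> pc_input l \<beta> t \<in> inputs_pco U"
  unfolding inputs_pco_def by blast

text \<open>For any horizon \<open>T\<close> the input on \<open>[0, T[\<close> is a word whose
  durations sum to exactly \<open>T\<close>; the state at time \<open>T\<close> is then a state at
  the end of a word.\<close>

lemma inputs_pco_pieces:
  assumes u: "u \<in> inputs_pco U" and T: "0 \<le> T"
  obtains l :: nat and \<beta> and t :: "nat \<Rightarrow> real" where "l > 0" "\<And>i. i < l \<Longrightarrow> \<beta> i \<in> U" "\<And>i. i < l \<Longrightarrow> 0 \<le> t i" "(\<Sum>i<l. t i) = T"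
    "\<And>i \<tau>. i < l \<Longrightarrow> (\<Sum>j<i. t j) \<le> \<tau> \<Longrightarrow> \<tau> < (\<Sum>j\<le>i. t j) \<Longrightarrow> u \<tau> = \<beta> i"
proof -
  obtain l \<beta> s where l: "l > 0" and \<beta>: "\<forall>i<l. \<beta> i \<in> U" and s: "\<forall>i<l. 0 \<le> s i" and ueq: "u = pc_input l \<beta> s"
    using u unfolding inputs_pco_def by blast
  \<comment> \<open>The switching times cut off at \<open>T\<close>. From index \<open>l\<close> on
    the value is \<open>T\<close>, so that the last piece, which \<open>u\<close> holds forever, is
    stretched up to the horizon if necessary.\<close>
  define c where "c i = (if i < l then min (\<Sum>j<i. s j) T else T)" for i
  define t where "t i = c (Suc i) - c i" for i
  have sums: "(\<Sum>j<i. t j) = c i" for i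
    unfolding t_def sum_lessThan_telescope using l T by (simp add: c_def)
  have sums': "(\<Sum>j\<le>i. t j) = c (Suc i)" for i
    using sums[of "Suc i"] by (simp add: lessThan_Suc_atMost)
  show thesis
  proof (rule that[of l \<beta> t])
    show "0 \<le> t i" if "i < l" for i
      using that s unfolding t_def c_def by auto
    show "(\<Sum>i<l. t i) = T" unfolding sums c_def by simp
    fix i \<tau> assume i: "i < l" and lo: "(\<Sum>j<i. t j) \<le> \<tau>" and hi: "\<tau> < (\<Sum>j\<le>i. t j)"
    have "\<tau> < T" using hi unfolding sums' c_def by (auto split: if_splits)
    then have "(\<Sum>j<i. s j) \<le> \<tau>" using lo i unfolding sums c_def by auto
    moreover have "\<tau> < (\<Sum>j\<le>i. s j) \<or> i = l - 1"
      using hi i unfolding sums' c_def by (auto simp: lessThan_Suc_atMost split: if_splits)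
    ultimately show "u \<tau> = \<beta> i" unfolding ueq using i s by (intro pc_input_eq) auto
  qed (use l \<beta> in auto)
qed

lemma inputs_pco_right_constant:
  assumes u: "u \<in> inputs_pco U" and t: "0 \<le> t"
  shows "u t \<in> U" "\<exists>\<delta>>0. \<forall>s. t \<le> s \<longrightarrow> s < t + \<delta> \<longrightarrow> u s = u t"
proof -
  \<comment> \<open>The horizon \<open>t + 1\<close> puts \<open>t\<close> strictly before the end,
    so some half-open piece contains it.\<close>
  have "0 \<le> t + 1" using t by simp
  then obtain l :: nat and \<beta> d where "l > 0" "\<And>i. i < l \<Longrightarrow> 0 \<le> d i"
    and *: "\<And>i. i < l \<Longrightarrow> \<beta> i \<in> U" "(\<Sum>i<l. d i) = t + 1"
    "\<And>i \<tau>. i < l \<Longrightarrow> (\<Sum>j<i. d j) \<le> \<tau> \<Longrightarrow> \<tau> < (\<Sum>j\<le>i. d j) \<Longrightarrow> u \<tau> = \<beta> i"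
    by (rule inputs_pco_pieces[OF u]) (rule that, assumption+)
  have "t < (\<Sum>i<l. d i)" using *(2) by simp
  from partial_sum_interval[OF t this] obtain i where i: "i < l" "(\<Sum>j<i. d j) \<le> t" "t < (\<Sum>j\<le>i. d j)" by blast
  show "u t \<in> U" using *(1,3) i by auto
  show "\<exists>\<delta>>0. \<forall>s. t \<le> s \<longrightarrow> s < t + \<delta> \<longrightarrow> u s = u t"
    by (rule exI[of _ "(\<Sum>j\<le>i. d j) - t"]) (use *(3)[OF i(1)] i in auto)
qed

lemma pc_input_after:
  assumes "l > 0" "\<And>j. j < l \<Longrightarrow> 0 \<le> t j" "(\<Sum>j<l. t j) \<le> \<tau>"
  shows "pc_input l \<beta> t \<tau> = \<beta> (l - 1)"
proof (rule pc_input_eq)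
  have "(\<Sum>j<l - 1. t j) \<le> (\<Sum>j<l. t j)" using assms by (intro sum_mono2) auto
  then show "(\<Sum>j<l - 1. t j) \<le> \<tau>" using assms(3) by linarith
qed (use assms in auto)

lemma pc_input_agree:
  assumes l: "l \<le> L" and t: "\<And>j. j < L \<Longrightarrow> 0 \<le> t j"
    and u: "\<And>i \<tau>. i < l \<Longrightarrow> (\<Sum>j<i. t j) \<le> \<tau> \<Longrightarrow> \<tau> < (\<Sum>j\<le>i. t j) \<Longrightarrow> u \<tau> = \<beta> i"
    and \<tau>: "0 \<le> \<tau>" "\<tau> < (\<Sum>j<l. t j)"
  shows "pc_input L \<beta> t \<tau> = u \<tau>"
proof -
  obtain i where i: "i < l" "(\<Sum>j<i. t j) \<le> \<tau>" "\<tau> < (\<Sum>j\<le>i. t j)"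
    using partial_sum_interval[OF \<tau>] by blast
  have "pc_input L \<beta> t \<tau> = \<beta> i" by (rule pc_input_eq) (use i l t in auto)
  then show ?thesis using u[OF i] by simp
qed

lemma switch_to_in_inputs_pco:
  assumes u: "u \<in> inputs_pco U" and t: "0 \<le> t" and \<alpha>: "\<alpha> \<in> U"
  shows "switch_to u t \<alpha> \<in> inputs_pco U"
proof -
  obtain l :: nat and \<beta> d where l: "l > 0" "\<And>i. i < l \<Longrightarrow> \<beta> i \<in> U" "\<And>i. i < l \<Longrightarrow> 0 \<le> d i" "(\<Sum>i<l. d i) = t"
    "\<And>i \<tau>. i < l \<Longrightarrow> (\<Sum>j<i. d j) \<le> \<tau> \<Longrightarrow> \<tau> < (\<Sum>j\<le>i. d j) \<Longrightarrow> u \<tau> = \<beta> i"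
    by (rule inputs_pco_pieces[OF u t]) (rule that, assumption+)
  define \<beta>' where "\<beta>' = \<beta>(l := \<alpha>)"
  \<comment> \<open>Duration 0 suffices for the appended piece, as the last value is held
    forever.\<close>
  define d' where "d' = d(l := 0)"
  have s1: "(\<Sum>j<i. d' j) = (\<Sum>j<i. d j)" if "i \<le> l" for i
    using that unfolding d'_def by (intro sum.cong) auto
  have s2: "(\<Sum>j\<le>i. d' j) = (\<Sum>j\<le>i. d j)" if "i < l" for i
    using that unfolding d'_def by (intro sum.cong) auto
  have d': "0 \<le> d' j" if "j < Suc l" for j using that l(3) unfolding d'_def by auto
  have "switch_to u t \<alpha> = pc_input (Suc l) \<beta>' d'"
  proof
    fix \<tau> :: real
    consider "\<tau> < 0" | "0 \<le> \<tau>" "\<tau> < t" | "t \<le> \<tau>" by linarith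
    then show "switch_to u t \<alpha> \<tau> = pc_input (Suc l) \<beta>' d' \<tau>"
    proof cases
      case 1
      then show ?thesis unfolding switch_to_def pc_input_def by simp
    next
      case 2
      have "pc_input (Suc l) \<beta>' d' \<tau> = u \<tau>"
        by (rule pc_input_agree[where l = l]) (use 2 l s1 s2 d' in \<open>auto simp: \<beta>'_def\<close>)
      then show ?thesis using 2 unfolding switch_to_def by simp
    next
      case 3
      have "pc_input (Suc l) \<beta>' d' \<tau> = \<beta>' (Suc l - 1)"
        by (rule pc_input_after) (use 3 s1[of l] d' l(4) in \<open>auto simp: d'_def\<close>)
      then show ?thesis using 3 t unfolding switch_to_def \<beta>'_def by simp
    qed
  qed
  also have "\<dots> \<in> inputs_pco U"
    by (rule inputs_pco_I) (use l(2) d' \<alpha> in \<open>auto simp: \<beta>'_def less_Suc_eq\<close>)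
  finally show ?thesis .
qed

section \<open>Trajectories of polynomial systems\<close>

text \<open>\<open>V\<close> picks a global trajectory for each input. Its existence is assumed, to
  be supplied by a realization; that it depends on the input causally and uniquely is derived. Only
  the first \<open>N\<close> coordinates are constrained.\<close>

locale polynomial_trajectories =
  fixes U :: "rvec set" and N :: nat and f :: "rvec \<Rightarrow> nat \<Rightarrow> rvec \<Rightarrow> real" and v0 :: rvec
    and V :: "rvec signal \<Rightarrow> rvec signal"
  assumes field: "\<alpha> \<in> U \<Longrightarrow> i < N \<Longrightarrow> polyfun {..<N} (f \<alpha> i)"
    and start: "u \<in> inputs_pco U \<Longrightarrow> i < N \<Longrightarrow> V u 0 i = v0 i"
    and ac: "u \<in> inputs_pco U \<Longrightarrow> i < N \<Longrightarrow> 0 \<le> T \<Longrightarrow> abs_continuous_on 0 T (\<lambda>t. V u t i)"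
    and ode: "u \<in> inputs_pco U \<Longrightarrow> AE t in lebesgue. 0 \<le> t \<longrightarrow>
      (\<forall>i<N. ((\<lambda>\<tau>. V u \<tau> i) has_real_derivative f (u t) i (V u t)) (at t within {0..}))"
begin

lemma trajectory_continuous:
  assumes u: "u \<in> inputs_pco U" and i: "i < N"
  shows "continuous_on {0..T} (\<lambda>t. V u t i)"
  by (cases "0 \<le> T") (use abs_continuous_on_imp_continuous_on[OF ac[OF u i]] in auto)

text \<open>The field for the fixed input \<alpha> is continuous along the trajectory, so
  \<open>abs_continuous_on_C1\<close> gives the differential equation at every time of the closed
  interval.\<close>

lemma trajectory_curve:
  assumes u: "u \<in> inputs_pco U" and \<alpha>: "\<alpha> \<in> U" and ab: "0 \<le> a" "a \<le> b"
    and const: "\<And>t. a \<le> t \<Longrightarrow> t < b \<Longrightarrow> u t = \<alpha>"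
  shows "integral_curve N (f \<alpha>) (b - a) (\<lambda>t. V u (a + t))"
  unfolding integral_curve_def
proof (intro allI impI ballI)
  fix i t assume i: "i < N" and t: "t \<in> {0..b - a}"
  obtain S where S: "S \<in> null_sets lebesgue" "{t. \<not> (0 \<le> t \<longrightarrow>
      (\<forall>i<N. ((\<lambda>\<tau>. V u \<tau> i) has_real_derivative f (u t) i (V u t)) (at t within {0..})))} \<subseteq> S"
    using ode[OF u] unfolding eventually_ae_filter by auto
  \<comment> \<open>At \<open>b\<close> the input may already have its next value; adding one point
    keeps the exceptional set negligible.\<close>
  have neg: "negligible (insert b S)" using S(1) by (simp add: negligible_iff_null_sets[symmetric])
  have "((\<lambda>\<tau>. V u \<tau> i) has_real_derivative f \<alpha> i (V u (a + t))) (at (a + t) within {a..b})"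
  proof (rule abs_continuous_on_C1[OF _ _ neg])
    show "abs_continuous_on a b (\<lambda>\<tau>. V u \<tau> i)"
      by (rule abs_continuous_on_subset[OF ac[OF u i, of b]]) (use ab in auto)
    show "continuous_on {a..b} (\<lambda>t. f \<alpha> i (V u t))"
      by (rule polyfun_continuous_on[OF field[OF \<alpha> i]], rule continuous_on_subset[OF trajectory_continuous[OF u, of _ b]])
        (use ab in auto)
    fix s assume s: "s \<in> {a..b} - insert b S"
    then have "0 \<le> s \<longrightarrow> (\<forall>i<N. ((\<lambda>\<tau>. V u \<tau> i) has_real_derivative f (u s) i (V u s)) (at s within {0..}))"
      using S(2) by blast
    then have "((\<lambda>\<tau>. V u \<tau> i) has_real_derivative f (u s) i (V u s)) (at s within {0..})"
      using s i ab by simp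
    then show "((\<lambda>\<tau>. V u \<tau> i) has_real_derivative f \<alpha> i (V u s)) (at s within {a..b})"
      using const[of s] s ab by (intro DERIV_subset[where t = "{a..b}"]) auto
  qed (use t in auto)
  then show "((\<lambda>\<tau>. V u (a + \<tau>) i) has_real_derivative f \<alpha> i (V u (a + t))) (at t within {0..b - a})"
    by (rule has_real_derivative_shift)
qed

text \<open>A continuation argument: agreement is a closed condition, and since inputs are constant
  for a while to the right of any time, local uniqueness extends it. Inputs are compared strictly
  before \<open>T\<close> only, which allows switching at \<open>T\<close> itself.\<close>

lemma trajectory_unique:
  assumes u: "u \<in> inputs_pco U" and w: "w \<in> inputs_pco U" and T: "0 \<le> T"
    and agree: "\<And>s. 0 \<le> s \<Longrightarrow> s < T \<Longrightarrow> u s = w s" and i: "i < N"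
  shows "V u T i = V w T i"
proof -
  define E where "E = (\<Inter>i<N. {t \<in> {0..T}. V u t i = V w t i}) \<inter> {0..T}"
  have "closed {t \<in> {0..T}. V u t i - V w t i = 0}" if "i < N" for i
    by (intro continuous_closed_preimage_constant continuous_on_diff trajectory_continuous[OF u that]
        trajectory_continuous[OF w that] closed_atLeastAtMost)
  then have closed: "closed E" unfolding E_def by (intro closed_Int closed_INT) auto
  have E: "t \<in> E \<longleftrightarrow> 0 \<le> t \<and> t \<le> T \<and> (\<forall>i<N. V u t i = V w t i)" for t
    unfolding E_def by auto
  \<comment> \<open>The times up to which the trajectories agree throughout. If the supremum were
    below \<open>T\<close>, the step \<open>h0\<close> would lead beyond it.\<close>
  define A where "A = {t \<in> {0..T}. {0..t} \<subseteq> E}"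
  have "0 \<in> A" using T start[OF u] start[OF w] by (auto simp: A_def E)
  have bdd: "bdd_above A" unfolding A_def by (auto intro: bdd_aboveI[of _ T])
  define t0 where "t0 = Sup A"
  have A: "A \<noteq> {}" using \<open>0 \<in> A\<close> by blast
  have AT: "a \<le> T" if "a \<in> A" for a using that unfolding A_def by simp
  have t0: "0 \<le> t0" "t0 \<le> T"
    unfolding t0_def by (rule cSup_upper[OF \<open>0 \<in> A\<close> bdd]) (rule cSup_least[OF A AT])
  have below: "{0..<t0} \<subseteq> E"
  proof
    fix s assume s: "s \<in> {0..<t0}"
    then obtain a where "a \<in> A" "s < a" using less_cSup_iff[OF A bdd, of s] unfolding t0_def by auto
    then show "s \<in> E" using s unfolding A_def by auto
  qed
  have upto: "{0..t0} \<subseteq> E"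
  proof (cases "t0 = 0")
    case True
    then show ?thesis using \<open>0 \<in> A\<close> unfolding A_def by auto
  next
    case False
    then have "closure {0..<t0} = {0..t0}" using t0 by simp
    then show ?thesis using closure_minimal[OF below closed] by simp
  qed
  have "t0 = T"
  proof (rule ccontr)
    assume "t0 \<noteq> T"
    then have lt: "t0 < T" using t0 by simp
    obtain \<delta> where \<delta>: "\<delta> > 0" "\<And>s. t0 \<le> s \<Longrightarrow> s < t0 + \<delta> \<Longrightarrow> u s = u t0"
      using inputs_pco_right_constant(2)[OF u t0(1)] by blast
    have \<alpha>: "u t0 \<in> U" by (rule inputs_pco_right_constant(1)[OF u t0(1)])
    obtain \<epsilon> where \<epsilon>: "\<epsilon> > 0" "\<And>h \<gamma> \<delta>. \<lbrakk>0 \<le> h; h \<le> \<epsilon>; integral_curve N (f (u t0)) h \<gamma>;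
        integral_curve N (f (u t0)) h \<delta>; \<forall>i<N. \<gamma> 0 i = V u t0 i \<and> \<delta> 0 i = V u t0 i\<rbrakk> \<Longrightarrow> \<forall>i<N. \<gamma> h i = \<delta> h i"
      using integral_curve_unique_local[of N "f (u t0)" "V u t0", OF field[OF \<alpha>]] by blast
    define h0 where "h0 = min \<epsilon> (min \<delta> (T - t0))"
    have h0: "h0 > 0" "h0 \<le> \<epsilon>" "h0 \<le> \<delta>" "h0 \<le> T - t0" using \<epsilon>(1) \<delta>(1) lt unfolding h0_def by auto
    have "t0 + h \<in> E" if h: "0 \<le> h" "h \<le> h0" for h
    proof -
      have "integral_curve N (f (u t0)) (t0 + h - t0) (\<lambda>t. V u (t0 + t))"
      proof (rule trajectory_curve[OF u \<alpha> t0(1)])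
        fix t assume t: "t0 \<le> t" "t < t0 + h"
        show "u t = u t0" by (rule \<delta>(2)[OF t(1)]) (use t h h0 in linarith)
      qed (use h in simp)
      moreover have "integral_curve N (f (u t0)) (t0 + h - t0) (\<lambda>t. V w (t0 + t))"
      proof (rule trajectory_curve[OF w \<alpha> t0(1)])
        fix t assume t: "t0 \<le> t" "t < t0 + h"
        have "u t = u t0" by (rule \<delta>(2)[OF t(1)]) (use t h h0 in linarith)
        moreover have "u t = w t" by (rule agree) (use t t0 h h0 in linarith)+
        ultimately show "w t = u t0" by simp
      qed (use h in simp)
      moreover have "\<forall>i<N. V u (t0 + 0) i = V u t0 i \<and> V w (t0 + 0) i = V u t0 i"
        using upto t0 E[of t0] by auto
      ultimately have "\<forall>i<N. V u (t0 + h) i = V w (t0 + h) i"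
        using \<epsilon>(2)[of h "\<lambda>t. V u (t0 + t)" "\<lambda>t. V w (t0 + t)", OF h(1) order_trans[OF h(2) h0(2)]] by simp
      then show ?thesis using E h h0 t0 by auto
    qed
    from this[of "s - t0" for s] have "s \<in> E" if "t0 \<le> s" "s \<le> t0 + h0" for s using that by simp
    moreover have "s \<in> E" if "0 \<le> s" "s \<le> t0" for s using upto that by auto
    ultimately have "s \<in> E" if "0 \<le> s" "s \<le> t0 + h0" for s using that by (cases "s \<le> t0") auto
    then have "{0..t0 + h0} \<subseteq> E" by auto
    then have "t0 + h0 \<in> A" using h0 t0 unfolding A_def by auto
    then have "t0 + h0 \<le> t0" unfolding t0_def by (rule cSup_upper[OF _ bdd])
    then show False using h0 by simp
  qed
  then show ?thesis using upto t0 E[of T] i by auto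
qed

text \<open>Induction over the pieces, each handled by \<open>flow_germ\<close>. The durations are
  arbitrary germs in \<open>n\<close> parameters rather than the parameters themselves, so the lemma
  serves both for analyticity in the durations and for one-parameter paths of inputs.\<close>

lemma trajectory_germ:
  assumes "\<forall>i<l. \<beta> i \<in> U" and l: "l > 0"
    and "\<forall>i<l. \<exists>r>0. \<exists>B. analytic_germ n r B (\<tau> i)"
    and z: "\<forall>i<l. 0 \<le> \<tau> i (\<lambda>_. 0)" and k: "k \<le> l"
  shows "\<exists>r>0. \<exists>W. (\<forall>j<N. \<exists>B. analytic_germ n r B (W j)) \<and>
    (\<forall>s. (\<forall>i<n. \<bar>s i\<bar> \<le> r) \<longrightarrow> (\<forall>i<l. 0 \<le> \<tau> i s) \<longrightarrow>
       (\<forall>j<N. V (pc_input l \<beta> (\<lambda>i. \<tau> i s)) (\<Sum>i<k. \<tau> i s) j = W j s))"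
  using k
proof (induction k)
  case 0
  note \<beta> = assms(1)[rule_format]
  show ?case
    by (rule exI[of _ 1], rule conjI[OF zero_less_one], rule exI[of _ "\<lambda>j _. v0 j"])
      (auto intro!: analytic_germ_const start inputs_pco_I l \<beta>)
next
  case (Suc k)
  note \<beta> = assms(1)[rule_format] and \<tau> = assms(3)[rule_format]
  from Suc.IH[OF Suc_leD[OF Suc.prems]] obtain r W where r: "r > 0"
    and W: "\<forall>j<N. \<exists>B. analytic_germ n r B (W j)"
    and WE: "\<And>s. \<lbrakk>\<forall>i<n. \<bar>s i\<bar> \<le> r; \<forall>i<l. 0 \<le> \<tau> i s\<rbrakk> \<Longrightarrow>
      \<forall>j<N. V (pc_input l \<beta> (\<lambda>i. \<tau> i s)) (\<Sum>i<k. \<tau> i s) j = W j s"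
    by (elim exE conjE, intro that) (assumption, assumption, blast)
  let ?\<gamma> = "\<lambda>s t. V (pc_input l \<beta> (\<lambda>i. \<tau> i s)) ((\<Sum>i<k. \<tau> i s) + t)"
  have kl: "k < l" using Suc.prems by simp
  have curve: "integral_curve N (f (\<beta> k)) (\<tau> k s) (?\<gamma> s)" if pos: "\<forall>i<l. 0 \<le> \<tau> i s" for s
  proof -
    have "integral_curve N (f (\<beta> k)) ((\<Sum>i<k. \<tau> i s) + \<tau> k s - (\<Sum>i<k. \<tau> i s)) (?\<gamma> s)"
    proof (rule trajectory_curve)
      show "pc_input l \<beta> (\<lambda>i. \<tau> i s) \<in> inputs_pco U" using l \<beta> pos by (intro inputs_pco_I) auto
      show "0 \<le> (\<Sum>i<k. \<tau> i s)" using pos kl by (intro sum_nonneg) auto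
      show "pc_input l \<beta> (\<lambda>i. \<tau> i s) t = \<beta> k"
        if "(\<Sum>i<k. \<tau> i s) \<le> t" "t < (\<Sum>i<k. \<tau> i s) + \<tau> k s" for t
        using that kl pos by (intro pc_input_eq) (auto simp: lessThan_Suc_atMost[symmetric])
    qed (use \<beta> kl pos in auto)
    then show ?thesis by simp
  qed
  have W': "\<forall>i<N. \<exists>r>0. \<exists>B. analytic_germ n r B (W i)" using W r by blast
  have F: "\<forall>i<N. polyfun {..<N} (f (\<beta> k) i)" using field[OF \<beta>[OF kl]] by blast
  \<comment> \<open>The reference curve that \<open>flow_germ\<close> asks for is the trajectory at
    the central parameter.\<close>
  have s0: "\<forall>i<N. ?\<gamma> (\<lambda>_. 0) 0 i = W i (\<lambda>_. 0)"
    using WE[OF _ z] r by simp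
  from flow_germ[of N "f (\<beta> k)" n W "\<tau> k" "?\<gamma> (\<lambda>_. 0)", OF F W' \<tau>[OF kl] z[rule_format, OF kl] curve[OF z] s0]
  obtain r1 X where r1: "r1 > 0" and X: "\<forall>j<N. \<exists>B. analytic_germ n r1 B (X j)"
    and XE: "\<And>s \<gamma>. \<lbrakk>\<forall>i<n. \<bar>s i\<bar> \<le> r1; 0 \<le> \<tau> k s; integral_curve N (f (\<beta> k)) (\<tau> k s) \<gamma>;
      \<forall>i<N. \<gamma> 0 i = W i s\<rbrakk> \<Longrightarrow> \<forall>j<N. \<gamma> (\<tau> k s) j = X j s"
    by (elim exE conjE, intro that) (assumption, assumption, blast)
  have X': "\<exists>r>0. \<exists>B. analytic_germ n r B (X i)" if "i < N" for i using X r1 that by blast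
  obtain r2 where r2: "r2 > 0" "\<And>r. r > 0 \<Longrightarrow> r \<le> r2 \<Longrightarrow> \<forall>i<N. analytic_germ n r (\<bar>X i (\<lambda>_. 0)\<bar> + 1) (X i)"
    using analytic_germs_shrink[of N n X 1, OF X'] by auto
  define r3 where "r3 = min r (min r1 r2)"
  have r3: "r3 > 0" "r3 \<le> r" "r3 \<le> r1" "r3 \<le> r2" using r r1 r2 unfolding r3_def by auto
  show ?case
  proof (rule exI[of _ r3], rule conjI[OF r3(1)], rule exI[of _ X], intro conjI allI impI)
    show "\<exists>B. analytic_germ n r3 B (X j)" if "j < N" for j using r2(2)[OF r3(1,4)] that by blast
    fix s j assume s: "\<forall>i<n. \<bar>s i\<bar> \<le> r3" and pos: "\<forall>i<l. 0 \<le> \<tau> i s" and j: "j < N"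
    have s': "\<forall>i<n. \<bar>s i\<bar> \<le> r" "\<forall>i<n. \<bar>s i\<bar> \<le> r1" using s r3 by force+
    have "\<forall>i<N. ?\<gamma> s 0 i = W i s" using WE[OF s'(1) pos] by simp
    from XE[OF s'(2) _ curve[OF pos] this] pos kl j
    show "V (pc_input l \<beta> (\<lambda>i. \<tau> i s)) (\<Sum>i<Suc k. \<tau> i s) j = X j s" by simp
  qed
qed

lemma observable_germ:
  assumes q: "polyfun {..<N} q" and \<beta>: "\<forall>i<l. \<beta> i \<in> U" and l: "l > 0"
    and \<tau>: "\<forall>i<l. \<exists>r>0. \<exists>B. analytic_germ n r B (\<tau> i)"
    and \<tau>0: "\<forall>i<l. 0 \<le> \<tau> i (\<lambda>_. 0)"
  shows "\<exists>r>0. \<exists>B X. analytic_germ n r B X \<and> (\<forall>s. (\<forall>i<n. \<bar>s i\<bar> \<le> r) \<longrightarrow> (\<forall>i<l. 0 \<le> \<tau> i s) \<longrightarrow>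
    q (V (pc_input l \<beta> (\<lambda>i. \<tau> i s)) (\<Sum>i<l. \<tau> i s)) = X s)"
proof -
  obtain r W where r: "r > 0" and W: "\<forall>j<N. \<exists>B. analytic_germ n r B (W j)"
    and WE: "\<And>s. \<lbrakk>\<forall>i<n. \<bar>s i\<bar> \<le> r; \<forall>i<l. 0 \<le> \<tau> i s\<rbrakk> \<Longrightarrow>
      \<forall>j<N. V (pc_input l \<beta> (\<lambda>i. \<tau> i s)) (\<Sum>i<l. \<tau> i s) j = W j s"
    using trajectory_germ[where n = n and \<tau> = \<tau>, OF \<beta> l \<tau> \<tau>0 order_refl]
    by (elim exE conjE, intro that) (assumption, assumption, blast)
  have "\<exists>r>0. \<exists>B. analytic_germ n r B (W j)" if "j < N" for j using W r that by blast
  from polyfun_germ[OF q, where W = W, OF this]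
  obtain r0 where r0: "r0 > 0" "\<forall>r>0. r \<le> r0 \<longrightarrow> (\<exists>C. analytic_germ n r C (\<lambda>s. q (\<lambda>j. W j s)))"
    by blast
  define r1 where "r1 = min r r0"
  have r1: "r1 > 0" "r1 \<le> r" "r1 \<le> r0" using r r0 unfolding r1_def by auto
  obtain C where C: "analytic_germ n r1 C (\<lambda>s. q (\<lambda>j. W j s))" using r0(2) r1 by blast
  show ?thesis
  proof (rule exI[of _ r1], rule conjI[OF r1(1)], rule exI[of _ C], rule exI, rule conjI[OF C], intro allI impI)
    fix s assume s: "\<forall>i<n. \<bar>s i\<bar> \<le> r1" and pos: "\<forall>i<l. 0 \<le> \<tau> i s"
    have "\<forall>i<n. \<bar>s i\<bar> \<le> r" using s r1 by force
    from WE[OF this pos] show "q (V (pc_input l \<beta> (\<lambda>i. \<tau> i s)) (\<Sum>i<l. \<tau> i s)) = q (\<lambda>j. W j s)"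
      by (intro polyfun_cong[OF q]) auto
  qed
qed

text \<open>
  Two reachable states are joined by an analytic path: concatenate the two input words and move
  the vector of switching durations along a straight line.
\<close>
lemma observables_no_zero_divisors:
  assumes a: "polyfun {..<N} a" and b: "polyfun {..<N} b"
    and zero: "\<And>u t. u \<in> inputs_pco U \<Longrightarrow> 0 \<le> t \<Longrightarrow> a (V u t) * b (V u t) = 0"
    and u: "u \<in> inputs_pco U" "0 \<le> t" and w: "w \<in> inputs_pco U" "0 \<le> s"
  shows "a (V u t) = 0 \<or> b (V w s) = 0"
proof -
  obtain l :: nat and \<beta> d where l: "l > 0" and \<beta>: "\<And>i. i < l \<Longrightarrow> \<beta> i \<in> U" and d: "\<And>i. i < l \<Longrightarrow> 0 \<le> d i"
    and dt: "(\<Sum>i<l. d i) = t"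
    and up: "\<And>i \<tau>. i < l \<Longrightarrow> (\<Sum>j<i. d j) \<le> \<tau> \<Longrightarrow> \<tau> < (\<Sum>j\<le>i. d j) \<Longrightarrow> u \<tau> = \<beta> i"
    by (rule inputs_pco_pieces[OF u]) (rule that, assumption+)
  obtain l' :: nat and \<beta>' d' where \<beta>': "\<And>i. i < l' \<Longrightarrow> \<beta>' i \<in> U" and d': "\<And>i. i < l' \<Longrightarrow> 0 \<le> d' i"
    and dt': "(\<Sum>i<l'. d' i) = s"
    and wp: "\<And>i \<tau>. i < l' \<Longrightarrow> (\<Sum>j<i. d' j) \<le> \<tau> \<Longrightarrow> \<tau> < (\<Sum>j\<le>i. d' j) \<Longrightarrow> w \<tau> = \<beta>' i"
    by (rule inputs_pco_pieces[OF w]) (rule that, assumption+)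
  define L where "L = l + l'"
  define \<delta> where "\<delta> i = (if i < l then \<beta> i else \<beta>' (i - l))" for i
  \<comment> \<open>\<open>A\<close> gives the second word duration 0 and \<open>B\<close> does so
    to the first. The ends of the segment \<open>dur\<close> thus replay \<open>u\<close> up to
    \<open>t\<close> and \<open>w\<close> up to \<open>s\<close>.\<close>
  define A where "A i = (if i < l then d i else 0)" for i
  define B where "B i = (if i < l then 0 else d' (i - l))" for i
  define dur where "dur x i = A i + x * (B i - A i)" for x i
  have L: "L > 0" "l \<le> L" using l unfolding L_def by auto
  have \<delta>: "\<forall>i<L. \<delta> i \<in> U" using \<beta> \<beta>' unfolding L_def \<delta>_def by auto
  have A0: "0 \<le> A i" if "i < L" for i using that d unfolding A_def by auto
  have B0: "0 \<le> B i" if "i < L" for i using that d' unfolding B_def L_def by auto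
  have dur0: "0 \<le> dur x i" if "x \<in> {0..1}" "i < L" for x i
  proof -
    have "dur x i = (1 - x) * A i + x * B i" unfolding dur_def by (simp add: algebra_simps)
    then show ?thesis using A0[OF that(2)] B0[OF that(2)] that(1) by simp
  qed
  have input: "pc_input L \<delta> e \<in> inputs_pco U" if "\<And>i. i < L \<Longrightarrow> 0 \<le> e i" for e
    using L \<delta> that by (intro inputs_pco_I) auto
  have sA: "(\<Sum>j<i. A j) = (\<Sum>j<i. d j)" if "i \<le> l" for i
    using that unfolding A_def by (intro sum.cong) auto
  have sA': "(\<Sum>i<L. A i) = t"
  proof -
    have "(\<Sum>i<L. A i) = (\<Sum>i<l. A i)"
      by (rule sum.mono_neutral_right) (auto simp: A_def L_def)
    then show ?thesis using sA[of l] dt by simp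
  qed
  have sB: "(\<Sum>j<l + k. B j) = (\<Sum>j<k. d' j)" for k
    by (induction k) (auto simp: B_def)
  have sB0: "(\<Sum>j<k. B j) = 0" if "k \<le> l" for k
    using that unfolding B_def by (intro sum.neutral) auto
  have VA: "V (pc_input L \<delta> A) t i = V u t i" if "i < N" for i
  proof (rule trajectory_unique[OF input[OF A0] u(1) u(2) _ that])
    fix \<tau> assume "0 \<le> \<tau>" "\<tau> < t"
    then show "pc_input L \<delta> A \<tau> = u \<tau>"
    proof (intro pc_input_agree[OF L(2) A0])
      fix i \<tau> assume i: "i < l" "(\<Sum>j<i. A j) \<le> \<tau>" "\<tau> < (\<Sum>j\<le>i. A j)"
      then show "u \<tau> = \<delta> i"
        using up[of i \<tau>] sA[of i] sA[of "Suc i"] unfolding \<delta>_def by (simp add: lessThan_Suc_atMost)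
    qed (use sA[of l] dt in auto)
  qed
  have VB: "V (pc_input L \<delta> B) s i = V w s i" if "i < N" for i
  proof (rule trajectory_unique[OF input[OF B0] w(1) w(2) _ that])
    fix \<tau> assume "0 \<le> \<tau>" "\<tau> < s"
    then show "pc_input L \<delta> B \<tau> = w \<tau>"
    proof (intro pc_input_agree[OF order_refl B0])
      fix i \<tau> assume i: "i < L" "(\<Sum>j<i. B j) \<le> \<tau>" "\<tau> < (\<Sum>j\<le>i. B j)"
      \<comment> \<open>In \<open>B\<close> the first word has duration 0, so a piece that contains
        a time lies in the second word.\<close>
      have le: "l \<le> i"
      proof (rule ccontr)
        assume "\<not> l \<le> i"
        then show False using i sB0[of i] sB0[of "Suc i"] by (simp add: lessThan_Suc_atMost)
      qed
      then obtain k where k: "i = l + k" using le_Suc_ex by blast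
      then show "w \<tau> = \<delta> i"
        using i wp[of k \<tau>] sB[of k] sB[of "Suc k"] unfolding \<delta>_def L_def by (simp add: lessThan_Suc_atMost)
    qed (use sB[of l'] dt' in \<open>auto simp: L_def\<close>)
  qed
  define F where "F c x = c (V (pc_input L \<delta> (dur x)) (\<Sum>i<L. dur x i))" for c :: "rvec \<Rightarrow> real" and x
  have germ: "\<exists>r>0. \<exists>B X. analytic_germ 1 r B X \<and>
      (\<forall>s. \<bar>s\<bar> \<le> r \<longrightarrow> x + s \<in> {0..1} \<longrightarrow> F c (x + s) = X (\<lambda>_. s))"
    if c: "polyfun {..<N} c" and x: "x \<in> {0..1}" for c x
  proof -
    \<comment> \<open>The durations are affine in the path parameter, hence germs in one variable.
      They are nonnegative while the parameter stays in the unit interval, which is where the germ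
      is compared.\<close>
    define \<tau> where "\<tau> i s = A i + (x + s 0) * (B i - A i)" for i and s :: rvec
    have "analytic_germ 1 1 (\<bar>A i\<bar> + (\<bar>x\<bar> + 1) * \<bar>B i - A i\<bar>) (\<tau> i)" for i
      unfolding \<tau>_def
      by (intro analytic_germ_add analytic_germ_mult analytic_germ_const[OF _ order_refl] analytic_germ_coord) auto
    then have 1: "\<forall>i<L. \<exists>r>0. \<exists>B. analytic_germ 1 r B (\<tau> i)" using zero_less_one by blast
    have 2: "\<forall>i<L. 0 \<le> \<tau> i (\<lambda>_. 0)" using dur0[OF x] unfolding \<tau>_def dur_def by simp
    obtain r B X where r: "r > 0" "analytic_germ 1 r B X"
      and X: "\<forall>s. (\<forall>i<1. \<bar>s i\<bar> \<le> r) \<longrightarrow> (\<forall>i<L. 0 \<le> \<tau> i s) \<longrightarrow>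
        c (V (pc_input L \<delta> (\<lambda>i. \<tau> i s)) (\<Sum>i<L. \<tau> i s)) = X s"
      using observable_germ[OF c \<delta> L(1) 1 2] by blast
    show ?thesis
    proof (rule exI[of _ r], rule conjI[OF r(1)], rule exI[of _ B], rule exI[of _ X], rule conjI[OF r(2)], intro allI impI)
      fix s assume s: "\<bar>s\<bar> \<le> r" "x + s \<in> {0..1}"
      have "\<tau> i (\<lambda>_. s) = dur (x + s) i" for i unfolding \<tau>_def dur_def by simp
      then show "F c (x + s) = X (\<lambda>_. s)"
        using X[rule_format, of "\<lambda>_. s"] s dur0[OF s(2)] unfolding F_def by simp
    qed
  qed
  have "F a x * F b x = 0" if "x \<in> {0..1}" for x
    unfolding F_def using that dur0 by (intro zero input sum_nonneg) auto
  from analytic_no_zero_divisors[OF germ[OF a] germ[OF b] this]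
  have "F a 0 = 0 \<or> F b 1 = 0" by blast
  moreover have "F a 0 = a (V u t)"
    unfolding F_def using sA' by (intro polyfun_cong[OF a]) (auto simp: dur_def[abs_def] VA)
  moreover have "F b 1 = b (V w s)"
    unfolding F_def using sB[of l'] dt' by (intro polyfun_cong[OF b]) (auto simp: dur_def[abs_def] VB L_def[symmetric])
  ultimately show ?thesis by simp
qed

end

section \<open>The observation algebra\<close>

lemma piecewise_continuous_restrict:
  assumes g: "\<And>T. continuous_on {0..T} g"
  shows "piecewise_continuous (\<lambda>t\<in>{0..}. g t)"
proof -
  have lim: "((\<lambda>t\<in>{0..}. g t) \<longlongrightarrow> g t) (at t within {0..})" if t: "t \<ge> 0" for t :: real
  proof -
    have "at t within {0..} = at t within {0..t + 1}"
      by (rule at_within_nhd[of t "{..<t + 1}"]) auto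
    moreover have "(g \<longlongrightarrow> g t) (at t within {0..t + 1})"
      using g[of "t + 1"] t by (auto simp: continuous_on_def)
    ultimately have "(g \<longlongrightarrow> g t) (at t within {0..})" by simp
    then show ?thesis
      by (rule Lim_transform_within[where d = 1]) auto
  qed
  show ?thesis
    unfolding piecewise_continuous_def
  proof (intro conjI allI impI)
    have "continuous (at t within {0..}) (\<lambda>t\<in>{0..}. g t)" if "t \<ge> 0" for t :: real
      unfolding continuous_within using lim[OF that] that by simp
    then show "finite {t \<in> {0..T}. \<not> continuous (at t within {0..}) (\<lambda>t\<in>{0..}. g t)}" for T
      by (auto intro: rev_finite_subset[of "{}"])
    fix t :: real
    show "\<exists>L. ((\<lambda>t\<in>{0..}. g t) \<longlongrightarrow> L) (at_right t)" if "t \<ge> 0"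
      by (rule exI, rule tendsto_within_subset[OF lim[OF that]]) (use that in auto)
    show "\<exists>L. ((\<lambda>t\<in>{0..}. g t) \<longlongrightarrow> L) (at_left t)" if "t > 0"
    proof -
      have "at t within {0..} = at t" using that by (intro at_within_interior) auto
      with lim[of t] that have "((\<lambda>t\<in>{0..}. g t) \<longlongrightarrow> g t) (at t)" by simp
      then have "((\<lambda>t\<in>{0..}. g t) \<longlongrightarrow> g t) (at_left t)" by (rule tendsto_within_subset) auto
      then show ?thesis by blast
    qed
  qed
qed

lemma io_algebra_simps:
  "carrier (io_algebra U) = {\<phi> \<in> inputs_pco U \<rightarrow>\<^sub>E real_pc. causal U \<phi> \<and> io_analytic U \<phi>}"
  "mult (io_algebra U) = (\<lambda>\<phi> \<psi>. \<lambda>u\<in>inputs_pco U. \<lambda>t\<in>{0..}. \<phi> u t * \<psi> u t)"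
  "add (io_algebra U) = (\<lambda>\<phi> \<psi>. \<lambda>u\<in>inputs_pco U. \<lambda>t\<in>{0..}. \<phi> u t + \<psi> u t)"
  "one (io_algebra U) = io_const U 1"
  "zero (io_algebra U) = io_const U 0"
  unfolding io_algebra_def by simp_all

lemma io_const_inject:
  assumes "U \<noteq> {}" "io_const U c = io_const U d"
  shows "c = d"
proof -
  obtain \<alpha> where "\<alpha> \<in> U" using assms(1) by blast
  then have "pc_input 1 (\<lambda>_. \<alpha>) (\<lambda>_. 0) \<in> inputs_pco U" by (intro inputs_pco_I) auto
  moreover have "io_const U c (pc_input 1 (\<lambda>_. \<alpha>) (\<lambda>_. 0)) 0 = io_const U d (pc_input 1 (\<lambda>_. \<alpha>) (\<lambda>_. 0)) 0"
    using assms(2) by simp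
  ultimately show ?thesis by (simp add: io_const_def)
qed

text \<open>\<open>m_inv\<close> is a definite description; pointwise uniqueness evaluates it
  directly, without establishing the ring laws on the whole carrier.\<close>

lemma io_algebra_inverse:
  assumes "\<phi> \<in> carrier (io_algebra U)" "\<psi> \<in> carrier (io_algebra U)"
    and neg: "\<And>u t. u \<in> inputs_pco U \<Longrightarrow> 0 \<le> t \<Longrightarrow> \<psi> u t = - \<phi> u t"
  shows "m_inv (add_monoid (io_algebra U)) \<phi> = \<psi>"
proof -
  let ?add = "\<lambda>\<phi> \<psi>. \<lambda>u\<in>inputs_pco U. \<lambda>t\<in>{0..}. \<phi> u t + \<psi> u t :: real"
  have ext: "\<eta> = \<psi>" if \<eta>: "\<eta> \<in> carrier (io_algebra U)" "?add \<phi> \<eta> = io_const U 0" for \<eta>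
  proof (rule ext)
    fix u show "\<eta> u = \<psi> u"
    proof (cases "u \<in> inputs_pco U")
      case True
      have "\<eta> u t = \<psi> u t" if "0 \<le> t" for t
        using fun_cong[OF fun_cong[OF \<eta>(2), of u], of t] neg[OF True that] True that
        by (simp add: io_const_def)
      moreover have "\<eta> u \<in> extensional {0..}" "\<psi> u \<in> extensional {0..}"
        using \<eta>(1) assms(2) True by (auto simp: io_algebra_simps real_pc_def dest!: PiE_mem)
      ultimately show ?thesis by (intro extensionalityI[of _ "{0..}"]) auto
    next
      case False
      then show ?thesis using \<eta>(1) assms(2) by (auto simp: io_algebra_simps PiE_def extensional_def)
    qed
  qed
  have sums: "?add \<phi> \<psi> = io_const U 0" "?add \<psi> \<phi> = io_const U 0"
    unfolding io_const_def by (auto simp: neg restrict_def fun_eq_iff)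
  show ?thesis
    unfolding m_inv_def
  proof (rule the_equality)
    show "\<psi> \<in> carrier (add_monoid (io_algebra U)) \<and>
        \<phi> \<otimes>\<^bsub>add_monoid (io_algebra U)\<^esub> \<psi> = \<one>\<^bsub>add_monoid (io_algebra U)\<^esub> \<and>
        \<psi> \<otimes>\<^bsub>add_monoid (io_algebra U)\<^esub> \<phi> = \<one>\<^bsub>add_monoid (io_algebra U)\<^esub>"
      using assms(2) sums by (simp add: io_algebra_simps)
  qed (rule ext; simp add: io_algebra_simps)
qed

section \<open>Polynomial functions of the state as input-output maps\<close>

context polynomial_trajectories
begin

definition observable :: "(rvec \<Rightarrow> real) \<Rightarrow> rvec signal \<Rightarrow> real signal" where
  "observable q = (\<lambda>u\<in>inputs_pco U. \<lambda>t\<in>{0..}. q (V u t))"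

definition observables :: "(rvec signal \<Rightarrow> real signal) set" where
  "observables = observable ` {q. polyfun {..<N} q}"

lemma observable_apply: "u \<in> inputs_pco U \<Longrightarrow> 0 \<le> t \<Longrightarrow> observable q u t = q (V u t)"
  unfolding observable_def by simp

lemma observable_eqI:
  "(\<And>u t. u \<in> inputs_pco U \<Longrightarrow> 0 \<le> t \<Longrightarrow> a (V u t) = b (V u t)) \<Longrightarrow> observable a = observable b"
  unfolding observable_def by (auto simp: fun_eq_iff restrict_def)

lemma observable_simps:
  "observable a \<oplus>\<^bsub>io_algebra U\<^esub> observable b = observable (\<lambda>x. a x + b x)"
  "observable a \<otimes>\<^bsub>io_algebra U\<^esub> observable b = observable (\<lambda>x. a x * b x)"
  "io_const U c = observable (\<lambda>_. c)"
  "\<one>\<^bsub>io_algebra U\<^esub> = observable (\<lambda>_. 1)"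
  "\<zero>\<^bsub>io_algebra U\<^esub> = observable (\<lambda>_. 0)"
  unfolding io_algebra_simps observable_def io_const_def by (auto simp: fun_eq_iff restrict_def)

lemma observable_causal:
  assumes q: "polyfun {..<N} q"
  shows "causal U (observable q)"
  unfolding causal_def
proof (intro ballI allI impI)
  fix u w t s assume u: "u \<in> inputs_pco U" and w: "w \<in> inputs_pco U"
    and agree: "\<forall>s\<in>{0..t}. u s = w s" and s: "s \<in> {0..t}"
  have "q (V u s) = q (V w s)"
    by (rule polyfun_cong[OF q], rule trajectory_unique[OF u w]) (use agree s in auto)
  then show "observable q u s = observable q w s"
    using u w s by (simp add: observable_apply)
qed

lemma observable_io_analytic:
  assumes q: "polyfun {..<N} q"
  shows "io_analytic U (observable q)"
  unfolding io_analytic_def real_analytic_on_def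
proof (intro allI impI ballI)
  fix l :: nat and \<beta> :: "nat \<Rightarrow> rvec" and a
  assume l: "l > 0" and \<beta>: "\<forall>i<l. \<beta> i \<in> U" and a: "a \<in> {t \<in> rspace l. \<forall>i<l. 0 \<le> t i}"
  define \<tau> where "\<tau> i s = a i + s i" for i and s :: rvec
  have "analytic_germ l 1 (\<bar>a i\<bar> + 1) (\<tau> i)" if "i < l" for i
    unfolding \<tau>_def using that
    by (intro analytic_germ_add analytic_germ_const[OF _ order_refl] analytic_germ_coord) auto
  then have 1: "\<forall>i<l. \<exists>r>0. \<exists>B. analytic_germ l r B (\<tau> i)" using zero_less_one by blast
  have 2: "\<forall>i<l. 0 \<le> \<tau> i (\<lambda>_. 0)" using a unfolding \<tau>_def by simp
  obtain r B X where r: "r > 0" and X: "analytic_germ l r B X"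
    and XE: "\<forall>s. (\<forall>i<l. \<bar>s i\<bar> \<le> r) \<longrightarrow> (\<forall>i<l. 0 \<le> \<tau> i s) \<longrightarrow>
      q (V (pc_input l \<beta> (\<lambda>i. \<tau> i s)) (\<Sum>i<l. \<tau> i s)) = X s"
    using observable_germ[OF q \<beta> l 1 2] by blast
  obtain c where c: "\<And>s. (\<And>i. i < l \<Longrightarrow> \<bar>s i\<bar> \<le> r) \<Longrightarrow>
      ((\<lambda>k. c k * monomial l k s) has_sum X s) (multi_index l)"
    using X by (rule analytic_germE) blast
  show "\<exists>c. \<exists>r>0. \<forall>x\<in>{t \<in> rspace l. \<forall>i<l. 0 \<le> t i}. (\<forall>i<l. \<bar>x i - a i\<bar> < r) \<longrightarrow>
        ((\<lambda>k. c k * monomial l k (\<lambda>i. x i - a i)) has_sum observable q (pc_input l \<beta> x) (\<Sum>i<l. x i)) (multi_index l)"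
  proof (rule exI[of _ c], rule exI[of _ r], rule conjI[OF r], intro ballI impI)
    fix x assume x: "x \<in> {t \<in> rspace l. \<forall>i<l. 0 \<le> t i}" and near: "\<forall>i<l. \<bar>x i - a i\<bar> < r"
    have \<tau>x: "\<tau> i (\<lambda>i. x i - a i) = x i" for i unfolding \<tau>_def by simp
    have near': "\<forall>i<l. \<bar>x i - a i\<bar> \<le> r" using near by (simp add: less_imp_le)
    have "q (V (pc_input l \<beta> x) (\<Sum>i<l. x i)) = X (\<lambda>i. x i - a i)"
      using XE[rule_format, of "\<lambda>i. x i - a i"] near' x unfolding \<tau>x by simp
    moreover have "pc_input l \<beta> x \<in> inputs_pco U" using l \<beta> x by (intro inputs_pco_I) auto
    moreover have "0 \<le> (\<Sum>i<l. x i)" using x by (intro sum_nonneg) auto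
    ultimately have "observable q (pc_input l \<beta> x) (\<Sum>i<l. x i) = X (\<lambda>i. x i - a i)"
      by (simp add: observable_apply)
    then show "((\<lambda>k. c k * monomial l k (\<lambda>i. x i - a i)) has_sum observable q (pc_input l \<beta> x) (\<Sum>i<l. x i)) (multi_index l)"
      using c[of "\<lambda>i. x i - a i"] near' by simp
  qed
qed

lemma observable_in_carrier:
  assumes q: "polyfun {..<N} q"
  shows "observable q \<in> carrier (io_algebra U)"
proof -
  have "(\<lambda>t\<in>{0..}. q (V u t)) \<in> real_pc" if u: "u \<in> inputs_pco U" for u
    unfolding real_pc_def
    using piecewise_continuous_restrict[of "\<lambda>t. q (V u t)", OF polyfun_continuous_on[OF q trajectory_continuous[OF u]]]
    by simp
  then have "observable q \<in> inputs_pco U \<rightarrow>\<^sub>E real_pc" unfolding observable_def by auto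
  then show ?thesis using observable_causal[OF q] observable_io_analytic[OF q] by (simp add: io_algebra_simps)
qed

text \<open>After the switch to \<alpha> at time \<open>t\<close> the state follows the field of
  \<alpha> from \<open>V u t\<close>, so the derivation acts as the Lie derivative, which is again
  polynomial.\<close>

lemma observable_deriv:
  assumes q: "polyfun {..<N} q" and \<alpha>: "\<alpha> \<in> U"
  shows "\<exists>q'. polyfun {..<N} q' \<and> io_deriv U \<alpha> (observable q) = observable q'"
proof -
  obtain q' where q': "polyfun {..<N} q'" and lie: "lie_derivative N (f \<alpha>) q q'"
    using polyfun_lie_derivative[of N "f \<alpha>" q] field[OF \<alpha>] q by blast
  have "vector_derivative (\<lambda>s. observable q (switch_to u t \<alpha>) (t + s)) (at 0 within {0..}) = q' (V u t)"
    if u: "u \<in> inputs_pco U" and t: "0 \<le> t" for u t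
  proof -
    define w where "w = switch_to u t \<alpha>"
    have w: "w \<in> inputs_pco U" unfolding w_def by (rule switch_to_in_inputs_pco[OF u t \<alpha>])
    have "integral_curve N (f \<alpha>) (t + 1 - t) (\<lambda>s. V w (t + s))"
      by (rule trajectory_curve[OF w \<alpha> t]) (use t in \<open>auto simp: w_def switch_to_def\<close>)
    then have "((\<lambda>s. V w (t + s) i) has_real_derivative f \<alpha> i (V w (t + s))) (at s within {0..1})"
      if "i < N" "s \<in> {0..1}" for i s
      using that unfolding integral_curve_def by simp
    from this[of _ 0] have "\<forall>i<N. ((\<lambda>s. V w (t + s) i) has_real_derivative f \<alpha> i (V w (t + 0))) (at 0 within {0..1})"
      by simp
    then have "((\<lambda>s. q (V w (t + s))) has_real_derivative q' (V w (t + 0))) (at 0 within {0..1})"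
      using lie[unfolded lie_derivative_def, rule_format, where \<gamma> = "\<lambda>s. V w (t + s)" and t = 0] by blast
    moreover have "at (0 :: real) within {0..1} = at 0 within {0..}"
      by (rule at_within_nhd[of 0 "{..<1}"]) auto
    ultimately have "((\<lambda>s. q (V w (t + s))) has_real_derivative q' (V w t)) (at 0 within {0..})" by simp
    then have "((\<lambda>s. observable q w (t + s)) has_real_derivative q' (V w t)) (at 0 within {0..})"
      by (rule has_field_derivative_transform_within[where d = 1])
        (use t w in \<open>auto simp: observable_apply\<close>)
    then have "((\<lambda>s. observable q w (t + s)) has_vector_derivative q' (V w t)) (at 0 within {0..})"
      by (simp add: has_real_derivative_iff_has_vector_derivative)
    then have "vector_derivative (\<lambda>s. observable q w (t + s)) (at 0 within {0..}) = q' (V w t)"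
      by (rule vector_derivative_within[rotated]) (simp add: at_within_Ici_at_right)
    \<comment> \<open>The switched input agrees with \<open>u\<close> before \<open>t\<close>, so it
      reaches the same state at \<open>t\<close>.\<close>
    moreover have "q' (V w t) = q' (V u t)"
      by (rule polyfun_cong[OF q'], rule trajectory_unique[OF w u t])
        (auto simp: w_def switch_to_def)
    ultimately show ?thesis unfolding w_def by simp
  qed
  then have "io_deriv U \<alpha> (observable q) = observable q'"
    unfolding io_deriv_def observable_def[of q'] by (auto simp: fun_eq_iff restrict_def)
  then show ?thesis using q' by blast
qed

lemma observable_neg:
  assumes q: "polyfun {..<N} q"
  shows "m_inv (add_monoid (io_algebra U)) (observable q) = observable (\<lambda>x. - q x)"
  by (rule io_algebra_inverse[OF observable_in_carrier[OF q] observable_in_carrier])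
    (auto intro: polyfun_neg q simp: observable_apply)

lemma observables_subring: "subring observables (io_algebra U)"
proof (intro subring.intro subgroup.intro submonoid.intro)
  show "observables \<subseteq> carrier (add_monoid (io_algebra U))"
    using observable_in_carrier unfolding observables_def by auto
  then show "observables \<subseteq> carrier (io_algebra U)" by simp
  show "x \<otimes>\<^bsub>add_monoid (io_algebra U)\<^esub> y \<in> observables" if "x \<in> observables" "y \<in> observables" for x y
    using that unfolding observables_def by (auto simp: observable_simps intro!: imageI polyfun.add)
  show "x \<otimes>\<^bsub>io_algebra U\<^esub> y \<in> observables" if "x \<in> observables" "y \<in> observables" for x y
    using that unfolding observables_def by (auto simp: observable_simps intro!: imageI polyfun.mult)
  show "\<one>\<^bsub>add_monoid (io_algebra U)\<^esub> \<in> observables" "\<one>\<^bsub>io_algebra U\<^esub> \<in> observables"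
    unfolding observables_def by (auto simp: observable_simps intro!: imageI polyfun.const)
  show "m_inv (add_monoid (io_algebra U)) x \<in> observables" if x: "x \<in> observables" for x
  proof -
    obtain q where q: "x = observable q" "polyfun {..<N} q" using x unfolding observables_def by blast
    show ?thesis
      unfolding q(1) observable_neg[OF q(2)] using q(2) unfolding observables_def
      by (intro imageI) (simp add: polyfun_neg)
  qed
qed

text \<open>If a product vanishes and one factor is nonzero at some reachable state,
  \<open>observables_no_zero_divisors\<close> makes the other factor vanish at every reachable
  state. An input value provides a point at which 1 and 0 differ.\<close>

lemma observables_domain:
  assumes "U \<noteq> {}"
  shows "domain (io_algebra U\<lparr>carrier := observables\<rparr>)"
proof (rule domainI)
  let ?R = "io_algebra U\<lparr>carrier := observables\<rparr>"
  note obs = observables_def observable_simps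
  show "cring ?R"
  proof (intro cringI abelian_groupI comm_monoidI)
    show "\<exists>y\<in>carrier ?R. y \<oplus>\<^bsub>?R\<^esub> x = \<zero>\<^bsub>?R\<^esub>" if x: "x \<in> carrier ?R" for x
    proof -
      obtain q where q: "x = observable q" "polyfun {..<N} q" using x by (auto simp: obs)
      show ?thesis
        by (rule bexI[of _ "observable (\<lambda>x. - q x)"])
          (use q in \<open>simp_all add: obs polyfun_neg\<close>)
    qed
  qed (auto simp: obs intro!: imageI polyfun.intros observable_eqI, simp_all add: algebra_simps)
  show "\<one>\<^bsub>?R\<^esub> \<noteq> \<zero>\<^bsub>?R\<^esub>"
    using io_const_inject[OF assms, of 1 0] by (auto simp: io_algebra_simps)
  fix x y assume xy: "x \<otimes>\<^bsub>?R\<^esub> y = \<zero>\<^bsub>?R\<^esub>" "x \<in> carrier ?R" "y \<in> carrier ?R"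
  then obtain a b where a: "x = observable a" "polyfun {..<N} a" and b: "y = observable b" "polyfun {..<N} b"
    by (auto simp: obs)
  have prod: "observable (\<lambda>x. a x * b x) = observable (\<lambda>_. 0)" using xy(1) a b by (simp add: obs)
  have zero: "a (V u t) * b (V u t) = 0" if "u \<in> inputs_pco U" "0 \<le> t" for u t
    using fun_cong[OF fun_cong[OF prod, of u], of t] that by (simp add: observable_apply)
  have "(\<forall>u\<in>inputs_pco U. \<forall>t\<ge>0. a (V u t) = 0) \<or> (\<forall>u\<in>inputs_pco U. \<forall>t\<ge>0. b (V u t) = 0)"
    using observables_no_zero_divisors[OF a(2) b(2) zero] by blast
  then show "x = \<zero>\<^bsub>?R\<^esub> \<or> y = \<zero>\<^bsub>?R\<^esub>"
    unfolding a b by (auto simp: obs intro!: observable_eqI)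
qed

text \<open>\<open>observables\<close> is one of the sets intersected in \<open>obs_algebra\<close>;
  the intersection is therefore a subring of a domain.\<close>

lemma obs_algebra_domain:
  assumes U: "U \<noteq> {}" and p: "\<And>k. k < q \<Longrightarrow> io_component U p k \<in> observables"
  shows "carrier (obs_algebra U q p) \<subseteq> observables" "domain (obs_algebra U q p)"
    "range (io_const U) \<subseteq> carrier (obs_algebra U q p)"
proof -
  let ?R = "io_algebra U\<lparr>carrier := observables\<rparr>"
  let ?F = "{B. subring B (io_algebra U) \<and> range (io_const U) \<subseteq> B \<and>
             (\<forall>k<q. io_component U p k \<in> B) \<and> (\<forall>\<alpha>\<in>U. \<forall>\<phi>\<in>B. io_deriv U \<alpha> \<phi> \<in> B)}"
  let ?H = "\<Inter>?F"
  have obs: "obs_algebra U q p = ?R\<lparr>carrier := ?H\<rparr>" unfolding obs_algebra_def by simp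
  have "observables \<in> ?F"
    using observables_subring p
    by (auto simp: observable_simps observables_def intro!: imageI polyfun.const dest: observable_deriv)
  then have sub: "?H \<subseteq> observables" by blast
  then show "carrier (obs_algebra U q p) \<subseteq> observables" unfolding obs by simp
  show "range (io_const U) \<subseteq> carrier (obs_algebra U q p)" unfolding obs by auto
  interpret R: domain ?R by (rule observables_domain[OF U])
  \<comment> \<open>The two inverses are descriptions over different carriers,
    \<open>observables\<close> and the full one; both evaluate to the observable of the negated
    polynomial.\<close>
  have Rneg: "\<ominus>\<^bsub>?R\<^esub> x = m_inv (add_monoid (io_algebra U)) x" if "x \<in> observables" for x
  proof -
    obtain a where a: "x = observable a" "polyfun {..<N} a" using \<open>x \<in> observables\<close> unfolding observables_def by blast
    have "observable (\<lambda>x. - a x) \<oplus>\<^bsub>?R\<^esub> x = \<zero>\<^bsub>?R\<^esub>"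
      unfolding a by (simp add: observable_simps)
    moreover have "observable (\<lambda>x. - a x) \<in> carrier ?R"
      using a(2) unfolding observables_def by (auto intro!: imageI polyfun_neg)
    ultimately show ?thesis using R.minus_equality[of _ x] \<open>x \<in> observables\<close> observable_neg[OF a(2)] a(1) by simp
  qed
  have "subring ?H ?R"
  proof (rule R.subringI)
    show "?H \<subseteq> carrier ?R" using sub by simp
    show "\<one>\<^bsub>?R\<^esub> \<in> ?H" by (auto dest: submonoid.one_closed[OF subring.axioms(2)])
    show "\<ominus>\<^bsub>?R\<^esub> h \<in> ?H" if h: "h \<in> ?H" for h
    proof
      fix B assume B: "B \<in> ?F"
      then have "subgroup B (add_monoid (io_algebra U))" using subring.axioms(1) by blast
      from subgroup.m_inv_closed[OF this] have "m_inv (add_monoid (io_algebra U)) h \<in> B" using h B by blast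
      then show "\<ominus>\<^bsub>?R\<^esub> h \<in> B" using Rneg h sub by auto
    qed
    show "h1 \<otimes>\<^bsub>?R\<^esub> h2 \<in> ?H" if h: "h1 \<in> ?H" "h2 \<in> ?H" for h1 h2
    proof
      fix B assume B: "B \<in> ?F"
      then have "submonoid B (io_algebra U)" using subring.axioms(2) by blast
      from submonoid.m_closed[OF this] have "h1 \<otimes>\<^bsub>io_algebra U\<^esub> h2 \<in> B" using h B by blast
      then show "h1 \<otimes>\<^bsub>?R\<^esub> h2 \<in> B" by simp
    qed
    show "h1 \<oplus>\<^bsub>?R\<^esub> h2 \<in> ?H" if h: "h1 \<in> ?H" "h2 \<in> ?H" for h1 h2
    proof
      fix B assume B: "B \<in> ?F"
      then have "subgroup B (add_monoid (io_algebra U))" using subring.axioms(1) by blast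
      from subgroup.m_closed[OF this] have "h1 \<otimes>\<^bsub>add_monoid (io_algebra U)\<^esub> h2 \<in> B" using h B by blast
      then show "h1 \<oplus>\<^bsub>?R\<^esub> h2 \<in> B" by simp
    qed
  qed
  then show "domain (obs_algebra U q p)" unfolding obs by (rule R.subring_is_domain)
qed

end

section \<open>Fields of fractions and transcendence degree\<close>

text \<open>A homogeneous linear system with more unknowns \<open>c e\<close> than equations
  \<open>k\<close> has a nontrivial solution: Gaussian elimination of one equation at a
  time.\<close>

lemma linear_dependence:
  fixes a :: "'e \<Rightarrow> 'k \<Rightarrow> real"
  assumes "finite M" "finite E" "card M < card E"
  shows "\<exists>c. (\<exists>e\<in>E. c e \<noteq> 0) \<and> (\<forall>k\<in>M. (\<Sum>e\<in>E. c e * a e k) = 0)"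
  using assms
proof (induction M arbitrary: E a rule: finite_induct)
  case empty
  then have "E \<noteq> {}" by auto
  then show ?case by (intro exI[of _ "\<lambda>_. 1"]) auto
next
  case (insert k M)
  show ?case
  proof (cases "\<forall>e\<in>E. a e k = 0")
    case True
    have "card M < card E" using insert by simp
    from insert.IH[OF insert.prems(1) this, of a]
    obtain c where c: "\<exists>e\<in>E. c e \<noteq> 0" "\<forall>j\<in>M. (\<Sum>e\<in>E. c e * a e j) = 0" by blast
    have "(\<Sum>e\<in>E. c e * a e k) = 0" using True by (intro sum.neutral) auto
    with c show ?thesis by (intro exI[of _ c]) simp
  next
    case False
    then obtain e0 where e0: "e0 \<in> E" "a e0 k \<noteq> 0" by blast
    define E' where "E' = E - {e0}"
    have E': "finite E'" "e0 \<notin> E'" "E = insert e0 E'" using insert.prems e0 unfolding E'_def by auto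
    have "card M < card E'" using insert.prems insert.hyps E' by simp
    \<comment> \<open>The pivot \<open>e0\<close> eliminates its unknown from the remaining
      equations; afterwards \<open>c0\<close> is chosen to solve equation \<open>k\<close>.\<close>
    from insert.IH[OF E'(1) this, of "\<lambda>e j. a e j - a e k / a e0 k * a e0 j"]
    obtain c where c: "\<exists>e\<in>E'. c e \<noteq> 0" "\<forall>j\<in>M. (\<Sum>e\<in>E'. c e * (a e j - a e k / a e0 k * a e0 j)) = 0"
      by blast
    define c0 where "c0 = - (\<Sum>e\<in>E'. c e * a e k) / a e0 k"
    have sum: "(\<Sum>e\<in>E. (if e = e0 then c0 else c e) * a e j) = c0 * a e0 j + (\<Sum>e\<in>E'. c e * a e j)" for j
    proof -
      have "(\<Sum>e\<in>E'. (if e = e0 then c0 else c e) * a e j) = (\<Sum>e\<in>E'. c e * a e j)"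
        using E'(2) by (intro sum.cong) auto
      then show ?thesis unfolding E'(3) using E'(1,2) by simp
    qed
    have "c0 * a e0 j + (\<Sum>e\<in>E'. c e * a e j) = 0" if "j \<in> M" for j
    proof -
      have "(\<Sum>e\<in>E'. c e * a e j) - (\<Sum>e\<in>E'. c e * a e k) / a e0 k * a e0 j = 0"
        using c(2) that
        by (simp add: right_diff_distrib sum_subtractf sum_distrib_right sum_divide_distrib mult.assoc)
      then show ?thesis unfolding c0_def by simp
    qed
    moreover have "c0 * a e0 k + (\<Sum>e\<in>E'. c e * a e k) = 0" unfolding c0_def using e0(2) by simp
    moreover have "\<exists>e\<in>E. (if e = e0 then c0 else c e) \<noteq> 0" using c(1) E' by auto
    ultimately show ?thesis by (intro exI[of _ "\<lambda>e. if e = e0 then c0 else c e"]) (auto simp: sum)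
  qed
qed

section \<open>Arithmetic of fractions over a domain\<close>

context domain
begin

lemma frac_rel_equiv: "equiv (carrier R \<times> (carrier R - {\<zero>})) (frac_rel R)"
proof (rule equivI)
  show "frac_rel R \<subseteq> (carrier R \<times> (carrier R - {\<zero>})) \<times> carrier R \<times> (carrier R - {\<zero>})"
    unfolding frac_rel_def by auto
  show "refl_on (carrier R \<times> (carrier R - {\<zero>})) (frac_rel R)"
    unfolding frac_rel_def refl_on_def by auto
  show "sym (frac_rel R)"
    unfolding frac_rel_def sym_def by auto
  show "trans (frac_rel R)"
    unfolding trans_def
  proof (intro allI impI)
    fix x y z assume xy: "(x, y) \<in> frac_rel R" and yz: "(y, z) \<in> frac_rel R"
    obtain a b c d e f where [simp]: "x = (a, b)" "y = (c, d)" "z = (e, f)"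
      by (cases x, cases y, cases z)
    have in_carrier: "a \<in> carrier R" "b \<in> carrier R" "c \<in> carrier R" "d \<in> carrier R" "e \<in> carrier R" "f \<in> carrier R"
      "b \<noteq> \<zero>" "d \<noteq> \<zero>" "f \<noteq> \<zero>" and eq: "a \<otimes> d = c \<otimes> b" "c \<otimes> f = e \<otimes> d"
      using xy yz unfolding frac_rel_def by auto
    have "d \<otimes> (a \<otimes> f) = (a \<otimes> d) \<otimes> f" using in_carrier by (simp add: m_ac)
    also have "\<dots> = (c \<otimes> f) \<otimes> b" unfolding eq(1) using in_carrier by (simp add: m_ac)
    also have "\<dots> = d \<otimes> (e \<otimes> b)" unfolding eq(2) using in_carrier by (simp add: m_ac)
    finally have "a \<otimes> f = e \<otimes> b" using m_lcancel[of d "a \<otimes> f" "e \<otimes> b"] in_carrier by simp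
    then show "(x, z) \<in> frac_rel R" using in_carrier unfolding frac_rel_def by simp
  qed
qed

lemma frac_eq_iff:
  assumes "a \<in> carrier R" "b \<in> carrier R - {\<zero>}" "c \<in> carrier R" "d \<in> carrier R - {\<zero>}"
  shows "frac R a b = frac R c d \<longleftrightarrow> a \<otimes> d = c \<otimes> b"
proof -
  have "frac R a b = frac R c d \<longleftrightarrow> ((a, b), (c, d)) \<in> frac_rel R"
    unfolding frac_def using assms by (intro eq_equiv_class_iff[OF frac_rel_equiv]) auto
  then show ?thesis using assms unfolding frac_rel_def by simp
qed

lemma frac_mem:
  assumes "(c, d) \<in> frac R a b" "a \<in> carrier R" "b \<in> carrier R - {\<zero>}"
  shows "c \<in> carrier R" "d \<in> carrier R - {\<zero>}" "a \<otimes> d = c \<otimes> b"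
  using assms unfolding frac_def frac_rel_def by auto

lemma frac_self: "a \<in> carrier R \<Longrightarrow> b \<in> carrier R - {\<zero>} \<Longrightarrow> (a, b) \<in> frac R a b"
  unfolding frac_def frac_rel_def by auto

lemma nonzero_mult: "b \<in> carrier R - {\<zero>} \<Longrightarrow> d \<in> carrier R - {\<zero>} \<Longrightarrow> b \<otimes> d \<in> carrier R - {\<zero>}"
  using integral by auto

text \<open>The operations of \<open>frac_field\<close> are unions over all representatives. If the
  resulting class is the same for each of them, the union collapses to that class.\<close>

lemma UN_frac_const:
  assumes "a \<in> carrier R" "b \<in> carrier R - {\<zero>}" "c \<in> carrier R" "d \<in> carrier R - {\<zero>}"
    and const: "\<And>a' b' c' d'. (a', b') \<in> frac R a b \<Longrightarrow> (c', d') \<in> frac R c d \<Longrightarrow> F a' b' c' d' = F a b c d"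
  shows "(\<Union>(a, b)\<in>frac R a b. \<Union>(c, d)\<in>frac R c d. F a b c d) = F a b c d"
proof -
  have inner: "(\<Union>(c', d')\<in>frac R c d. F a' b' c' d') = F a b c d" if ab': "(a', b') \<in> frac R a b" for a' b'
  proof (rule UN_constant_eq[OF frac_self[OF assms(3,4)]], rule ballI)
    fix p assume "p \<in> frac R c d"
    moreover obtain c' d' where "p = (c', d')" by (cases p)
    ultimately show "(case p of (c', d') \<Rightarrow> F a' b' c' d') = F a b c d" using const[OF ab'] by simp
  qed
  show ?thesis
  proof (rule UN_constant_eq[OF frac_self[OF assms(1,2)]], rule ballI)
    fix p assume "p \<in> frac R a b"
    moreover obtain a' b' where "p = (a', b')" by (cases p)
    ultimately show "(case p of (a', b') \<Rightarrow> \<Union>(c', d')\<in>frac R c d. F a' b' c' d') = F a b c d"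
      using inner by simp
  qed
qed

lemma frac_field_mult:
  assumes "a \<in> carrier R" "b \<in> carrier R - {\<zero>}" "c \<in> carrier R" "d \<in> carrier R - {\<zero>}"
  shows "frac R a b \<otimes>\<^bsub>frac_field R\<^esub> frac R c d = frac R (a \<otimes> c) (b \<otimes> d)"
proof -
  have "frac R (a' \<otimes> c') (b' \<otimes> d') = frac R (a \<otimes> c) (b \<otimes> d)"
    if ab': "(a', b') \<in> frac R a b" and cd': "(c', d') \<in> frac R c d" for a' b' c' d'
  proof -
    note x = frac_mem[OF ab' assms(1,2)] and y = frac_mem[OF cd' assms(3,4)]
    have "(a' \<otimes> c') \<otimes> (b \<otimes> d) = (a' \<otimes> b) \<otimes> (c' \<otimes> d)" using x(1,2) y(1,2) assms by (simp add: m_ac)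
    also have "\<dots> = (a \<otimes> b') \<otimes> (c \<otimes> d')" using x(3) y(3) by simp
    also have "\<dots> = (a \<otimes> c) \<otimes> (b' \<otimes> d')" using x(1,2) y(1,2) assms by (simp add: m_ac)
    finally show ?thesis using x(1,2) y(1,2) assms nonzero_mult by (subst frac_eq_iff) auto
  qed
  then show ?thesis unfolding frac_field_def monoid.simps
    by (rule UN_frac_const[OF assms])
qed

lemma frac_field_add:
  assumes "a \<in> carrier R" "b \<in> carrier R - {\<zero>}" "c \<in> carrier R" "d \<in> carrier R - {\<zero>}"
  shows "frac R a b \<oplus>\<^bsub>frac_field R\<^esub> frac R c d = frac R (a \<otimes> d \<oplus> c \<otimes> b) (b \<otimes> d)"
proof -
  have "frac R (a' \<otimes> d' \<oplus> c' \<otimes> b') (b' \<otimes> d') = frac R (a \<otimes> d \<oplus> c \<otimes> b) (b \<otimes> d)"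
    if ab': "(a', b') \<in> frac R a b" and cd': "(c', d') \<in> frac R c d" for a' b' c' d'
  proof -
    note x = frac_mem[OF ab' assms(1,2)] and y = frac_mem[OF cd' assms(3,4)]
    have "(a' \<otimes> d' \<oplus> c' \<otimes> b') \<otimes> (b \<otimes> d) = (a' \<otimes> b) \<otimes> (d' \<otimes> d) \<oplus> (c' \<otimes> d) \<otimes> (b' \<otimes> b)"
      using x(1,2) y(1,2) assms by (simp add: m_ac l_distr r_distr)
    also have "\<dots> = (a \<otimes> b') \<otimes> (d' \<otimes> d) \<oplus> (c \<otimes> d') \<otimes> (b' \<otimes> b)" using x(3) y(3) by simp
    also have "\<dots> = (a \<otimes> d \<oplus> c \<otimes> b) \<otimes> (b' \<otimes> d')"
      using x(1,2) y(1,2) assms by (simp add: m_ac l_distr r_distr)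
    finally show ?thesis using x(1,2) y(1,2) assms nonzero_mult by (subst frac_eq_iff) auto
  qed
  then show ?thesis unfolding frac_field_def ring.simps
    by (rule UN_frac_const[OF assms])
qed

lemma frac_field_carrier: "carrier (frac_field R) = {frac R a b | a b. a \<in> carrier R \<and> b \<in> carrier R - {\<zero>}}"
  unfolding frac_field_def frac_def quotient_def by auto

lemma frac_field_one: "\<one>\<^bsub>frac_field R\<^esub> = frac R \<one> \<one>"
  and frac_field_zero: "\<zero>\<^bsub>frac_field R\<^esub> = frac R \<zero> \<one>"
  unfolding frac_field_def by simp_all

lemma frac_zero: "b \<in> carrier R - {\<zero>} \<Longrightarrow> frac R \<zero> b = frac R \<zero> \<one>"
  by (subst frac_eq_iff) auto

lemma frac_in_carrier: "a \<in> carrier R \<Longrightarrow> b \<in> carrier R - {\<zero>} \<Longrightarrow> frac R a b \<in> carrier (frac_field R)"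
  unfolding frac_field_carrier by blast

lemma frac_field_cring: "cring (frac_field R)"
proof (intro cringI abelian_groupI comm_monoidI)
  let ?F = "frac_field R"
  have rep: "\<exists>a b. x = frac R a b \<and> a \<in> carrier R \<and> b \<in> carrier R - {\<zero>}" if "x \<in> carrier ?F" for x
    using that unfolding frac_field_carrier by blast
  fix x y assume x: "x \<in> carrier ?F" and y: "y \<in> carrier ?F"
  obtain a b where a: "x = frac R a b" "a \<in> carrier R" "b \<in> carrier R - {\<zero>}" using rep[OF x] by blast
  obtain c d where c: "y = frac R c d" "c \<in> carrier R" "d \<in> carrier R - {\<zero>}" using rep[OF y] by blast
  have bd: "b \<otimes> d \<in> carrier R - {\<zero>}" using a c nonzero_mult by blast
  show "x \<oplus>\<^bsub>?F\<^esub> y \<in> carrier ?F" "x \<otimes>\<^bsub>?F\<^esub> y \<in> carrier ?F"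
    using a c bd by (auto simp: frac_field_add frac_field_mult intro!: frac_in_carrier)
  show "x \<oplus>\<^bsub>?F\<^esub> y = y \<oplus>\<^bsub>?F\<^esub> x" "x \<otimes>\<^bsub>?F\<^esub> y = y \<otimes>\<^bsub>?F\<^esub> x"
    using a c by (auto simp: frac_field_add frac_field_mult m_ac a_ac)
  fix z assume z: "z \<in> carrier ?F"
  obtain e f where e: "z = frac R e f" "e \<in> carrier R" "f \<in> carrier R - {\<zero>}" using rep[OF z] by blast
  have df: "d \<otimes> f \<in> carrier R - {\<zero>}" "b \<otimes> f \<in> carrier R - {\<zero>}" "b \<otimes> f \<otimes> (d \<otimes> f) \<in> carrier R - {\<zero>}"
    "b \<otimes> d \<otimes> f \<in> carrier R - {\<zero>}"
    using a c e bd nonzero_mult by blast+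
  show "x \<oplus>\<^bsub>?F\<^esub> y \<oplus>\<^bsub>?F\<^esub> z = x \<oplus>\<^bsub>?F\<^esub> (y \<oplus>\<^bsub>?F\<^esub> z)"
    using a c e bd df by (simp add: frac_field_add) (simp add: m_ac a_ac l_distr r_distr)
  show "x \<otimes>\<^bsub>?F\<^esub> y \<otimes>\<^bsub>?F\<^esub> z = x \<otimes>\<^bsub>?F\<^esub> (y \<otimes>\<^bsub>?F\<^esub> z)"
    using a c e bd df by (simp add: frac_field_mult m_ac)
  show "(x \<oplus>\<^bsub>?F\<^esub> y) \<otimes>\<^bsub>?F\<^esub> z = x \<otimes>\<^bsub>?F\<^esub> z \<oplus>\<^bsub>?F\<^esub> y \<otimes>\<^bsub>?F\<^esub> z"
  proof -
    have "frac R ((a \<otimes> d \<oplus> c \<otimes> b) \<otimes> e) (b \<otimes> d \<otimes> f)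
        = frac R (a \<otimes> e \<otimes> (d \<otimes> f) \<oplus> c \<otimes> e \<otimes> (b \<otimes> f)) (b \<otimes> f \<otimes> (d \<otimes> f))"
      using a c e df by (subst frac_eq_iff) (auto simp: m_ac l_distr r_distr)
    then show ?thesis using a c e bd df by (simp add: frac_field_add frac_field_mult)
  qed
next
  let ?F = "frac_field R"
  have one: "\<one> \<in> carrier R - {\<zero>}" by simp
  show "\<one>\<^bsub>?F\<^esub> \<in> carrier ?F" "\<zero>\<^bsub>?F\<^esub> \<in> carrier ?F"
    unfolding frac_field_one frac_field_zero using one by (auto intro: frac_in_carrier)
  fix x assume x: "x \<in> carrier ?F"
  obtain a b where a: "x = frac R a b" "a \<in> carrier R" "b \<in> carrier R - {\<zero>}"
    using x unfolding frac_field_carrier by blast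
  show "\<zero>\<^bsub>?F\<^esub> \<oplus>\<^bsub>?F\<^esub> x = x" "\<one>\<^bsub>?F\<^esub> \<otimes>\<^bsub>?F\<^esub> x = x"
    using a one by (simp_all add: frac_field_zero frac_field_one frac_field_add frac_field_mult)
  have "frac R (\<ominus> a) b \<oplus>\<^bsub>?F\<^esub> x = frac R \<zero> (b \<otimes> b)"
    using a by (simp add: frac_field_add l_minus l_neg)
  also have "\<dots> = \<zero>\<^bsub>?F\<^esub>"
    unfolding frac_field_zero using a nonzero_mult by (intro frac_zero) blast
  finally show "\<exists>y\<in>carrier ?F. y \<oplus>\<^bsub>?F\<^esub> x = \<zero>\<^bsub>?F\<^esub>"
    using a frac_in_carrier by (intro bexI[of _ "frac R (\<ominus> a) b"]) auto
qed

lemma nonzero_pow: "b \<in> carrier R - {\<zero>} \<Longrightarrow> b [^] (k :: nat) \<in> carrier R - {\<zero>}"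
  by (induction k) (auto simp: integral_iff)

lemma nonzero_finprod:
  "finite S \<Longrightarrow> (\<And>s. s \<in> S \<Longrightarrow> b s \<in> carrier R - {\<zero>}) \<Longrightarrow> (\<Otimes>s\<in>S. b s) \<in> carrier R - {\<zero>}"
proof (induction S rule: finite_induct)
  case (insert x S)
  have "(\<Otimes>s\<in>insert x S. b s) = b x \<otimes> (\<Otimes>s\<in>S. b s)"
    using insert by (intro finprod_insert) auto
  then show ?case using insert nonzero_mult by auto
qed simp

lemma frac_pow:
  assumes "a \<in> carrier R" "b \<in> carrier R - {\<zero>}"
  shows "frac R a b [^]\<^bsub>frac_field R\<^esub> (k :: nat) = frac R (a [^] k) (b [^] k)"
proof -
  interpret F: cring "frac_field R" by (rule frac_field_cring)
  show ?thesis
  proof (induction k)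
    case 0
    show ?case by (simp add: frac_field_one)
  next
    case (Suc k)
    then show ?case using assms nonzero_pow by (simp add: frac_field_mult)
  qed
qed

lemma frac_finprod:
  assumes "finite S" "\<And>s. s \<in> S \<Longrightarrow> a s \<in> carrier R" "\<And>s. s \<in> S \<Longrightarrow> b s \<in> carrier R - {\<zero>}"
  shows "(\<Otimes>\<^bsub>frac_field R\<^esub>s\<in>S. frac R (a s) (b s)) = frac R (\<Otimes>s\<in>S. a s) (\<Otimes>s\<in>S. b s)"
proof -
  interpret F: cring "frac_field R" by (rule frac_field_cring)
  show ?thesis using assms
  proof (induction S rule: finite_induct)
    case empty
    show ?case by (simp add: frac_field_one)
  next
    case (insert x S)
    have "(\<Otimes>\<^bsub>frac_field R\<^esub>s\<in>insert x S. frac R (a s) (b s))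
        = frac R (a x) (b x) \<otimes>\<^bsub>frac_field R\<^esub> (\<Otimes>\<^bsub>frac_field R\<^esub>s\<in>S. frac R (a s) (b s))"
      using insert frac_in_carrier by (intro F.finprod_insert) auto
    also have "\<dots> = frac R (a x) (b x) \<otimes>\<^bsub>frac_field R\<^esub> frac R (\<Otimes>s\<in>S. a s) (\<Otimes>s\<in>S. b s)"
      using insert by simp
    also have "\<dots> = frac R (a x \<otimes> (\<Otimes>s\<in>S. a s)) (b x \<otimes> (\<Otimes>s\<in>S. b s))"
      using insert nonzero_finprod[of S b] by (intro frac_field_mult finprod_closed) auto
    also have "\<dots> = frac R (\<Otimes>s\<in>insert x S. a s) (\<Otimes>s\<in>insert x S. b s)"
      using insert by (subst (1 2) finprod_insert) auto
    finally show ?case .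
  qed
qed

lemma frac_finsum:
  assumes "finite M" "\<And>e. e \<in> M \<Longrightarrow> x e \<in> carrier R" "d \<in> carrier R - {\<zero>}"
  shows "(\<Oplus>\<^bsub>frac_field R\<^esub>e\<in>M. frac R (x e) d) = frac R (\<Oplus>e\<in>M. x e) d"
proof -
  interpret F: cring "frac_field R" by (rule frac_field_cring)
  show ?thesis using assms
  proof (induction M rule: finite_induct)
    case empty
    then show ?case using frac_zero[of d] by (simp add: frac_field_zero)
  next
    case (insert y M)
    have cl: "(\<Oplus>e\<in>M. x e) \<in> carrier R" using insert by (intro finsum_closed) auto
    have "(\<Oplus>\<^bsub>frac_field R\<^esub>e\<in>insert y M. frac R (x e) d)
        = frac R (x y) d \<oplus>\<^bsub>frac_field R\<^esub> (\<Oplus>\<^bsub>frac_field R\<^esub>e\<in>M. frac R (x e) d)"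
      using insert frac_in_carrier by (intro F.finsum_insert) auto
    also have "\<dots> = frac R (x y) d \<oplus>\<^bsub>frac_field R\<^esub> frac R (\<Oplus>e\<in>M. x e) d"
      using insert by simp
    also have "\<dots> = frac R (x y \<otimes> d \<oplus> (\<Oplus>e\<in>M. x e) \<otimes> d) (d \<otimes> d)"
      using insert cl by (intro frac_field_add) auto
    also have "\<dots> = frac R (x y \<oplus> (\<Oplus>e\<in>M. x e)) d"
    proof -
      have "d \<otimes> d \<in> carrier R - {\<zero>}" using insert.prems nonzero_mult by blast
      then show ?thesis using insert cl by (subst frac_eq_iff) (auto simp: l_distr r_distr m_ac)
    qed
    also have "\<dots> = frac R (\<Oplus>e\<in>insert y M. x e) d"
      using insert by (subst finsum_insert) auto
    finally show ?case .
  qed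
qed

text \<open>A relation with cleared denominators: all exponents are at most \<open>T\<close>, so \<open>b\<^sub>s\<^sup>T\<close> clears \<open>s = a\<^sub>s / b\<^sub>s\<close>.\<close>
lemma not_alg_independent:
  fixes T :: nat
  assumes S: "finite S" "\<And>s. s \<in> S \<Longrightarrow> s = frac R (a s) (b s)"
    and ab: "\<And>s. s \<in> S \<Longrightarrow> a s \<in> carrier R" "\<And>s. s \<in> S \<Longrightarrow> b s \<in> carrier R - {\<zero>}"
    and K: "K \<subseteq> carrier R" and c: "\<And>e. e \<in> S \<rightarrow>\<^sub>E {..T} \<Longrightarrow> c e \<in> K" "\<exists>e \<in> S \<rightarrow>\<^sub>E {..T}. c e \<noteq> \<zero>"
    and zero: "(\<Oplus>e\<in>S \<rightarrow>\<^sub>E {..T}. c e \<otimes> (\<Otimes>s\<in>S. a s [^] e s \<otimes> b s [^] (T - e s))) = \<zero>"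
  shows "\<not> alg_independent (frac_field R) ((\<lambda>c. frac R c \<one>) ` K) S"
proof
  interpret F: cring "frac_field R" by (rule frac_field_cring)
  assume ind: "alg_independent (frac_field R) ((\<lambda>c. frac R c \<one>) ` K) S"
  let ?E = "S \<rightarrow>\<^sub>E {..T}"
  have one: "\<one> \<in> carrier R - {\<zero>}" by simp
  have fin: "finite ?E" using S(1) by (intro finite_PiE) auto
  define num where "num e = (\<Otimes>s\<in>S. a s [^] e s \<otimes> b s [^] (T - e s))" for e :: "_ \<Rightarrow> nat"
  define den where "den = (\<Otimes>s\<in>S. b s [^] T)"
  have num: "num e \<in> carrier R" for e
    unfolding num_def using ab by (intro finprod_closed) auto
  have den: "den \<in> carrier R - {\<zero>}"
    unfolding den_def using ab nonzero_pow by (intro nonzero_finprod S) auto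
  have prod: "(\<Otimes>\<^bsub>frac_field R\<^esub>s\<in>S. s [^]\<^bsub>frac_field R\<^esub> e s) = frac R (num e) den" if e: "e \<in> ?E" for e
  proof -
    have pow: "s [^]\<^bsub>frac_field R\<^esub> e s = frac R (a s [^] e s \<otimes> b s [^] (T - e s)) (b s [^] T)" if s: "s \<in> S" for s
    proof -
      have le: "e s \<le> T" using PiE_mem[OF e s] by simp
      have "b s [^] T = b s [^] e s \<otimes> b s [^] (T - e s)"
        using ab(2)[OF s] le by (simp add: nat_pow_mult)
      then have "a s [^] e s \<otimes> b s [^] T = (a s [^] e s \<otimes> b s [^] (T - e s)) \<otimes> b s [^] e s"
        using ab(1)[OF s] ab(2)[OF s] by (simp add: m_ac)
      then have "frac R (a s [^] e s) (b s [^] e s) = frac R (a s [^] e s \<otimes> b s [^] (T - e s)) (b s [^] T)"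
        using ab(1)[OF s] ab(2)[OF s] nonzero_pow by (subst frac_eq_iff) auto
      then show ?thesis using frac_pow[OF ab(1)[OF s] ab(2)[OF s], of "e s"] S(2)[OF s] by simp
    qed
    have "(\<Otimes>\<^bsub>frac_field R\<^esub>s\<in>S. s [^]\<^bsub>frac_field R\<^esub> e s)
        = (\<Otimes>\<^bsub>frac_field R\<^esub>s\<in>S. frac R (a s [^] e s \<otimes> b s [^] (T - e s)) (b s [^] T))"
      using pow ab nonzero_pow by (intro F.finprod_cong' frac_in_carrier Pi_I) auto
    also have "\<dots> = frac R (num e) den"
      unfolding num_def den_def using ab nonzero_pow by (intro frac_finprod S) auto
    finally show ?thesis .
  qed
  have cC: "c e \<in> carrier R" if "e \<in> ?E" for e using c(1)[OF that] K by blast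
  have summand: "frac R (c e) \<one> \<otimes>\<^bsub>frac_field R\<^esub> (\<Otimes>\<^bsub>frac_field R\<^esub>s\<in>S. s [^]\<^bsub>frac_field R\<^esub> e s) = frac R (c e \<otimes> num e) den"
    if e: "e \<in> ?E" for e
    unfolding prod[OF e] using frac_field_mult[OF cC[OF e] one num den] den by simp
  have "(\<Oplus>\<^bsub>frac_field R\<^esub>e\<in>?E. frac R (c e) \<one> \<otimes>\<^bsub>frac_field R\<^esub> (\<Otimes>\<^bsub>frac_field R\<^esub>s\<in>S. s [^]\<^bsub>frac_field R\<^esub> e s))
      = (\<Oplus>\<^bsub>frac_field R\<^esub>e\<in>?E. frac R (c e \<otimes> num e) den)"
    using cC num den by (intro F.finsum_cong' frac_in_carrier Pi_I summand) auto
  also have "\<dots> = frac R (\<Oplus>e\<in>?E. c e \<otimes> num e) den"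
    using cC num by (intro frac_finsum fin den) auto
  also have "\<dots> = \<zero>\<^bsub>frac_field R\<^esub>"
    using zero frac_zero[OF den] unfolding num_def frac_field_zero by simp
  finally have "(\<Oplus>\<^bsub>frac_field R\<^esub>e\<in>?E. frac R (c e) \<one> \<otimes>\<^bsub>frac_field R\<^esub> (\<Otimes>\<^bsub>frac_field R\<^esub>s\<in>S. s [^]\<^bsub>frac_field R\<^esub> e s)) = \<zero>\<^bsub>frac_field R\<^esub>" .
  moreover have "?E \<subseteq> S \<rightarrow>\<^sub>E UNIV" by (intro PiE_mono) auto
  moreover have "(\<lambda>e. frac R (c e) \<one>) \<in> ?E \<rightarrow> (\<lambda>c. frac R c \<one>) ` K" using c(1) by blast
  ultimately have "\<forall>e\<in>?E. frac R (c e) \<one> = \<zero>\<^bsub>frac_field R\<^esub>"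
    using ind fin unfolding alg_independent_def by blast
  then have "c e = \<zero>" if "e \<in> ?E" for e
    using that cC[OF that] frac_eq_iff[OF cC[OF that] one zero_closed one] by (simp add: frac_field_zero)
  then show False using c(2) by blast
qed

end

section \<open>Bounding the transcendence degree of the observation algebra\<close>

lemma obs_algebra_simps:
  "add (obs_algebra U q p) = add (io_algebra U)" "mult (obs_algebra U q p) = mult (io_algebra U)"
  "one (obs_algebra U q p) = one (io_algebra U)" "zero (obs_algebra U q p) = zero (io_algebra U)"
  unfolding obs_algebra_def by simp_all

text \<open>For fixed \<open>D\<close> the left side is of order \<open>T ^ N\<close> and the right
  side of order \<open>T ^ n\<close>, so for large \<open>T\<close> there are more exponent vectors
  than monomials to expand them in.\<close>

lemma count_exponents:
  assumes "N < n"
  shows "\<exists>T. (n * (T * D) + 1) ^ N < (T + 1 :: nat) ^ n"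
proof (rule exI)
  \<comment> \<open>With this \<open>T\<close> the left side is at most
    \<open>(T + 1) ^ N * T\<close>, strictly below \<open>(T + 1) ^ (N + 1)\<close>.\<close>
  let ?T = "(n * D + 1) ^ N"
  have "n * (?T * D) + 1 \<le> (?T + 1) * (n * D + 1)" by (simp add: algebra_simps)
  then have "(n * (?T * D) + 1) ^ N \<le> ((?T + 1) * (n * D + 1)) ^ N" by (rule power_mono) simp
  also have "\<dots> = (?T + 1) ^ N * ?T" by (simp only: power_mult_distrib)
  also have "\<dots> < (?T + 1) ^ N * (?T + 1)" by simp
  also have "\<dots> = (?T + 1) ^ Suc N" by simp
  also have "\<dots> \<le> (?T + 1) ^ n" using assms by (intro power_increasing) auto
  finally show "(n * (?T * D) + 1) ^ N < (?T + 1) ^ n" .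
qed

context polynomial_trajectories
begin

context
  fixes q p
  assumes U: "U \<noteq> {}" and p: "\<And>k. k < q \<Longrightarrow> io_component U p k \<in> observables"
begin

interpretation R: domain "obs_algebra U q p"
  by (rule obs_algebra_domain(2)[OF U p])

lemma obs_pow:
  "a = observable A \<Longrightarrow> a [^]\<^bsub>obs_algebra U q p\<^esub> (k :: nat) = observable (\<lambda>x. A x ^ k)"
  by (induction k) (simp_all add: obs_algebra_simps observable_simps mult.commute)

lemma obs_finprod:
  assumes "finite S" "\<And>s. s \<in> S \<Longrightarrow> g s \<in> carrier (obs_algebra U q p)" "\<And>s. s \<in> S \<Longrightarrow> g s = observable (G s)"
  shows "finprod (obs_algebra U q p) g S = observable (\<lambda>x. \<Prod>s\<in>S. G s x)"
  using assms
proof (induction S rule: finite_induct)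
  case empty
  show ?case by (simp add: obs_algebra_simps observable_simps)
next
  case (insert s S)
  have "finprod (obs_algebra U q p) g (insert s S) = g s \<otimes>\<^bsub>obs_algebra U q p\<^esub> finprod (obs_algebra U q p) g S"
    using insert by (intro R.finprod_insert) auto
  also have "\<dots> = observable (G s) \<otimes>\<^bsub>io_algebra U\<^esub> observable (\<lambda>x. \<Prod>s\<in>S. G s x)"
    using insert by (simp add: obs_algebra_simps)
  finally show ?case using insert.hyps by (simp add: observable_simps)
qed

lemma obs_finsum:
  assumes "finite S" "\<And>s. s \<in> S \<Longrightarrow> g s \<in> carrier (obs_algebra U q p)" "\<And>s. s \<in> S \<Longrightarrow> g s = observable (G s)"
  shows "finsum (obs_algebra U q p) g S = observable (\<lambda>x. \<Sum>s\<in>S. G s x)"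
  using assms
proof (induction S rule: finite_induct)
  case empty
  show ?case by (simp add: obs_algebra_simps observable_simps)
next
  case (insert s S)
  have "finsum (obs_algebra U q p) g (insert s S) = g s \<oplus>\<^bsub>obs_algebra U q p\<^esub> finsum (obs_algebra U q p) g S"
    using insert by (intro R.finsum_insert) auto
  also have "\<dots> = observable (G s) \<oplus>\<^bsub>io_algebra U\<^esub> observable (\<lambda>x. \<Sum>s\<in>S. G s x)"
    using insert by (simp add: obs_algebra_simps)
  finally show ?case using insert.hyps by (simp add: observable_simps)
qed

text \<open>
  The polynomials of degree at most \<open>D\<close> in \<open>N\<close> variables form a space of dimension of order \<open>D\<^sup>N\<close>,
  while \<open>n\<close> elements have of order \<open>T\<^sup>n\<close> monomials of degree at most \<open>T\<close>.
\<close>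
lemma card_alg_independent_le:
  assumes S: "finite S" "S \<subseteq> carrier (frac_field (obs_algebra U q p))"
    and ind: "alg_independent (frac_field (obs_algebra U q p))
      ((\<lambda>c. frac (obs_algebra U q p) c \<one>\<^bsub>obs_algebra U q p\<^esub>) ` range (io_const U)) S"
  shows "card S \<le> N"
proof (rule ccontr)
  let ?R = "obs_algebra U q p"
  assume "\<not> card S \<le> N"
  then have N: "N < card S" by simp
  have "\<forall>s\<in>S. \<exists>a. \<exists>b. s = frac ?R a b \<and> a \<in> carrier ?R \<and> b \<in> carrier ?R - {\<zero>\<^bsub>?R\<^esub>}"
    using S(2) unfolding R.frac_field_carrier by blast
  from bchoice[OF this] obtain a where
    "\<forall>s\<in>S. \<exists>b. s = frac ?R (a s) b \<and> a s \<in> carrier ?R \<and> b \<in> carrier ?R - {\<zero>\<^bsub>?R\<^esub>}" ..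
  from bchoice[OF this] obtain b where
    ab: "\<forall>s\<in>S. s = frac ?R (a s) (b s) \<and> a s \<in> carrier ?R \<and> b s \<in> carrier ?R - {\<zero>\<^bsub>?R\<^esub>}" ..
  have rep: "\<exists>A. polyfun {..<N} A \<and> x = observable A" if "x \<in> carrier ?R" for x
    using obs_algebra_domain(1)[OF U p] that unfolding observables_def by blast
  have "\<forall>s\<in>S. \<exists>A. polyfun {..<N} A \<and> a s = observable A" using ab rep by blast
  from bchoice[OF this] obtain A where A: "\<forall>s\<in>S. polyfun {..<N} (A s) \<and> a s = observable (A s)" ..
  have "\<forall>s\<in>S. \<exists>B. polyfun {..<N} B \<and> b s = observable B" using ab rep by blast
  from bchoice[OF this] obtain B where B: "\<forall>s\<in>S. polyfun {..<N} (B s) \<and> b s = observable (B s)" ..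
  have "\<forall>s\<in>S. \<exists>D. degree_le N D (A s)" using A polyfun_degree_le by blast
  from bchoice[OF this] obtain DA where DA: "\<forall>s\<in>S. degree_le N (DA s) (A s)" ..
  have "\<forall>s\<in>S. \<exists>D. degree_le N D (B s)" using B polyfun_degree_le by blast
  from bchoice[OF this] obtain DB where DB: "\<forall>s\<in>S. degree_le N (DB s) (B s)" ..
  define D where "D = (\<Sum>s\<in>S. DA s + DB s)"
  have D: "degree_le N D (A s)" "degree_le N D (B s)" if s: "s \<in> S" for s
  proof -
    have "DA s + DB s \<le> D" unfolding D_def using s S(1) by (intro member_le_sum) auto
    then have "DA s \<le> D" "DB s \<le> D" by auto
    then show "degree_le N D (A s)" "degree_le N D (B s)"
      using DA DB s by (blast intro: degree_le_mono)+
  qed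
  obtain T where T: "(card S * (T * D) + 1) ^ N < (T + 1) ^ card S" using count_exponents[OF N] by blast
  let ?E = "S \<rightarrow>\<^sub>E {..T}"
  have fin: "finite ?E" using S(1) by (intro finite_PiE) auto
  \<comment> \<open>The numerator, over a common denominator, of the monomial with exponents
    \<open>e\<close>. The exponents of \<open>A s\<close> and \<open>B s\<close> add up to
    \<open>T\<close>, so the degree bound is independent of \<open>e\<close>.\<close>
  define P where "P e x = (\<Prod>s\<in>S. A s x ^ e s * B s x ^ (T - e s))" for e :: "_ \<Rightarrow> nat" and x
  have deg: "degree_le N (card S * (T * D)) (P e)" if e: "e \<in> ?E" for e
    unfolding P_def
  proof (rule degree_le_prod[OF S(1)])
    fix s assume s: "s \<in> S"
    have "e s \<le> T" using PiE_mem[OF e s] by simp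
    then have "e s * D + (T - e s) * D = T * D" by (simp add: add_mult_distrib[symmetric])
    then show "degree_le N (T * D) (\<lambda>x. A s x ^ e s * B s x ^ (T - e s))"
      using degree_le_mult[OF degree_le_power[OF D(1)[OF s], of "e s"] degree_le_power[OF D(2)[OF s], of "T - e s"]]
      by simp
  qed
  let ?M = "exponents N (card S * (T * D))"
  have "\<forall>e\<in>?E. \<exists>co. \<forall>x. P e x = (\<Sum>k\<in>?M. co k * monomial N k x)"
    using deg unfolding degree_le_def by blast
  from bchoice[OF this] obtain co where co: "\<forall>e\<in>?E. \<forall>x. P e x = (\<Sum>k\<in>?M. co e k * monomial N k x)" ..
  \<comment> \<open>There are more numerators than monomials, so their coefficient vectors are
    linearly dependent over the reals. The resulting relation between polynomials passes to the
    observables.\<close>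
  have "card ?M < card ?E"
    using exponents_finite_card(2)[of N "card S * (T * D)"] T S(1) by (simp add: card_PiE)
  from linear_dependence[OF exponents_finite_card(1) fin this, of co]
  obtain c where c: "\<exists>e\<in>?E. c e \<noteq> 0" "\<forall>k\<in>?M. (\<Sum>e\<in>?E. c e * co e k) = 0" by blast
  have relation: "(\<Sum>e\<in>?E. c e * P e x) = 0" for x
  proof -
    have "(\<Sum>e\<in>?E. c e * P e x) = (\<Sum>e\<in>?E. \<Sum>k\<in>?M. c e * co e k * monomial N k x)"
      using co by (intro sum.cong refl) (simp add: sum_distrib_left mult.assoc)
    also have "\<dots> = (\<Sum>k\<in>?M. \<Sum>e\<in>?E. c e * co e k * monomial N k x)" by (rule sum.swap)
    also have "\<dots> = (\<Sum>k\<in>?M. (\<Sum>e\<in>?E. c e * co e k) * monomial N k x)" by (simp add: sum_distrib_right)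
    also have "\<dots> = 0" using c(2) by simp
    finally show ?thesis .
  qed
  have K: "range (io_const U) \<subseteq> carrier ?R" by (rule obs_algebra_domain(3)[OF U p])
  have factor: "a s [^]\<^bsub>?R\<^esub> e s \<otimes>\<^bsub>?R\<^esub> b s [^]\<^bsub>?R\<^esub> (T - e s) = observable (\<lambda>x. A s x ^ e s * B s x ^ (T - e s))"
    if s: "s \<in> S" for s and e :: "_ \<Rightarrow> nat"
    using A B s obs_pow[of "a s" "A s"] obs_pow[of "b s" "B s"] by (simp add: obs_algebra_simps observable_simps)
  have num: "(\<Otimes>\<^bsub>?R\<^esub>s\<in>S. a s [^]\<^bsub>?R\<^esub> e s \<otimes>\<^bsub>?R\<^esub> b s [^]\<^bsub>?R\<^esub> (T - e s)) = observable (P e)" for e :: "_ \<Rightarrow> nat"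
    unfolding P_def using ab by (intro obs_finprod S factor) auto
  have numC: "(\<Otimes>\<^bsub>?R\<^esub>s\<in>S. a s [^]\<^bsub>?R\<^esub> e s \<otimes>\<^bsub>?R\<^esub> b s [^]\<^bsub>?R\<^esub> (T - e s)) \<in> carrier ?R" for e :: "_ \<Rightarrow> nat"
    using ab by (intro R.finprod_closed) auto
  have "(\<Oplus>\<^bsub>?R\<^esub>e\<in>?E. io_const U (c e) \<otimes>\<^bsub>?R\<^esub> (\<Otimes>\<^bsub>?R\<^esub>s\<in>S. a s [^]\<^bsub>?R\<^esub> e s \<otimes>\<^bsub>?R\<^esub> b s [^]\<^bsub>?R\<^esub> (T - e s)))
      = observable (\<lambda>x. \<Sum>e\<in>?E. c e * P e x)"
  proof (rule obs_finsum[OF fin])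
    fix e assume "e \<in> ?E"
    show "io_const U (c e) \<otimes>\<^bsub>?R\<^esub> (\<Otimes>\<^bsub>?R\<^esub>s\<in>S. a s [^]\<^bsub>?R\<^esub> e s \<otimes>\<^bsub>?R\<^esub> b s [^]\<^bsub>?R\<^esub> (T - e s)) \<in> carrier ?R"
      using K numC by (intro R.m_closed) auto
    show "io_const U (c e) \<otimes>\<^bsub>?R\<^esub> (\<Otimes>\<^bsub>?R\<^esub>s\<in>S. a s [^]\<^bsub>?R\<^esub> e s \<otimes>\<^bsub>?R\<^esub> b s [^]\<^bsub>?R\<^esub> (T - e s)) = observable (\<lambda>x. c e * P e x)"
      unfolding num by (simp add: obs_algebra_simps observable_simps)
  qed
  also have "\<dots> = \<zero>\<^bsub>?R\<^esub>" unfolding relation by (simp add: obs_algebra_simps observable_simps)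
  finally have zero: "(\<Oplus>\<^bsub>?R\<^esub>e\<in>?E. io_const U (c e) \<otimes>\<^bsub>?R\<^esub> (\<Otimes>\<^bsub>?R\<^esub>s\<in>S. a s [^]\<^bsub>?R\<^esub> e s \<otimes>\<^bsub>?R\<^esub> b s [^]\<^bsub>?R\<^esub> (T - e s))) = \<zero>\<^bsub>?R\<^esub>" .
  have nonzero: "\<exists>e\<in>?E. io_const U (c e) \<noteq> \<zero>\<^bsub>?R\<^esub>"
    using c(1) io_const_inject[OF U] by (auto simp: obs_algebra_simps io_algebra_simps)
  have "\<not> alg_independent (frac_field ?R) ((\<lambda>c. frac ?R c \<one>\<^bsub>?R\<^esub>) ` range (io_const U)) S"
    by (rule R.not_alg_independent[where c = "\<lambda>e. io_const U (c e)" and T = T and a = a and b = b, OF S(1) _ _ _ K _ nonzero zero])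
      (use ab in auto)
  then show False using ind by blast
qed

lemma trdeg_obs_algebra_le: "trdeg (range (io_const U)) (obs_algebra U q p) \<le> enat N"
  unfolding trdeg_def by (rule SUP_least) (use card_alg_independent_le in auto)

end

end

section \<open>Polynomial embeddings\<close>

lemma activation_deriv:
  "activation \<sigma> \<Longrightarrow> \<exists>P. \<forall>x. (\<sigma> has_real_derivative poly P (\<sigma> x)) (at x)"
  unfolding activation_def C1_omega_def by blast

lemma activation_lipschitz: "activation \<sigma> \<Longrightarrow> \<exists>L. L-lipschitz_on UNIV \<sigma>"
  unfolding activation_def by blast

lemma lipschitz_on_imp_continuous_on_compose:
  fixes g :: "'a :: topological_space \<Rightarrow> real" and \<sigma> :: "real \<Rightarrow> real"
  assumes "L-lipschitz_on UNIV \<sigma>" "continuous_on S g"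
  shows "continuous_on S (\<lambda>x. \<sigma> (g x))"
  by (rule continuous_on_compose2[OF lipschitz_on_continuous_on[OF assms(1)] assms(2)]) simp

text \<open>\<open>Inl\<close> names the coordinates of the given system and \<open>Inr\<close> the adjoined ones.\<close>
lemma polynomial_embedding_adjoin:
  fixes w :: "'j \<Rightarrow> rvec \<Rightarrow> real" and S :: control_system
  defines "env \<equiv> \<lambda>x. case_sum x (\<lambda>j. w j x)"
  assumes S: "sdim S = n" "init S \<in> rspace n" "out S = mat_vec q n C" and J: "finite J"
    and cont: "\<And>j. j \<in> J \<Longrightarrow> continuous_on UNIV (w j)"
    and ac: "\<And>j x T. j \<in> J \<Longrightarrow> (\<And>i. i < n \<Longrightarrow> abs_continuous_on 0 T (\<lambda>t. x t i)) \<Longrightarrow> abs_continuous_on 0 T (\<lambda>t. w j (x t))"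
    and polyd: "\<And>\<alpha> i. \<alpha> \<in> U \<Longrightarrow> i < n \<Longrightarrow> polyfun (Inl ` {..<n} \<union> Inr ` J) (Qd \<alpha> i)"
    and polyw: "\<And>\<alpha> j. \<alpha> \<in> U \<Longrightarrow> j \<in> J \<Longrightarrow> polyfun (Inl ` {..<n} \<union> Inr ` J) (Qw \<alpha> j)"
    and dyn: "\<And>\<alpha> i x. \<alpha> \<in> U \<Longrightarrow> i < n \<Longrightarrow> dyn S x \<alpha> i = Qd \<alpha> i (env x)"
    and der: "\<And>\<alpha> j \<gamma> t X. \<alpha> \<in> U \<Longrightarrow> j \<in> J \<Longrightarrow>
      (\<And>i. i < n \<Longrightarrow> ((\<lambda>\<tau>. \<gamma> \<tau> i) has_real_derivative Qd \<alpha> i (env (\<gamma> t))) (at t within X)) \<Longrightarrow>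
      ((\<lambda>\<tau>. w j (\<gamma> \<tau>)) has_real_derivative Qw \<alpha> j (env (\<gamma> t))) (at t within X)"
  shows "\<exists>P. polynomial_embedding U q P S"
proof -
  let ?I = "Inl ` {..<n} \<union> Inr ` J :: (nat + 'j) set"
  define m where "m = card J"
  obtain h where h: "bij_betw h J {0..<m}" using ex_bij_betw_finite_nat[OF J] unfolding m_def by blast
  define g where "g = inv_into J h"
  have gJ: "g k \<in> J" if "k < m" for k
    using bij_betw_inv_into[OF h] that unfolding g_def bij_betw_def by auto
  have gh: "g (h j) = j" if "j \<in> J" for j
    using h that unfolding g_def bij_betw_def by simp
  have hm: "h j < m" if "j \<in> J" for j using h that unfolding bij_betw_def by auto
  \<comment> \<open>The adjoined values are appended to the state. The original coordinates survive,
    which makes \<open>F\<close> injective and lets the output matrix \<open>C\<close> be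
    reused.\<close>
  define F where "F x = (\<lambda>k. if k < n then x k else if k < n + m then w (g (k - n)) x else 0)" for x :: rvec
  \<comment> \<open>Turns the numbered vector back into an assignment of values to names. It matches
    \<open>env\<close> only on the names in use, which is enough by
    \<open>polyfun_cong\<close>.\<close>
  define dec where "dec v = case_sum v (\<lambda>j. v (n + h j))" for v :: rvec
  have dec: "dec (F x) i = env x i" if "i \<in> ?I" for x i
    using that hm gh by (auto simp: dec_def F_def env_def)
  define P where "P = \<lparr>sdim = n + m,
    dyn = (\<lambda>v \<alpha> k. if k < n then Qd \<alpha> k (dec v) else if k < n + m then Qw \<alpha> (g (k - n)) (dec v) else 0),
    out = mat_vec q n C, init = F (init S)\<rparr>"
  have Fr: "F x \<in> rspace (n + m)" for x
    by (auto simp: F_def topspace_Euclidean_space)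
  have polydec: "polyfun {..<n + m} (\<lambda>v. Q (dec v))" if "polyfun ?I Q" for Q
  proof -
    have "polyfun {..<n + m} (\<lambda>v. Q (\<lambda>i. dec v i))"
      using that by (rule polyfun_subst) (use hm in \<open>auto simp: dec_def intro!: polyfun.coord\<close>)
    then show ?thesis by simp
  qed
  have system: "polynomial_system U q P"
    unfolding polynomial_system_def
  proof (intro conjI ballI allI impI)
    show "init P \<in> rspace (sdim P)" by (simp add: P_def Fr)
    show "dyn P v \<alpha> \<in> rspace (sdim P)" for v \<alpha>
      by (auto simp: P_def topspace_Euclidean_space)
    show "polynomial_on_rspace (sdim P) (\<lambda>v. dyn P v \<alpha> i)" if "\<alpha> \<in> U" "i < sdim P" for \<alpha> i
    proof (cases "i < n")
      case True
      then show ?thesis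
        using polyfun_imp_polynomial_on_rspace[OF polydec[OF polyd[OF \<open>\<alpha> \<in> U\<close> True]]] by (simp add: P_def)
    next
      case False
      then have "g (i - n) \<in> J" using that(2) gJ by (simp add: P_def)
      from polyfun_imp_polynomial_on_rspace[OF polydec[OF polyw[OF \<open>\<alpha> \<in> U\<close> this]]] show ?thesis
        using False that(2) by (simp add: P_def)
    qed
    show "out P v \<in> rspace q" for v by (auto simp: P_def mat_vec_def topspace_Euclidean_space)
    show "polynomial_on_rspace (sdim P) (\<lambda>v. out P v k)" if "k < q" for k
    proof -
      have "polyfun {..<n + m} (\<lambda>v. \<Sum>j<n. C k j * v j)"
        by (intro polyfun_sum polyfun.mult polyfun.const polyfun.coord) auto
      from polyfun_imp_polynomial_on_rspace[OF this] show ?thesis using that by (simp add: P_def mat_vec_def)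
    qed
  qed
  have Fcont: "continuous_map (Euclidean_space n) (Euclidean_space (n + m)) F"
  proof -
    \<comment> \<open>Continuity is shown in the product topology on all sequences, of which
      \<open>Euclidean_space\<close> is a subspace.\<close>
    have "continuous_on UNIV (\<lambda>x. F x k)" for k
      using cont gJ unfolding F_def
      by (cases "k < n"; cases "k < n + m") (auto intro: continuous_on_product_coordinates)
    then have "continuous_map (powertop_real UNIV) euclideanreal (\<lambda>x. F x k)" for k
      unfolding euclidean_product_topology by simp
    then have "continuous_map (powertop_real UNIV) (powertop_real UNIV) F"
      by (simp add: continuous_map_componentwise_UNIV)
    then have "continuous_map (Euclidean_space n) (powertop_real UNIV) F"
      unfolding Euclidean_space_def by (rule continuous_map_from_subtopology)
    then show ?thesis
      unfolding Euclidean_space_def[of "n + m"]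
      by (rule continuous_map_into_subtopology) (auto simp: F_def)
  qed
  have Finj: "inj_on F (rspace n)"
  proof (rule inj_onI, rule ext)
    fix x y k assume xy: "x \<in> rspace n" "y \<in> rspace n" and eq: "F x = F y"
    have "F x k = F y k" by (simp only: eq)
    then show "x k = y k"
      using xy by (cases "k < n") (simp_all add: F_def topspace_Euclidean_space)
  qed
  have "solution U q P (\<lambda>t\<in>{0..}. F (x t)) u y" if sol: "solution U q S x u y" for x u y
  proof -
    have x: "x \<in> space_ac n" "x 0 = init S" and u: "u \<in> inputs_pco U" and y: "y \<in> space_pc q"
      and ode: "AE t in lebesgue. 0 \<le> t \<longrightarrow>
        (\<forall>i<n. ((\<lambda>\<tau>. x \<tau> i) has_real_derivative dyn S (x t) (u t) i) (at t within {0..}))"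
      and out: "\<And>t. t \<ge> 0 \<Longrightarrow> y t = mat_vec q n C (x t)"
      using sol S unfolding solution_def by auto
    have acx: "abs_continuous_on 0 T (\<lambda>t. F (x t) k)" if "k < n + m" "T \<ge> 0" for k T
    proof (cases "k < n")
      case True
      then show ?thesis using x(1) that by (simp add: space_ac_def F_def)
    next
      case False
      then have "g (k - n) \<in> J" using that gJ by simp
      from ac[OF this, of T x] show ?thesis using x(1) that False by (simp add: space_ac_def F_def)
    qed
    show ?thesis
      unfolding solution_def
    proof (intro conjI allI impI u y)
      show "(\<lambda>t\<in>{0..}. F (x t)) \<in> space_ac (sdim P)"
        unfolding space_ac_def
      proof (intro CollectI conjI allI impI)
        show "(\<lambda>t\<in>{0..}. F (x t)) \<in> {0..} \<rightarrow>\<^sub>E rspace (sdim P)" using Fr by (simp add: P_def)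
        fix k T assume k: "k < sdim P" and T: "(T :: real) \<ge> 0"
        show "abs_continuous_on 0 T (\<lambda>t. (\<lambda>t\<in>{0..}. F (x t)) t k)"
          by (rule abs_continuous_on_cong[OF _ acx[OF _ T]]) (use k in \<open>auto simp: P_def\<close>)
      qed
      show "(\<lambda>t\<in>{0..}. F (x t)) 0 = init P" using x(2) by (simp add: P_def)
      show "y t = out P ((\<lambda>t\<in>{0..}. F (x t)) t)" if "t \<ge> 0" for t
        using out[OF that] that by (simp add: P_def mat_vec_def F_def fun_eq_iff)
      show "AE t in lebesgue. 0 \<le> t \<longrightarrow> (\<forall>k<sdim P. ((\<lambda>\<tau>. (\<lambda>t\<in>{0..}. F (x t)) \<tau> k) has_real_derivative
          dyn P ((\<lambda>t\<in>{0..}. F (x t)) t) (u t) k) (at t within {0..}))"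
        using ode
      proof (rule eventually_mono, intro impI allI)
        fix t k
        assume "0 \<le> t \<longrightarrow> (\<forall>i<n. ((\<lambda>\<tau>. x \<tau> i) has_real_derivative dyn S (x t) (u t) i) (at t within {0..}))"
          and t: "0 \<le> t" and k: "k < sdim P"
        moreover have ut: "u t \<in> U" by (rule inputs_pco_right_constant(1)[OF u t])
        ultimately have "((\<lambda>\<tau>. x \<tau> i) has_real_derivative dyn S (x t) (u t) i) (at t within {0..})" if "i < n" for i
          using that by blast
        then have d: "((\<lambda>\<tau>. x \<tau> i) has_real_derivative Qd (u t) i (env (x t))) (at t within {0..})" if "i < n" for i
          unfolding dyn[OF ut that, symmetric] using that by blast
        have "((\<lambda>\<tau>. F (x \<tau>) k) has_real_derivative dyn P (F (x t)) (u t) k) (at t within {0..})"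
        proof (cases "k < n")
          case True
          have "Qd (u t) k (dec (F (x t))) = Qd (u t) k (env (x t))"
            by (rule polyfun_cong[OF polyd[OF ut True] dec])
          then show ?thesis using d[OF True] True by (simp add: P_def F_def)
        next
          case False
          then have gk: "g (k - n) \<in> J" using k gJ by (simp add: P_def)
          have "Qw (u t) (g (k - n)) (dec (F (x t))) = Qw (u t) (g (k - n)) (env (x t))"
            by (rule polyfun_cong[OF polyw[OF ut gk] dec])
          then show ?thesis using der[OF ut gk d] False k by (simp add: P_def F_def)
        qed
        then have "((\<lambda>\<tau>. (\<lambda>t\<in>{0..}. F (x t)) \<tau> k) has_real_derivative dyn P (F (x t)) (u t) k) (at t within {0..})"
          by (rule has_field_derivative_transform_within[where d = 1]) (use t in auto)
        then show "((\<lambda>\<tau>. (\<lambda>t\<in>{0..}. F (x t)) \<tau> k) has_real_derivative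
            dyn P ((\<lambda>t\<in>{0..}. F (x t)) t) (u t) k) (at t within {0..})"
          using t by simp
      qed
    qed
  qed
  then have "polynomial_embedding U q P S"
    unfolding polynomial_embedding_def using system Fcont Finj S(1) by (auto simp: P_def)
  then show ?thesis by blast
qed

text \<open>The adjoined coordinate named \<open>(\<alpha>, i)\<close> is the \<open>i\<close>-th
  velocity under input \<alpha>, so the original equations become linear. Its own derivative is
  \<sigma>', a polynomial in that coordinate, times a linear combination of velocities.\<close>

lemma ode_rnn_polynomial_embedding:
  assumes U: "finite U" and S: "S \<in> ode_rnn m q"
  shows "\<exists>P. polynomial_embedding U q P S"
proof -
  obtain n \<sigma> A B C x0 where Seq: "S = \<lparr>sdim = n,
       dyn = (\<lambda>x u i. if i < n then \<sigma> (mat_vec n n A x i + mat_vec n m B u i) else 0),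
       out = mat_vec q n C, init = x0\<rparr>" and act: "activation \<sigma>" and x0: "x0 \<in> rspace n"
    using S unfolding ode_rnn_def by blast
  obtain P L where P: "\<And>x. (\<sigma> has_real_derivative poly P (\<sigma> x)) (at x)" and L: "L-lipschitz_on UNIV \<sigma>"
    using activation_deriv[OF act] activation_lipschitz[OF act] by blast
  define w where "w j x = \<sigma> ((\<Sum>k<n. A (snd j) k * x k) + mat_vec n m B (fst j) (snd j))" for j :: "rvec \<times> nat" and x :: rvec
  define Qd where "Qd \<alpha> i e = e (Inr (\<alpha>, i))" for \<alpha> :: rvec and i :: nat and e :: "nat + rvec \<times> nat \<Rightarrow> real"
  define Qw where "Qw \<beta> j e = poly P (e (Inr j)) * (\<Sum>k<n. A (snd j) k * Qd \<beta> k e)" for \<beta> and j :: "rvec \<times> nat" and e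
  let ?J = "U \<times> {..<n}"
  show ?thesis
  proof (rule polynomial_embedding_adjoin[where J = ?J and w = w and Qd = Qd and Qw = Qw and n = n and C = C])
    show "sdim S = n" "init S \<in> rspace n" "out S = mat_vec q n C" using x0 by (simp_all add: Seq)
    show "finite ?J" using U by simp
    show "continuous_on UNIV (w j)" for j
      unfolding w_def
      by (intro lipschitz_on_imp_continuous_on_compose[OF L] continuous_intros continuous_on_product_coordinates)
    show "abs_continuous_on 0 T (\<lambda>t. w j (x t))" if "\<And>i. i < n \<Longrightarrow> abs_continuous_on 0 T (\<lambda>t. x t i)" for j x T
      unfolding w_def
      by (intro abs_continuous_on_lipschitz[OF _ L] abs_continuous_on_add abs_continuous_on_sum
          abs_continuous_on_cmult abs_continuous_on_const that) auto
    show polyd: "polyfun (Inl ` {..<n} \<union> Inr ` ?J) (Qd \<alpha> i)" if "\<alpha> \<in> U" "i < n" for \<alpha> i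
      unfolding Qd_def using that by (intro polyfun.coord) auto
    show "polyfun (Inl ` {..<n} \<union> Inr ` ?J) (Qw \<alpha> j)" if "\<alpha> \<in> U" "j \<in> ?J" for \<alpha> j
      unfolding Qw_def using that
      by (intro polyfun.mult polyfun_poly polyfun_sum polyfun.const polyd polyfun.coord) auto
    show "dyn S x \<alpha> i = Qd \<alpha> i (case_sum x (\<lambda>j. w j x))" if "\<alpha> \<in> U" "i < n" for \<alpha> i x
      using that by (simp add: Seq Qd_def w_def mat_vec_def)
    show "((\<lambda>\<tau>. w j (\<gamma> \<tau>)) has_real_derivative Qw \<alpha> j (case_sum (\<gamma> t) (\<lambda>j. w j (\<gamma> t)))) (at t within X)"
      if d: "\<And>i. i < n \<Longrightarrow> ((\<lambda>\<tau>. \<gamma> \<tau> i) has_real_derivative Qd \<alpha> i (case_sum (\<gamma> t) (\<lambda>j. w j (\<gamma> t)))) (at t within X)"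
      for \<alpha> j \<gamma> t X
    proof -
      let ?e = "case_sum (\<gamma> t) (\<lambda>j. w j (\<gamma> t))"
      have "((\<lambda>\<tau>. (\<Sum>k<n. A (snd j) k * \<gamma> \<tau> k) + mat_vec n m B (fst j) (snd j))
          has_real_derivative (\<Sum>k<n. A (snd j) k * Qd \<alpha> k ?e) + 0) (at t within X)"
        by (intro DERIV_add DERIV_sum DERIV_cmult DERIV_const d) simp
      from DERIV_chain2[OF P this] show ?thesis unfolding w_def Qw_def by simp
    qed
  qed
qed

text \<open>The outer activations \<open>\<sigma> 5 (s i)\<close> and the four gates, frozen at each
  input value, are adjoined. The hidden state is a product of available coordinates, so its
  derivative is polynomial as well, and every gate closes up through its equation
  \<open>\<sigma>' = P(\<sigma>)\<close>.\<close>

lemma ode_lstm_polynomial_embedding: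
  assumes U: "finite U" and S: "S \<in> ode_lstm m q"
  shows "\<exists>P. polynomial_embedding U q P S"
proof -
  obtain n \<sigma> V W b C s0 where Seq: "S = \<lparr>sdim = 2 * n, dyn = lstm_dyn n m \<sigma> V W b,
       out = mat_vec q (2 * n) C, init = s0\<rparr>"
    and act: "\<forall>k\<in>{1..5}. activation (\<sigma> k)" and s0: "s0 \<in> rspace (2 * n)"
    using S unfolding ode_lstm_def by blast
  have "\<forall>k\<in>{1..5}. \<exists>P. \<forall>x. (\<sigma> k has_real_derivative poly P (\<sigma> k x)) (at x)"
    using act activation_deriv by blast
  from bchoice[OF this] obtain P
    where P: "\<forall>k\<in>{1..5}. \<forall>x. (\<sigma> k has_real_derivative poly (P k) (\<sigma> k x)) (at x)" ..
  have "\<forall>k\<in>{1..5}. \<exists>L. L-lipschitz_on UNIV (\<sigma> k)" using act activation_lipschitz by blast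
  from bchoice[OF this] obtain L where L: "\<forall>k\<in>{1..5}. (L k)-lipschitz_on UNIV (\<sigma> k)" ..
  let ?J = "{..<n} <+> {1..4 :: nat} \<times> U \<times> {..<n}"
  let ?I = "Inl ` {..<2 * n} \<union> Inr ` ?J :: (nat + nat + nat \<times> rvec \<times> nat) set"
  define gate where "gate k \<alpha> i s = \<sigma> k ((\<Sum>j<n. V k i j * (s (n + j) * \<sigma> 5 (s j))) + (mat_vec n m (W k) \<alpha> i + b k i))"
    for k \<alpha> i and s :: rvec
  have gate: "lstm_gate n m \<sigma> V W b k s \<alpha> i = gate k \<alpha> i s" if "i < n" for k s \<alpha> i
    using that by (simp add: lstm_gate_def gate_def Let_def mat_vec_def add.assoc)
  define w where "w = case_sum (\<lambda>i s. \<sigma> 5 (s i)) (\<lambda>(k, \<alpha>, i). gate k \<alpha> i)"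
  define G where "G k \<alpha> i e = e (Inr (Inr (k, \<alpha>, i)))" for k i :: nat and \<alpha> :: rvec and e :: "nat + nat + nat \<times> rvec \<times> nat \<Rightarrow> real"
  define Qd where "Qd \<beta> i e = (if i < n then (\<Sum>j<n. V 0 i j * e (Inl j)) + G 2 \<beta> i e * e (Inl i) + G 3 \<beta> i e * G 1 \<beta> i e
      else G 4 \<beta> (i - n) e)" for \<beta> i e
  \<comment> \<open>The product rule for the hidden state
    \<open>s (n + j) * \<sigma> 5 (s j)\<close>.\<close>
  define Qh where "Qh \<beta> j e = Qd \<beta> (n + j) e * e (Inr (Inl j)) + poly (P 5) (e (Inr (Inl j))) * Qd \<beta> j e * e (Inl (n + j))"
    for \<beta> j e
  \<comment> \<open>\<open>\<beta>\<close> is the acting input, which drives the hidden state;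
    \<open>\<alpha>\<close> is the input frozen inside the adjoined gate.\<close>
  define Qw where "Qw \<beta> = case_sum (\<lambda>i e. poly (P 5) (e (Inr (Inl i))) * Qd \<beta> i e)
    (\<lambda>(k, \<alpha>, i) e. poly (P k) (G k \<alpha> i e) * (\<Sum>j<n. V k i j * Qh \<beta> j e))" for \<beta>
  have polyG: "polyfun ?I (G k \<alpha> i)" if "k \<in> {1..4}" "\<alpha> \<in> U" "i < n" for k \<alpha> i
    unfolding G_def using that by (intro polyfun.coord) auto
  have polyd: "polyfun ?I (Qd \<alpha> i)" if \<alpha>: "\<alpha> \<in> U" and i: "i < 2 * n" for \<alpha> i
  proof (cases "i < n")
    case True
    have "polyfun ?I (\<lambda>e. (\<Sum>j<n. V 0 i j * e (Inl j)) + G 2 \<alpha> i e * e (Inl i) + G 3 \<alpha> i e * G 1 \<alpha> i e)"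
      using \<alpha> True by (intro polyfun.add polyfun.mult polyfun_sum polyfun.const polyG polyfun.coord) auto
    then show ?thesis using True unfolding Qd_def by simp
  next
    case False
    have "polyfun ?I (G 4 \<alpha> (i - n))" using \<alpha> i False by (intro polyG) auto
    then show ?thesis using False unfolding Qd_def by simp
  qed
  have polyh: "polyfun ?I (Qh \<alpha> j)" if "\<alpha> \<in> U" "j < n" for \<alpha> j
    unfolding Qh_def using that
    by (intro polyfun.add polyfun.mult polyfun_poly polyd polyfun.coord) auto
  show ?thesis
  proof (rule polynomial_embedding_adjoin[where J = ?J and w = w and Qd = Qd and Qw = Qw and n = "2 * n" and C = C])
    show "sdim S = 2 * n" "init S \<in> rspace (2 * n)" "out S = mat_vec q (2 * n) C" using s0 by (simp_all add: Seq)
    show "finite ?J" using U by simp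
    show "continuous_on UNIV (w j)" if "j \<in> ?J" for j
    proof -
      have L5: "(L 5)-lipschitz_on UNIV (\<sigma> 5)" using L by auto
      have five: "continuous_on UNIV (\<lambda>s :: rvec. \<sigma> 5 (s i))" for i
        by (intro lipschitz_on_imp_continuous_on_compose[OF L5] continuous_on_product_coordinates)
      have "continuous_on UNIV (gate k \<alpha> i)" if k: "k \<in> {1..4}" for k \<alpha> i
      proof -
        have Lk: "(L k)-lipschitz_on UNIV (\<sigma> k)" using L k by auto
        show ?thesis
          unfolding gate_def[abs_def]
          by (intro lipschitz_on_imp_continuous_on_compose[OF Lk] continuous_on_add continuous_on_sum
              continuous_on_mult continuous_on_const continuous_on_product_coordinates five)
      qed
      then show ?thesis using that five unfolding w_def by auto
    qed
    show "abs_continuous_on 0 T (\<lambda>t. w j (x t))"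
      if j: "j \<in> ?J" and ac: "\<And>i. i < 2 * n \<Longrightarrow> abs_continuous_on 0 T (\<lambda>t. x t i)" for j x T
    proof -
      have L5: "(L 5)-lipschitz_on UNIV (\<sigma> 5)" using L by auto
      have five: "abs_continuous_on 0 T (\<lambda>t. \<sigma> 5 (x t i))" if "i < n" for i
        using that by (intro abs_continuous_on_lipschitz[OF _ L5] ac) simp
      have "abs_continuous_on 0 T (\<lambda>t. gate k \<alpha> i (x t))" if k: "k \<in> {1..4}" for k \<alpha> i
      proof -
        have Lk: "(L k)-lipschitz_on UNIV (\<sigma> k)" using L k by auto
        show ?thesis
          unfolding gate_def
          by (intro abs_continuous_on_lipschitz[OF _ Lk] abs_continuous_on_add abs_continuous_on_sum
              abs_continuous_on_cmult abs_continuous_on_mult abs_continuous_on_const ac five) auto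
      qed
      then show ?thesis using j five unfolding w_def by auto
    qed
    show "polyfun ?I (Qd \<alpha> i)" if "\<alpha> \<in> U" "i < 2 * n" for \<alpha> i by (rule polyd[OF that])
    show "polyfun ?I (Qw \<alpha> j)" if \<alpha>: "\<alpha> \<in> U" and j: "j \<in> ?J" for \<alpha> j
    proof -
      have "polyfun ?I (\<lambda>e. poly (P 5) (e (Inr (Inl i))) * Qd \<alpha> i e)" if "i < n" for i
        using \<alpha> that by (intro polyfun.mult polyfun_poly polyd polyfun.coord) auto
      moreover have "polyfun ?I (\<lambda>e. poly (P k) (G k \<beta> i e) * (\<Sum>j<n. V k i j * Qh \<alpha> j e))"
        if "k \<in> {1..4}" "\<beta> \<in> U" "i < n" for k \<beta> i
        using \<alpha> that by (intro polyfun.mult polyfun_poly polyfun_sum polyfun.const polyG polyh) auto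
      ultimately show ?thesis using j unfolding Qw_def by auto
    qed
    show "dyn S s \<alpha> i = Qd \<alpha> i (case_sum s (\<lambda>j. w j s))" if "\<alpha> \<in> U" "i < 2 * n" for \<alpha> i s
      using that by (auto simp: Seq lstm_dyn_def Let_def gate Qd_def G_def w_def mat_vec_def)
    show "((\<lambda>\<tau>. w j (\<gamma> \<tau>)) has_real_derivative Qw \<alpha> j (case_sum (\<gamma> t) (\<lambda>j. w j (\<gamma> t)))) (at t within X)"
      if \<alpha>: "\<alpha> \<in> U" and j: "j \<in> ?J"
      and d: "\<And>i. i < 2 * n \<Longrightarrow> ((\<lambda>\<tau>. \<gamma> \<tau> i) has_real_derivative Qd \<alpha> i (case_sum (\<gamma> t) (\<lambda>j. w j (\<gamma> t)))) (at t within X)"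
      for \<alpha> j \<gamma> t X
    proof -
      define e where "e = case_sum (\<gamma> t) (\<lambda>j. w j (\<gamma> t))"
      have e: "e (Inl i) = \<gamma> t i" "e (Inr (Inl i)) = \<sigma> 5 (\<gamma> t i)" "G k \<beta> i e = gate k \<beta> i (\<gamma> t)" for i k \<beta>
        by (simp_all add: e_def w_def G_def)
      have d': "((\<lambda>\<tau>. \<gamma> \<tau> i) has_real_derivative Qd \<alpha> i e) (at t within X)" if "i < 2 * n" for i
        using d[OF that] unfolding e_def .
      have P': "(\<sigma> k has_real_derivative poly (P k) (\<sigma> k x)) (at x)" if "k \<in> {1..5}" for k x
        using P that by blast
      have five: "((\<lambda>\<tau>. \<sigma> 5 (\<gamma> \<tau> i)) has_real_derivative poly (P 5) (e (Inr (Inl i))) * Qd \<alpha> i e) (at t within X)"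
        if "i < n" for i
        unfolding e by (rule DERIV_chain2[OF P']) (use d' that in auto)
      have hidden: "((\<lambda>\<tau>. \<gamma> \<tau> (n + i) * \<sigma> 5 (\<gamma> \<tau> i)) has_real_derivative Qh \<alpha> i e) (at t within X)"
        if i: "i < n" for i
        using DERIV_mult[OF d' five[OF i], of "n + i"] i unfolding Qh_def e by simp
      have "((\<lambda>\<tau>. gate k \<beta> i (\<gamma> \<tau>)) has_real_derivative
          poly (P k) (G k \<beta> i e) * (\<Sum>j<n. V k i j * Qh \<alpha> j e)) (at t within X)"
        if k: "k \<in> {1..4}" for k \<beta> i
      proof -
        have "((\<lambda>\<tau>. (\<Sum>j<n. V k i j * (\<gamma> \<tau> (n + j) * \<sigma> 5 (\<gamma> \<tau> j))) + (mat_vec n m (W k) \<beta> i + b k i))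
            has_real_derivative (\<Sum>j<n. V k i j * Qh \<alpha> j e) + 0) (at t within X)"
          by (intro DERIV_add DERIV_sum DERIV_cmult DERIV_const hidden) simp
        from DERIV_chain2[OF P' this, of k] k show ?thesis unfolding e gate_def by simp
      qed
      moreover have "w (Inl i) = (\<lambda>s. \<sigma> 5 (s i))" "w (Inr (k, \<beta>, i)) = gate k \<beta> i" for i k \<beta>
        unfolding w_def by simp_all
      ultimately have "((\<lambda>\<tau>. w j (\<gamma> \<tau>)) has_real_derivative Qw \<alpha> j e) (at t within X)"
        using j five by (auto simp: Qw_def)
      then show ?thesis unfolding e_def .
    qed
  qed
qed

section \<open>Realizable input-output maps\<close>

text \<open>Choosing one solution per input yields a \<open>polynomial_trajectories\<close>
  structure in which each output component of \<open>p\<close> is an observable; everything then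
  follows from the results on observables.\<close>

lemma polynomial_realization:
  assumes U: "U \<noteq> {}" and P: "polynomial_system U q P"
    and sol: "\<And>u. u \<in> inputs_pco U \<Longrightarrow> \<exists>v. solution U q P v u (p u)"
  shows "causal U p" "\<forall>k<q. io_analytic U (io_component U p k)" "domain (obs_algebra U q p)"
    "trdeg (range (io_const U)) (obs_algebra U q p) < \<infinity>"
proof -
  let ?N = "sdim P"
  have "\<forall>\<alpha> i. \<exists>f. \<alpha> \<in> U \<longrightarrow> i < ?N \<longrightarrow> polyfun {..<?N} f \<and> (\<forall>v\<in>rspace ?N. dyn P v \<alpha> i = f v)"
    \<comment> \<open>Polynomiality is given on \<open>rspace\<close> only; the chosen
      \<open>polyfun\<close> representatives agree with the dynamics there, which is where
      trajectories live.\<close>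
    using P polynomial_on_rspace_imp_polyfun unfolding polynomial_system_def by meson
  then have "\<exists>f. \<forall>\<alpha> i. \<alpha> \<in> U \<longrightarrow> i < ?N \<longrightarrow> polyfun {..<?N} (f \<alpha> i) \<and> (\<forall>v\<in>rspace ?N. dyn P v \<alpha> i = f \<alpha> i v)"
    by (simp only: choice_iff)
  then obtain f where f: "\<And>\<alpha> i. \<alpha> \<in> U \<Longrightarrow> i < ?N \<Longrightarrow> polyfun {..<?N} (f \<alpha> i)"
    "\<And>\<alpha> i v. \<alpha> \<in> U \<Longrightarrow> i < ?N \<Longrightarrow> v \<in> rspace ?N \<Longrightarrow> dyn P v \<alpha> i = f \<alpha> i v" by blast
  have "\<forall>k. \<exists>g. k < q \<longrightarrow> polyfun {..<?N} g \<and> (\<forall>v\<in>rspace ?N. out P v k = g v)"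
    using P polynomial_on_rspace_imp_polyfun unfolding polynomial_system_def by blast
  from choice[OF this] obtain g where g: "\<And>k. k < q \<Longrightarrow> polyfun {..<?N} (g k)"
    "\<And>k v. k < q \<Longrightarrow> v \<in> rspace ?N \<Longrightarrow> out P v k = g k v" by blast
  have "\<forall>u. \<exists>v. u \<in> inputs_pco U \<longrightarrow> solution U q P v u (p u)" using sol by blast
  from choice[OF this] obtain V where V: "\<And>u. u \<in> inputs_pco U \<Longrightarrow> solution U q P (V u) u (p u)" by blast
  have Vr: "V u t \<in> rspace ?N" if "u \<in> inputs_pco U" "0 \<le> t" for u t
    using V[OF that(1)] that(2) unfolding solution_def space_ac_def by (auto dest: PiE_mem)
  interpret polynomial_trajectories U ?N f "init P" V
  proof
    show "polyfun {..<?N} (f \<alpha> i)" if "\<alpha> \<in> U" "i < ?N" for \<alpha> i by (rule f(1)[OF that])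
    fix u assume u: "u \<in> inputs_pco U"
    show "V u 0 i = init P i" for i using V[OF u] unfolding solution_def by simp
    show "abs_continuous_on 0 T (\<lambda>t. V u t i)" if "i < ?N" "0 \<le> T" for i T
      using V[OF u] that unfolding solution_def space_ac_def by auto
    have "AE t in lebesgue. 0 \<le> t \<longrightarrow>
        (\<forall>i<?N. ((\<lambda>\<tau>. V u \<tau> i) has_real_derivative dyn P (V u t) (u t) i) (at t within {0..}))"
      using V[OF u] unfolding solution_def by blast
    then show "AE t in lebesgue. 0 \<le> t \<longrightarrow>
        (\<forall>i<?N. ((\<lambda>\<tau>. V u \<tau> i) has_real_derivative f (u t) i (V u t)) (at t within {0..}))"
    proof (rule eventually_mono, intro impI allI)
      fix t i
      assume "0 \<le> t \<longrightarrow> (\<forall>i<?N. ((\<lambda>\<tau>. V u \<tau> i) has_real_derivative dyn P (V u t) (u t) i) (at t within {0..}))"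
        and t: "0 \<le> t" and i: "i < ?N"
      then show "((\<lambda>\<tau>. V u \<tau> i) has_real_derivative f (u t) i (V u t)) (at t within {0..})"
        unfolding f(2)[OF inputs_pco_right_constant(1)[OF u t] i Vr[OF u t], symmetric] by blast
    qed
  qed
  have out: "p u t = out P (V u t)" if "u \<in> inputs_pco U" "0 \<le> t" for u t
    using V[OF that(1)] that(2) unfolding solution_def by blast
  have comp: "io_component U p k = observable (g k)" if k: "k < q" for k
    using g(2)[OF k Vr] out unfolding io_component_def observable_def
    by (auto simp: fun_eq_iff restrict_def)
  show "causal U p"
    unfolding causal_def
  proof (intro ballI allI impI)
    fix u w t s assume u: "u \<in> inputs_pco U" and w: "w \<in> inputs_pco U"
      and agree: "\<forall>s\<in>{0..t}. u s = w s" and s: "s \<in> {0..t}"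
    have "V u s = V w s"
    proof
      fix i show "V u s i = V w s i"
      proof (cases "i < ?N")
        case True
        show ?thesis by (rule trajectory_unique[OF u w _ _ True]) (use agree s in auto)
      next
        case False
        \<comment> \<open>Coordinates beyond the dimension vanish on \<open>rspace\<close>, so
          agreement of the others is equality of states.\<close>
        then show ?thesis using Vr[OF u] Vr[OF w] s by (auto simp: topspace_Euclidean_space)
      qed
    qed
    then show "p u s = p w s" using out u w s by simp
  qed
  show "\<forall>k<q. io_analytic U (io_component U p k)"
    using comp observable_io_analytic g(1) by simp
  have obs: "io_component U p k \<in> observables" if "k < q" for k
    unfolding observables_def comp[OF that] using g(1)[OF that] by blast
  show "domain (obs_algebra U q p)" by (rule obs_algebra_domain(2)[OF U obs])
  have "trdeg (range (io_const U)) (obs_algebra U q p) \<le> enat ?N"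
    by (rule trdeg_obs_algebra_le[OF U obs])
  then show "trdeg (range (io_const U)) (obs_algebra U q p) < \<infinity>"
    using enat_ord_simps(4) order_le_less_trans by blast
qed

text \<open>An embedding turns a realization of \<open>p\<close> into a polynomial one.
  \<open>domain\<close> is asserted together with the bound on \<open>trdeg\<close> so that
  \<open>frac_field\<close> is a genuine field of fractions.\<close>

theorem theorem2p3:
  fixes m q :: nat and U :: "rvec set"
  assumes "U \<subseteq> rspace m" and "finite U" and "U \<noteq> {}"
  shows "(\<forall>S \<in> ode_rnn m q \<union> ode_lstm m q. \<exists>P. polynomial_embedding U q P S) \<and>
    (\<forall>p \<in> inputs_pco U \<rightarrow>\<^sub>E space_pc q.
       (\<exists>S \<in> ode_lstm m q \<union> ode_rnn m q. realization U q S p) \<longrightarrow>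
       causal U p \<and>
       (\<forall>k<q. io_analytic U (io_component U p k)) \<and>
       domain (obs_algebra U q p) \<and>
       trdeg (range (io_const U)) (obs_algebra U q p) < \<infinity>)"
proof (intro conjI ballI impI)
  show embed: "\<exists>P. polynomial_embedding U q P S" if "S \<in> ode_rnn m q \<union> ode_lstm m q" for S
    using that ode_rnn_polynomial_embedding[OF assms(2)] ode_lstm_polynomial_embedding[OF assms(2)] by blast
  fix p assume "\<exists>S \<in> ode_lstm m q \<union> ode_rnn m q. realization U q S p"
  then obtain S where S: "S \<in> ode_rnn m q \<union> ode_lstm m q" and real: "realization U q S p" by blast
  obtain P where P: "polynomial_embedding U q P S" using embed[OF S] by blast
  have system: "polynomial_system U q P" using P unfolding polynomial_embedding_def by blast
  \<comment> \<open>The embedding carries the solution of \<open>S\<close> to one of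
    \<open>P\<close> with the same input and the same output \<open>p u\<close>.\<close>
  have sol: "\<exists>v. solution U q P v u (p u)" if u: "u \<in> inputs_pco U" for u
  proof -
    obtain x y where xy: "solution U q S x u y" and "p u = y"
      using real u unfolding realization_def by (metis (mono_tags, lifting) case_prodE ex1_implies_ex)
    then show ?thesis using P unfolding polynomial_embedding_def by blast
  qed
  note * = polynomial_realization[OF assms(3) system sol]
  show "causal U p" by (rule *(1))
  show "\<forall>k<q. io_analytic U (io_component U p k)" by (rule *(2))
  show "domain (obs_algebra U q p)" by (rule *(3))
  show "trdeg (range (io_const U)) (obs_algebra U q p) < \<infinity>" by (rule *(4))
qed

end
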